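(* Let $\gamma\in\mathbb{R}$ and let $V:[0,\infty)\to\mathbb{R}$ be measurable with $\int_0^\infty(1+x)|V(x)|\,dx<\infty$. Let $N$ be the number of negative eigenvalues of the operator $H=-\frac{d^2}{dx^2}+V$ in $L_2(0,\infty)$ with boundary condition $u'(0)=\gamma u(0)$, let $w$ be the Jost function and $\eta$ the limit phase, and let $\eta(0)=\lim_{k\to0+}\eta(k)$, $\eta(\infty)=\lim_{k\to\infty}\eta(k)$. If $w(0)\ne0$, then $$\eta(\infty)-\eta(0)=\begin{cases}\pi N&\text{if }\gamma>0,\\ \pi(N-\tfrac12)&\text{if }\gamma=0,\\ \pi(N-1)&\text{if }\gamma<0.\end{cases}$$ If $w(0)=0$, then $$\eta(\infty)-\eta(0)=\begin{cases}\pi(N+\tfrac12)&\text{if }\gamma>0,\\ \pi N&\text{if }\gamma=0,\\ \pi(N-\tfrac12)&\text{if }\gamma<0.\end{cases}$$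
   Context: The operator $H$ is defined through the quadratic form $\int_0^\infty(|u'|^2+V|u|^2)\,dx+\gamma|u(0)|^2$ with form domain $H^1(0,\infty)$; under the moment condition $N$ is finite. For $\zeta\neq0$, $\operatorname{Im}\zeta\ge0$, the Jost solution $\theta(x,\zeta)$ is the unique solution of $-u''+Vu=\zeta^2u$ on $x>0$ with $\theta(x,\zeta)=e^{i\zeta x}(1+o(1))$, $\theta'(x,\zeta)=i\zeta e^{i\zeta x}(1+o(1))$ as $x\to\infty$ (prime $=d/dx$). The Jost function is $w(\zeta)=\gamma\theta(0,\zeta)-\theta'(0,\zeta)$. Under the moment condition $w$ extends continuously to $\zeta=0$ (within $\operatorname{Im}\zeta\ge0$), and $w(0)$ denotes this value. Moreover $w(k)\ne0$ for $k>0$ and $w(\zeta)/(\gamma-i\zeta)\to1$ as $|\zeta|\to\infty$. The limit amplitude $a(k)>0$ and limit phase $\eta(k)\in\mathbb{R}$, $k>0$, are defined by $w(k)=a(k)e^{i\eta(k)}(\gamma-ik)$, where $\eta$ is the continuous branch on $(0,\infty)$ with $\eta(k)\to0$ as $k\to\infty$. *)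

theory Defs
  imports "HOL-Analysis.Analysis"
begin

text \<open>
  Functions on the half-line are total functions on \<open>real\<close>; only their values
  on \<open>{0..}\<close> matter in everything below.
\<close>

definition L2_half :: "(real \<Rightarrow> complex) \<Rightarrow> bool" where
  "L2_half f \<longleftrightarrow> set_borel_measurable lebesgue {0..} f \<and>
     set_integrable lebesgue {0..} (\<lambda>x. (cmod (f x))\<^sup>2)"

text \<open>
  \<open>f\<close> is locally absolutely continuous on \<open>{0..}\<close> and \<open>g\<close> is its almost everywhere
  derivative, written in integrated form.
\<close>

definition has_ac_deriv :: "(real \<Rightarrow> complex) \<Rightarrow> (real \<Rightarrow> complex) \<Rightarrow> bool" where
  "has_ac_deriv f g \<longleftrightarrow>
     (\<forall>x\<ge>0. set_integrable lebesgue {0..x} g \<and>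
             f x = f 0 + (LINT t:{0..x}|lebesgue. g t))"

text \<open>
  \<open>H1_half u u'\<close>: \<open>u\<close> is the absolutely continuous representative of an element of
  the Sobolev space \<open>H\<^sup>1(0,\<infinity>)\<close>, with weak derivative \<open>u'\<close> (determined by \<open>u\<close> only
  up to a null set).
\<close>

definition H1_half :: "(real \<Rightarrow> complex) \<Rightarrow> (real \<Rightarrow> complex) \<Rightarrow> bool" where
  "H1_half u u' \<longleftrightarrow> L2_half u \<and> L2_half u' \<and> has_ac_deriv u u'"

text \<open>
  The sesquilinear form polarizing \<open>\<integral>(\<bar>u'\<bar>\<^sup>2 + V \<bar>u\<bar>\<^sup>2) dx + \<gamma> \<bar>u(0)\<bar>\<^sup>2\<close>.
\<close>

definition schroedinger_form ::
  "real \<Rightarrow> (real \<Rightarrow> real) \<Rightarrow> (real \<Rightarrow> complex) \<Rightarrow> (real \<Rightarrow> complex) \<Rightarrow>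
   (real \<Rightarrow> complex) \<Rightarrow> (real \<Rightarrow> complex) \<Rightarrow> complex" where
  "schroedinger_form \<gamma> V u u' v v' =
     (LINT x:{0..}|lebesgue. u' x * cnj (v' x) + complex_of_real (V x) * (u x * cnj (v x)))
     + complex_of_real \<gamma> * (u 0 * cnj (v 0))"

text \<open>
  The graph of the operator \<open>H\<close> associated with the form: \<open>u\<close> lies in its domain and
  \<open>H u = f\<close> iff \<open>u\<close> lies in the form domain and \<open>h[u, v] = (f, v)\<close> for all \<open>v\<close> in the
  form domain. The boundary condition \<open>u'(0) = \<gamma> u(0)\<close> is encoded in the term at \<open>0\<close>.
\<close>

definition schroedinger_op ::
  "real \<Rightarrow> (real \<Rightarrow> real) \<Rightarrow> (real \<Rightarrow> complex) \<Rightarrow> (real \<Rightarrow> complex) \<Rightarrow> bool" where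
  "schroedinger_op \<gamma> V u f \<longleftrightarrow> L2_half f \<and>
     (\<exists>u'. H1_half u u' \<and>
       (\<forall>v v'. H1_half v v' \<longrightarrow>
          schroedinger_form \<gamma> V u u' v v' = (LINT x:{0..}|lebesgue. f x * cnj (v x))))"

definition is_eigenvalue :: "real \<Rightarrow> (real \<Rightarrow> real) \<Rightarrow> real \<Rightarrow> bool" where
  "is_eigenvalue \<gamma> V \<mu> \<longleftrightarrow>
     (\<exists>u. (\<exists>x\<ge>0. u x \<noteq> 0) \<and> schroedinger_op \<gamma> V u (\<lambda>x. complex_of_real \<mu> * u x))"

definition negative_eigenvalues :: "real \<Rightarrow> (real \<Rightarrow> real) \<Rightarrow> real set" where
  "negative_eigenvalues \<gamma> V = {\<mu>. \<mu> < 0 \<and> is_eigenvalue \<gamma> V \<mu>}"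

text \<open>The derivative on \<open>{0..}\<close>, one-sided at \<open>0\<close>.\<close>

definition half_deriv :: "(real \<Rightarrow> complex) \<Rightarrow> real \<Rightarrow> complex" where
  "half_deriv u x = vector_derivative u (at x within {0..})"

text \<open>
  Solutions of \<open>-u'' + V u = z u\<close> in the usual sense for a locally integrable potential:
  \<open>u\<close> is differentiable, \<open>u'\<close> is locally absolutely continuous and \<open>u'' = (V - z) u\<close>
  almost everywhere. As \<open>V\<close> is integrable near \<open>0\<close>, solutions on \<open>{0<..}\<close> extend to \<open>0\<close>.
\<close>

definition schroedinger_solution :: "(real \<Rightarrow> real) \<Rightarrow> complex \<Rightarrow> (real \<Rightarrow> complex) \<Rightarrow> bool" where
  "schroedinger_solution V z u \<longleftrightarrow>
     u differentiable_on {0..} \<and>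
     has_ac_deriv (half_deriv u) (\<lambda>x. (complex_of_real (V x) - z) * u x)"

definition is_jost_solution :: "(real \<Rightarrow> real) \<Rightarrow> complex \<Rightarrow> (real \<Rightarrow> complex) \<Rightarrow> bool" where
  "is_jost_solution V \<zeta> \<theta> \<longleftrightarrow>
     schroedinger_solution V (\<zeta>\<^sup>2) \<theta> \<and>
     ((\<lambda>x. \<theta> x / exp (\<i> * \<zeta> * of_real x)) \<longlongrightarrow> 1) at_top \<and>
     ((\<lambda>x. half_deriv \<theta> x / (\<i> * \<zeta> * exp (\<i> * \<zeta> * of_real x))) \<longlongrightarrow> 1) at_top"

text \<open>
  Existence, and uniqueness on \<open>{0..}\<close>, hold for integrable \<open>V\<close> and \<open>\<zeta> \<noteq> 0\<close>, \<open>Im \<zeta> \<ge> 0\<close>.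
  Choice rather than definite description is used because the values on the negative
  half-line are arbitrary; the same applies to \<open>limit_phase\<close> below.
\<close>

definition jost_solution :: "(real \<Rightarrow> real) \<Rightarrow> complex \<Rightarrow> real \<Rightarrow> complex" where
  "jost_solution V \<zeta> = (SOME \<theta>. is_jost_solution V \<zeta> \<theta>)"

definition jost_function_nz :: "real \<Rightarrow> (real \<Rightarrow> real) \<Rightarrow> complex \<Rightarrow> complex" where
  "jost_function_nz \<gamma> V \<zeta> =
     complex_of_real \<gamma> * jost_solution V \<zeta> 0 - half_deriv (jost_solution V \<zeta>) 0"

text \<open>The Jost function \<open>w\<close> on \<open>Im \<zeta> \<ge> 0\<close>, extended by continuity to \<open>\<zeta> = 0\<close>.\<close>

definition jost_function :: "real \<Rightarrow> (real \<Rightarrow> real) \<Rightarrow> complex \<Rightarrow> complex" where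
  "jost_function \<gamma> V \<zeta> =
     (if \<zeta> = 0 then Lim (at 0 within {z. Im z \<ge> 0}) (jost_function_nz \<gamma> V)
      else jost_function_nz \<gamma> V \<zeta>)"

definition is_limit_phase :: "real \<Rightarrow> (real \<Rightarrow> real) \<Rightarrow> (real \<Rightarrow> real) \<Rightarrow> bool" where
  "is_limit_phase \<gamma> V \<eta> \<longleftrightarrow>
     continuous_on {0<..} \<eta> \<and> (\<eta> \<longlongrightarrow> 0) at_top \<and>
     (\<forall>k>0. \<exists>a>0. jost_function \<gamma> V (complex_of_real k) =
        complex_of_real a * exp (\<i> * complex_of_real (\<eta> k)) *
        (complex_of_real \<gamma> - \<i> * complex_of_real k))"

definition limit_phase :: "real \<Rightarrow> (real \<Rightarrow> real) \<Rightarrow> real \<Rightarrow> real" where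
  "limit_phase \<gamma> V = (SOME \<eta>. is_limit_phase \<gamma> V \<eta>)"

end

theory Submission
  imports Defs
begin

text \<open>
  Substituting \<open>\<theta> = exp (\<i> \<zeta> x) m\<close> turns the equation of the Jost solution into a Volterra
  equation for \<open>m\<close> whose kernel is bounded by \<open>y\<close> uniformly in the closed half-plane, so that
  \<open>m\<close>, and with it \<open>w\<close>, is continuous there including \<open>\<zeta> = 0\<close>. Wronskian identities show that the
  zeros of \<open>w\<close> lie on the imaginary half-axis and that \<open>w\<close> is there \<open>\<zeta> - \<zeta>\<^sub>0\<close> times a continuous
  function not vanishing at \<open>\<zeta>\<^sub>0\<close>; this includes \<open>\<zeta>\<^sub>0 = 0\<close>. Their number (without \<open>0\<close>) is the
  number of negative eigenvalues. Dividing \<open>w\<close> by \<open>-\<i> \<zeta>\<close> and by the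
  factors \<open>(\<zeta> - \<i> \<kappa>) / (\<zeta> + \<i> \<kappa>)\<close> leaves a continuous function without zeros on the
  first quadrant that is real on the imaginary axis and tends to \<open>1\<close> at infinity. The phase of
  this quotient vanishes at both ends of the positive half-axis, hence the limit phase at \<open>0\<close> is
  that of the explicit factors. No holomorphy and no argument principle is needed.
\<close>

section \<open>Absolutely continuous functions on the half-line\<close>

text \<open>The potential is merely measurable, so second derivatives of solutions exist only almost
  everywhere. Differential identities are therefore carried by \<open>has_ac_deriv\<close>, and
  half-line integrals are evaluated by a primitive with a limit at infinity. For a zero a of w, the
  Wronskian with the solution at a directly displays w(\<zeta>) as \<zeta> - a times an integral
  continuous in \<zeta>. At a = 0 the Jost solution does not decay; there the identity is used for
  m, and the integral converges because the first moment makes the tails of |V| integrable. The half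
  steps of the formula come from the behavior at 0. If w(0) = 0, the divisor -\<i>\<zeta> removes
  this zero; otherwise it would create a pole, and -\<i>(\<zeta> + \<i>) takes its place, whose
  phase changes by pi/2 along the positive half-axis. The factor \<gamma> - \<i>k in the definition
  of the phase contributes sgn \<gamma> times pi/2 in the same way, and each quotient (\<zeta> -
  \<i>\<kappa>)/(\<zeta> + \<i>\<kappa>) contributes pi.\<close>

lemma has_ac_deriv_iff_integral:
  "has_ac_deriv f g \<longleftrightarrow> (\<forall>x\<ge>0. g absolutely_integrable_on {0..x} \<and> f x = f 0 + integral {0..x} g)"
  unfolding has_ac_deriv_def by (metis set_lebesgue_integral_eq_integral(2))

lemma has_ac_derivD:
  assumes "has_ac_deriv f g" "x \<ge> 0"
  shows "g absolutely_integrable_on {0..x}" "f x = f 0 + integral {0..x} g"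
    "f x = f 0 + (LINT t:{0..x}|lebesgue. g t)"
  using assms unfolding has_ac_deriv_def by (metis set_lebesgue_integral_eq_integral(2))+

lemma has_ac_deriv_integrable:
  assumes "has_ac_deriv f g" "0 \<le> a"
  shows "g absolutely_integrable_on {a..b}"
proof (cases "a \<le> b")
  case True
  then have "g absolutely_integrable_on {0..b}" using has_ac_derivD(1) assms by simp
  then show ?thesis by (rule set_integrable_subset) (use assms in auto)
qed (simp add: set_integrable_def)

lemma has_ac_deriv_increment:
  assumes "has_ac_deriv f g" "0 \<le> a" "a \<le> b"
  shows "f b - f a = integral {a..b} g"
proof -
  have "g integrable_on {0..b}"
    using has_ac_deriv_integrable[OF assms(1), of 0 b] by (simp add: set_lebesgue_integral_eq_integral(1))
  then have "integral {0..a} g + integral {a..b} g = integral {0..b} g"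
    using assms by (intro Henstock_Kurzweil_Integration.integral_combine) auto
  moreover have "f b = f 0 + integral {0..b} g" "f a = f 0 + integral {0..a} g"
    using has_ac_derivD(2)[OF assms(1), of a] has_ac_derivD(2)[OF assms(1), of b] assms(2,3) by simp_all
  ultimately show ?thesis by (simp add: algebra_simps)
qed

text \<open>Limits at \<open>x\<close> see only nearby points; this transfers results on compact
  intervals to the half-line.\<close>

lemma at_within_half_line: "at x within {0..x + 1} = at x within {0..}" for x :: real
  by (rule at_within_nhd[of _ "{..<x + 1}"]) auto

lemma continuous_on_indefinite_integral:
  fixes g :: "real \<Rightarrow> 'a::banach"
  assumes "\<And>b. g integrable_on {0..b}"
  shows "continuous_on {0..} (\<lambda>x. integral {0..x} g)"
proof -
  have "continuous (at x within {0..}) (\<lambda>x. integral {0..x} g)" if "x \<ge> 0" for x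
    using indefinite_integral_continuous_1[OF assms, of "x + 1"] that
    by (simp add: continuous_on_eq_continuous_within flip: at_within_half_line)
  then show ?thesis by (simp add: continuous_on_eq_continuous_within)
qed

lemma has_ac_deriv_continuous_on:
  assumes "has_ac_deriv f g"
  shows "continuous_on {0..} f"
proof -
  have "g integrable_on {0..b}" for b
    using has_ac_deriv_integrable[OF assms, of 0 b] by (simp add: set_lebesgue_integral_eq_integral(1))
  then have "continuous_on {0..} (\<lambda>x. f 0 + integral {0..x} g)"
    by (intro continuous_intros continuous_on_indefinite_integral)
  then show ?thesis
    by (rule continuous_on_eq) (metis assms atLeast_iff has_ac_derivD(2))
qed

text \<open>Subdivision chains the local estimates into one on [0, x], where the increment of
  \<open>\<Phi>\<close> is fixed while \<epsilon> is arbitrary. In the product rule below,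
  \<open>\<Phi>\<close> integrates the norms of both derivatives.\<close>

lemma const_if_locally_dominated:
  fixes h :: "real \<Rightarrow> 'a::real_normed_vector" and \<Phi> :: "real \<Rightarrow> real"
  assumes "\<And>\<epsilon> x. \<epsilon> > 0 \<Longrightarrow> 0 \<le> x \<Longrightarrow>
      \<exists>\<delta>>0. \<forall>a b :: real. 0 \<le> a \<and> a \<le> x \<and> x \<le> b \<and> b - a < \<delta> \<longrightarrow> norm (h b - h a) \<le> \<epsilon> * (\<Phi> b - \<Phi> a)"
    and "0 \<le> (x::real)"
  shows "h x = h 0"
proof -
  have *: "norm (h x - h 0) \<le> \<epsilon> * (\<Phi> x - \<Phi> 0)" if "\<epsilon> > 0" for \<epsilon>
  proof -
    have "0 \<le> (0::real) \<longrightarrow> norm (h x - h 0) \<le> \<epsilon> * (\<Phi> x - \<Phi> 0)"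
    \<comment> \<open>\<open>Bolzano\<close> offers every real interval around the point, including
      those that start left of 0; the premise makes the predicate vacuous there.\<close>
    proof (rule Bolzano[of 0 x "\<lambda>a b. 0 \<le> a \<longrightarrow> norm (h b - h a) \<le> \<epsilon> * (\<Phi> b - \<Phi> a)"])
      fix a b c :: real
      assume "0 \<le> a \<longrightarrow> norm (h b - h a) \<le> \<epsilon> * (\<Phi> b - \<Phi> a)"
        "0 \<le> b \<longrightarrow> norm (h c - h b) \<le> \<epsilon> * (\<Phi> c - \<Phi> b)" "a \<le> b" "b \<le> c"
      moreover have "norm (h c - h a) \<le> norm (h c - h b) + norm (h b - h a)"
        using norm_triangle_ineq[of "h c - h b" "h b - h a"] by simp
      moreover have "\<epsilon> * (\<Phi> c - \<Phi> b) + \<epsilon> * (\<Phi> b - \<Phi> a) = \<epsilon> * (\<Phi> c - \<Phi> a)"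
        by (simp add: right_diff_distrib)
      ultimately show "0 \<le> a \<longrightarrow> norm (h c - h a) \<le> \<epsilon> * (\<Phi> c - \<Phi> a)"
        by linarith
    next
      fix y :: real assume "0 \<le> y"
      show "\<exists>d>0. \<forall>a b. a \<le> y \<and> y \<le> b \<and> b - a < d \<longrightarrow> 0 \<le> a \<longrightarrow>
             norm (h b - h a) \<le> \<epsilon> * (\<Phi> b - \<Phi> a)"
        using assms(1)[OF that \<open>0 \<le> y\<close>] by blast
    qed (use assms in auto)
    then show ?thesis by simp
  qed
  have "norm (h x - h 0) \<le> 0"
  proof (rule field_le_epsilon)
    fix e :: real assume "e > 0"
    \<comment> \<open>The added 1 keeps the divisor positive when
      \<open>\<Phi> x = \<Phi> 0\<close>.\<close>
    define c where "c = \<bar>\<Phi> x - \<Phi> 0\<bar> + 1"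
    have "norm (h x - h 0) \<le> e / c * (\<Phi> x - \<Phi> 0)" using *[of "e / c"] \<open>e > 0\<close> by (simp add: c_def)
    also have "\<dots> \<le> e / c * c" using \<open>e > 0\<close> by (intro mult_left_mono) (auto simp: c_def)
    also have "\<dots> = e" by (simp add: c_def)
    finally show "norm (h x - h 0) \<le> 0 + e" by simp
  qed
  then show ?thesis by simp
qed

lemma absolutely_integrable_mult_continuous:
  fixes f g :: "real \<Rightarrow> complex"
  assumes "f absolutely_integrable_on {a..b}" "continuous_on {a..b} g"
  shows "(\<lambda>x. f x * g x) absolutely_integrable_on {a..b}" "(\<lambda>x. g x * f x) absolutely_integrable_on {a..b}"
proof -
  have "(\<lambda>x. g x * f x) absolutely_integrable_on {a..b}"
  proof (rule absolutely_integrable_bounded_measurable_product[of "(*)" g "{a..b}" f])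
    show "bilinear ((*) :: complex \<Rightarrow> _)"
      unfolding bilinear_conv_bounded_bilinear by (rule bounded_bilinear_mult)
    show "g \<in> borel_measurable (lebesgue_on {a..b})"
      by (rule continuous_imp_measurable_on_sets_lebesgue) (use assms in auto)
    show "bounded (g ` {a..b})" using assms by (intro compact_imp_bounded compact_continuous_image) auto
  qed (use assms in auto)
  then show "(\<lambda>x. f x * g x) absolutely_integrable_on {a..b}" "(\<lambda>x. g x * f x) absolutely_integrable_on {a..b}"
    by (simp_all add: mult.commute)
qed

lemma has_ac_derivI:
  assumes "\<And>x. x \<ge> 0 \<Longrightarrow> g absolutely_integrable_on {0..x}" "\<And>x. x \<ge> 0 \<Longrightarrow> f x = f 0 + integral {0..x} g"
  shows "has_ac_deriv f g"
  using assms unfolding has_ac_deriv_iff_integral by blast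

text \<open>The product minus the integral of its expected derivative is constant: over a short
  interval its increment is an integral in which \<open>f'\<close> and \<open>g'\<close> are
  multiplied only by small oscillations of \<open>g\<close> and \<open>f\<close>.\<close>

lemma has_ac_deriv_mult:
  assumes "has_ac_deriv f f'" "has_ac_deriv g g'"
  shows "has_ac_deriv (\<lambda>x. f x * g x) (\<lambda>x. f' x * g x + f x * g' x)"
proof -
  let ?p = "\<lambda>x. f' x * g x + f x * g' x"
  define h where "h x = f x * g x - integral {0..x} ?p" for x
  define \<Phi> where "\<Phi> x = integral {0..x} (\<lambda>t. norm (f' t) + norm (g' t))" for x
  have fi: "f' absolutely_integrable_on {a..b}" "g' absolutely_integrable_on {a..b}" if "0 \<le> a" for a b
    using has_ac_deriv_integrable assms that by auto
  have fc: "continuous_on {a..b} f" "continuous_on {a..b} g" if "0 \<le> a" for a b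
    using that by (auto intro!: continuous_on_subset[OF has_ac_deriv_continuous_on] assms)
  have pi: "?p absolutely_integrable_on {a..b}" if "0 \<le> a" for a b
    by (intro set_integral_add absolutely_integrable_mult_continuous fi fc that)
  have ni: "(\<lambda>t. norm (f' t) + norm (g' t)) absolutely_integrable_on {a..b}" if "0 \<le> a" for a b
    by (intro set_integral_add set_integrable_norm fi that)
  have int: "u integrable_on S" if "u absolutely_integrable_on S" for u :: "real \<Rightarrow> 'z::euclidean_space" and S
    using that by (simp add: set_lebesgue_integral_eq_integral(1))
  have hc: "h x = h 0" if "x \<ge> 0" for x
  proof (rule const_if_locally_dominated[where \<Phi> = \<Phi>])
    fix \<epsilon> x :: real assume "\<epsilon> > 0" "0 \<le> x"
    have "continuous (at x within {0..}) f" "continuous (at x within {0..}) g"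
      using assms[THEN has_ac_deriv_continuous_on] \<open>0 \<le> x\<close> by (auto simp: continuous_on_eq_continuous_within)
    then obtain d1 d2 where d: "d1 > 0" "\<And>t. t \<in> {0..} \<Longrightarrow> dist t x < d1 \<Longrightarrow> dist (f t) (f x) < \<epsilon>/2"
      "d2 > 0" "\<And>t. t \<in> {0..} \<Longrightarrow> dist t x < d2 \<Longrightarrow> dist (g t) (g x) < \<epsilon>/2"
      using \<open>\<epsilon> > 0\<close> unfolding continuous_within_eps_delta by (metis half_gt_zero)
    show "\<exists>\<delta>>0. \<forall>a b. 0 \<le> a \<and> a \<le> x \<and> x \<le> b \<and> b - a < \<delta> \<longrightarrow> norm (h b - h a) \<le> \<epsilon> * (\<Phi> b - \<Phi> a)"
    proof (intro exI[of _ "min d1 d2"] conjI allI impI)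
      fix a b assume ab: "0 \<le> a \<and> a \<le> x \<and> x \<le> b \<and> b - a < min d1 d2"
      have F: "norm (f b - f t) \<le> \<epsilon>" "norm (g a - g t) \<le> \<epsilon>" if "t \<in> {a..b}" for t
      proof -
        have "dist (f t) (f x) < \<epsilon>/2" "dist (f b) (f x) < \<epsilon>/2" "dist (g t) (g x) < \<epsilon>/2" "dist (g a) (g x) < \<epsilon>/2"
          using ab that by (auto intro!: d(2) d(4) simp: dist_real_def simp del: divide_const_simps)
        then have "dist (f b) (f t) < \<epsilon>" "dist (g a) (g t) < \<epsilon>"
          by (metis dist_commute dist_triangle_half_l)+
        then show "norm (f b - f t) \<le> \<epsilon>" "norm (g a - g t) \<le> \<epsilon>" by (auto simp: dist_norm)
      qed
      have split: "integral {0..b} u - integral {0..a} u = integral {a..b} u"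
        if "u absolutely_integrable_on {0..b}" for u :: "real \<Rightarrow> 'z::euclidean_space"
        using Henstock_Kurzweil_Integration.integral_combine[of 0 a b u] ab int[OF that] by (simp add: algebra_simps)
      have fd: "f b - f a = integral {a..b} f'" "g b - g a = integral {a..b} g'"
        using has_ac_deriv_increment assms ab by auto
      \<comment> \<open>The factors are frozen at opposite endpoints, \<open>f\<close> at
        \<open>b\<close> and \<open>g\<close> at \<open>a\<close>; this makes the splitting exact,
        with no quadratic remainder.\<close>
      have "h b - h a = f b * (g b - g a) + (f b - f a) * g a - integral {a..b} ?p"
        unfolding split[OF pi[of 0 b], symmetric, OF order_refl] by (simp add: h_def algebra_simps)
      also have "\<dots> = integral {a..b} (\<lambda>t. f b * g' t) + integral {a..b} (\<lambda>t. f' t * g a) - integral {a..b} ?p"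
        by (simp add: fd)
      also have "\<dots> = integral {a..b} (\<lambda>t. f b * g' t + f' t * g a) - integral {a..b} ?p"
        using ab by (subst integral_add) (auto intro!: int fi set_integrable_mult_right set_integrable_mult_left)
      also have "\<dots> = integral {a..b} (\<lambda>t. f b * g' t + f' t * g a - ?p t)"
        using ab by (subst integral_diff)
          (auto intro!: integrable_add int fi pi set_integrable_mult_right set_integrable_mult_left)
      also have "\<dots> = integral {a..b} (\<lambda>t. (f b - f t) * g' t + f' t * (g a - g t))"
        by (rule integral_cong) (auto simp: algebra_simps)
      also have "norm \<dots> \<le> integral {a..b} (\<lambda>t. \<epsilon> * (norm (f' t) + norm (g' t)))"
      proof (rule integral_norm_bound_integral)
        show "(\<lambda>t. (f b - f t) * g' t + f' t * (g a - g t)) integrable_on {a..b}"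
          using ab by (intro int set_integral_add absolutely_integrable_mult_continuous fi continuous_intros fc) auto
        show "(\<lambda>t. \<epsilon> * (norm (f' t) + norm (g' t))) integrable_on {a..b}"
          using ab by (intro int set_integrable_mult_right ni) auto
        fix t assume "t \<in> {a..b}"
        then have "norm ((f b - f t) * g' t) \<le> \<epsilon> * norm (g' t)" "norm (f' t * (g a - g t)) \<le> \<epsilon> * norm (f' t)"
          using F by (auto simp: norm_mult intro!: mult_right_mono) (metis mult.commute mult_right_mono norm_ge_zero)
        then show "norm ((f b - f t) * g' t + f' t * (g a - g t)) \<le> \<epsilon> * (norm (f' t) + norm (g' t))"
          by (intro order_trans[OF norm_triangle_ineq]) (auto simp: algebra_simps)
      qed
      also have "\<dots> = \<epsilon> * (\<Phi> b - \<Phi> a)"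
        unfolding \<Phi>_def using ab by (subst split) (auto intro!: ni)
      finally show "norm (h b - h a) \<le> \<epsilon> * (\<Phi> b - \<Phi> a)" .
    qed (use d in auto)
  qed (use that in auto)
  show ?thesis
  proof (rule has_ac_derivI)
    fix x :: real assume "x \<ge> 0"
    show "f x * g x = f 0 * g 0 + integral {0..x} ?p"
      using hc[OF \<open>x \<ge> 0\<close>] unfolding h_def by (simp add: diff_eq_eq)
  qed (use pi in auto)
qed

section \<open>Linear operations and the link with classical derivatives\<close>

lemma has_ac_deriv_add:
  assumes "has_ac_deriv f f'" "has_ac_deriv g g'"
  shows "has_ac_deriv (\<lambda>x. f x + g x) (\<lambda>x. f' x + g' x)"
  unfolding has_ac_deriv_def
proof (intro allI impI conjI)
  fix x :: real assume "x \<ge> 0"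
  then have *: "set_integrable lebesgue {0..x} f'" "set_integrable lebesgue {0..x} g'"
    "f x = f 0 + (LINT t:{0..x}|lebesgue. f' t)" "g x = g 0 + (LINT t:{0..x}|lebesgue. g' t)"
    using assms unfolding has_ac_deriv_def by blast+
  then show "set_integrable lebesgue {0..x} (\<lambda>x. f' x + g' x)"
    "f x + g x = f 0 + g 0 + (LINT t:{0..x}|lebesgue. f' t + g' t)"
    by (simp_all only: set_integral_add add_ac)
qed

lemma has_ac_deriv_cmult:
  assumes "has_ac_deriv f f'"
  shows "has_ac_deriv (\<lambda>x. c * f x) (\<lambda>x. c * f' x)"
  unfolding has_ac_deriv_def
proof (intro allI impI conjI)
  fix x :: real assume "x \<ge> 0"
  note D = has_ac_derivD[OF assms this]
  show "set_integrable lebesgue {0..x} (\<lambda>x. c * f' x)" using D(1) by simp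
  show "c * f x = c * f 0 + (LINT t:{0..x}|lebesgue. c * f' t)"
    by (subst D(3)) (simp add: distrib_left)
qed

lemma has_ac_deriv_cong:
  assumes "has_ac_deriv f f'" "\<And>x. x \<ge> 0 \<Longrightarrow> f x = g x" "\<And>x. x \<ge> 0 \<Longrightarrow> f' x = g' x"
  shows "has_ac_deriv g g'"
proof -
  have "set_integrable lebesgue {0..x} f' = set_integrable lebesgue {0..x} g'" for x
    by (rule set_integrable_cong) (use assms in auto)
  moreover have "(LINT t:{0..x}|lebesgue. f' t) = (LINT t:{0..x}|lebesgue. g' t)" for x
    by (rule set_lebesgue_integral_cong) (use assms in auto)
  ultimately show ?thesis using assms(1,2) unfolding has_ac_deriv_def by (metis order_refl)
qed

lemma has_ac_deriv_const: "has_ac_deriv (\<lambda>x. c) (\<lambda>x. 0)"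
  unfolding has_ac_deriv_def by (simp add: set_integrable_def)

lemma has_ac_deriv_diff:
  assumes "has_ac_deriv f f'" "has_ac_deriv g g'"
  shows "has_ac_deriv (\<lambda>x. f x - g x) (\<lambda>x. f' x - g' x)"
  using has_ac_deriv_add[OF assms(1) has_ac_deriv_cmult[OF assms(2), of "-1"]] by simp

lemma has_ac_deriv_cnj:
  assumes "has_ac_deriv f f'"
  shows "has_ac_deriv (\<lambda>x. cnj (f x)) (\<lambda>x. cnj (f' x))"
  unfolding has_ac_deriv_def set_integrable_def set_lebesgue_integral_def
proof (intro allI impI conjI)
  fix x :: real assume "x \<ge> 0"
  note * = has_ac_derivD[OF assms this, unfolded set_integrable_def set_lebesgue_integral_def]
  have eq: "(\<lambda>t. indicat_real {0..x} t *\<^sub>R cnj (f' t)) = (\<lambda>t. cnj (indicat_real {0..x} t *\<^sub>R f' t))"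
    by (auto simp: scaleR_conv_of_real)
  show "integrable lebesgue (\<lambda>t. indicat_real {0..x} t *\<^sub>R cnj (f' t))"
    unfolding eq by (rule integrable_cnj) (rule *(1))
  show "cnj (f x) = cnj (f 0) + (LINT t|lebesgue. indicat_real {0..x} t *\<^sub>R cnj (f' t))"
    using arg_cong[OF *(3), of cnj] unfolding complex_cnj_add eq Bochner_Integration.integral_cnj .
qed

lemma has_ac_deriv_C1:
  assumes "\<And>x. x \<ge> 0 \<Longrightarrow> (f has_vector_derivative g x) (at x within {0..})" "continuous_on {0..} g"
  shows "has_ac_deriv f g"
proof (rule has_ac_derivI)
  fix x :: real assume "x \<ge> 0"
  have c: "continuous_on {0..x} g" using assms(2) by (rule continuous_on_subset) auto
  then show "g absolutely_integrable_on {0..x}" by (rule absolutely_integrable_continuous_real)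
  have "(g has_integral (f x - f 0)) {0..x}"
    using \<open>x \<ge> 0\<close> assms(1)
    by (intro fundamental_theorem_of_calculus) (auto intro: has_vector_derivative_within_subset[where S = "{0..}"])
  then show "f x = f 0 + integral {0..x} g" by (simp add: integral_unique)
qed

lemma has_ac_deriv_has_vector_derivative:
  assumes "has_ac_deriv f g" "continuous_on {0..} g" "x \<ge> 0"
  shows "(f has_vector_derivative g x) (at x within {0..})"
proof -
  have c: "continuous_on {0..x+1} g" using assms(2) by (rule continuous_on_subset) auto
  have "((\<lambda>u. integral {0..u} g) has_vector_derivative g x) (at x within {0..x+1})"
    by (rule integral_has_vector_derivative) (use c assms in auto)
  then have "((\<lambda>u. f 0 + integral {0..u} g) has_vector_derivative g x) (at x within {0..x+1})"
    by (auto intro!: derivative_eq_intros)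
  then have "((\<lambda>u. f 0 + integral {0..u} g) has_vector_derivative g x) (at x within {0..})"
    unfolding at_within_half_line .
  then show ?thesis
    by (rule has_vector_derivative_transform[rotated 2])
       (use assms in simp, metis assms(1) atLeast_iff has_ac_derivD(2))
qed

lemma vector_derivative_half_line:
  assumes "(f has_vector_derivative d) (at x within {0..})" "(x::real) \<ge> 0"
  shows "vector_derivative f (at x within {0..}) = d"
proof (rule vector_derivative_within[OF _ assms(1)])
  show "at x within {0..} \<noteq> bot"
  proof
    assume "at x within {0..} = bot"
    moreover have "at_right x \<le> at x within {0..}" by (rule at_le) (use assms in auto)
    ultimately show False by (simp add: bot.extremum_unique)
  qed
qed

section \<open>The fundamental theorem of calculus on the whole half-line\<close>

lemma has_ac_deriv_tendsto:
  assumes "has_ac_deriv f g" "set_integrable lebesgue {0..} g"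
  shows "(f \<longlongrightarrow> f 0 + (LINT t:{0..}|lebesgue. g t)) at_top"
proof -
  have "((\<lambda>x. f 0 + (LINT t:{0..x}|lebesgue. g t)) \<longlongrightarrow> f 0 + (LINT t:{0..}|lebesgue. g t)) at_top"
    by (intro tendsto_intros tendsto_set_lebesgue_integral_at_top assms) auto
  then show ?thesis
    by (rule Lim_transform_eventually)
       (intro eventually_mono[OF eventually_ge_at_top[of 0]], metis assms(1) has_ac_derivD(3))
qed

text \<open>The Wronskian identities are all integrated in this way, the values at 0 and at infinity
  being the two boundary terms.\<close>

lemma has_ac_deriv_LINT:
  assumes "has_ac_deriv f g" "set_integrable lebesgue {0..} g" "(f \<longlongrightarrow> l) at_top"
  shows "(LINT t:{0..}|lebesgue. g t) = l - f 0"
  using tendsto_unique[OF _ has_ac_deriv_tendsto[OF assms(1,2)] assms(3)] by (simp add: algebra_simps)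

lemma LINT_tail:
  fixes g :: "real \<Rightarrow> 'a::{banach,second_countable_topology}"
  assumes "set_integrable lebesgue {0..} g" "x \<ge> 0"
  shows "(LINT t:{x..}|lebesgue. g t) = (LINT t:{0..}|lebesgue. g t) - (LINT t:{0..x}|lebesgue. g t)"
proof -
  have eq: "{0..} = {0..<x} \<union> {x..}" using assms by auto
  have "(LINT t:{0..}|lebesgue. g t) = (LINT t:{0..<x}|lebesgue. g t) + (LINT t:{x..}|lebesgue. g t)"
    unfolding eq by (rule set_integral_Un) (auto intro!: set_integrable_subset[OF assms(1)] simp: assms)
  moreover have "(LINT t:{0..<x}|lebesgue. g t) = (LINT t:{0..x}|lebesgue. g t)"
  proof (rule set_integral_cong_set)
    have "set_integrable lebesgue {0..<x} g" "set_integrable lebesgue {0..x} g"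
      by (auto intro!: set_integrable_subset[OF assms(1)])
    then show "set_borel_measurable lebesgue {0..<x} g" "set_borel_measurable lebesgue {0..x} g"
      unfolding set_integrable_def set_borel_measurable_def by auto
    show "AE t in lebesgue. (t \<in> {0..x}) = (t \<in> {0..<x})"
      by (rule AE_I[of _ _ "{x}"]) auto
  qed
  ultimately show ?thesis by (simp add: algebra_simps)
qed

text \<open>The tail is the primitive of \<open>- g\<close> that vanishes at infinity, the right
  normalisation for solutions that are prescribed there.\<close>

lemma has_ac_deriv_tail:
  assumes "set_integrable lebesgue {0..} g"
  shows "has_ac_deriv (\<lambda>x. LINT t:{x..}|lebesgue. g t) (\<lambda>x. - g x)"
  unfolding has_ac_deriv_def
proof (intro allI impI conjI)
  fix x :: real assume "x \<ge> 0"
  show "set_integrable lebesgue {0..x} (\<lambda>x. - g x)"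
    using set_integrable_subset[OF assms, of "{0..x}"] unfolding set_integrable_def by simp
  show "(LINT t:{x..}|lebesgue. g t) = (LINT t:{0..}|lebesgue. g t) + (LINT t:{0..x}|lebesgue. - g t)"
    using LINT_tail[OF assms \<open>x \<ge> 0\<close>] by (simp add: set_lebesgue_integral_def)
qed

lemma tail_tendsto_0:
  fixes g :: "real \<Rightarrow> 'a::{banach,second_countable_topology}"
  assumes "set_integrable lebesgue {0..} g"
  shows "((\<lambda>x. LINT t:{x..}|lebesgue. g t) \<longlongrightarrow> 0) at_top"
proof -
  have "((\<lambda>x. (LINT t:{0..}|lebesgue. g t) - (LINT t:{0..x}|lebesgue. g t)) \<longlongrightarrow>
      (LINT t:{0..}|lebesgue. g t) - (LINT t:{0..}|lebesgue. g t)) at_top"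
    by (intro tendsto_intros tendsto_set_lebesgue_integral_at_top assms) auto
  then have "((\<lambda>x. (LINT t:{0..}|lebesgue. g t) - (LINT t:{0..x}|lebesgue. g t)) \<longlongrightarrow> 0) at_top"
    by simp
  then show ?thesis
    by (rule Lim_transform_eventually)
       (intro eventually_mono[OF eventually_ge_at_top[of 0]] LINT_tail[OF assms, symmetric])
qed

section \<open>Measurability and dominated convergence\<close>

lemma continuous_imp_measurable_lebesgue:
  fixes g :: "real \<Rightarrow> 'b::topological_space"
  assumes "continuous_on UNIV g"
  shows "g \<in> borel_measurable lebesgue"
  using borel_measurable_continuous_onI[OF assms] by (simp add: measurable_completion)

text \<open>Composing with \<open>max 0\<close> extends \<open>f\<close> continuously to the whole
  line and leaves it unchanged on the half-line.\<close>

lemma half_line_measurable: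
  fixes f :: "real \<Rightarrow> 'b::{real_normed_vector,second_countable_topology}"
  assumes "continuous_on {0..} f"
  shows "(\<lambda>x. indicat_real {0..} x *\<^sub>R f x) \<in> borel_measurable lebesgue"
proof -
  have "continuous_on UNIV (\<lambda>x. f (max 0 x))"
    by (intro continuous_on_compose2[OF assms] continuous_intros) auto
  then have "(\<lambda>x. f (max 0 x)) \<in> borel_measurable lebesgue" by (rule continuous_imp_measurable_lebesgue)
  then have "(\<lambda>x. indicat_real {0..} x *\<^sub>R f (max 0 x)) \<in> borel_measurable lebesgue"
    by (intro borel_measurable_scaleR borel_measurable_indicator) auto
  moreover have "(\<lambda>x. indicat_real {0..} x *\<^sub>R f (max 0 x)) = (\<lambda>x. indicat_real {0..} x *\<^sub>R f x)"
    by (rule ext) (auto split: split_indicator simp: max_def)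
  ultimately show ?thesis by simp
qed

lemma set_integrable_bound_continuous:
  fixes f :: "real \<Rightarrow> 'a::{banach,second_countable_topology}"
  assumes "set_integrable lebesgue {0..} g" "continuous_on {0..} f" "\<And>x. x \<ge> 0 \<Longrightarrow> norm (f x) \<le> g x"
  shows "set_integrable lebesgue {0..} f"
  unfolding set_integrable_def
proof (rule Bochner_Integration.integrable_bound[OF assms(1)[unfolded set_integrable_def] half_line_measurable[OF assms(2)]])
  show "AE x in lebesgue. norm (indicat_real {0..} x *\<^sub>R f x) \<le> norm (indicat_real {0..} x *\<^sub>R g x)"
    by (rule AE_I2) (use assms(3) in \<open>auto simp: indicator_def intro: order_trans[OF _ abs_ge_self]\<close>)
qed

text \<open>Continuity is tested along sequences, where dominated convergence applies with one
  majorant for all parameters.\<close>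

lemma continuous_on_integral_dominated:
  fixes F :: "'s::metric_space \<Rightarrow> 'm \<Rightarrow> 'b::{banach,second_countable_topology}"
  assumes "\<And>y. y \<in> space M \<Longrightarrow> continuous_on S (\<lambda>s. F s y)" "\<And>s. s \<in> S \<Longrightarrow> F s \<in> borel_measurable M"
    "integrable M w" "\<And>s y. s \<in> S \<Longrightarrow> y \<in> space M \<Longrightarrow> norm (F s y) \<le> w y"
  shows "continuous_on S (\<lambda>s. integral\<^sup>L M (F s))"
  unfolding continuous_on_sequentially
proof (intro allI ballI impI, elim conjE)
  fix X a assume "a \<in> S" "\<forall>n. X n \<in> S" "X \<longlonglongrightarrow> a"
  then show "((\<lambda>s. integral\<^sup>L M (F s)) \<circ> X) \<longlonglongrightarrow> integral\<^sup>L M (F a)"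
    unfolding o_def
  proof (intro integral_dominated_convergence[where w = w])
    show "AE y in M. (\<lambda>i. F (X i) y) \<longlonglongrightarrow> F a y"
      using assms(1) \<open>a \<in> S\<close> \<open>\<forall>n. X n \<in> S\<close> \<open>X \<longlonglongrightarrow> a\<close>
      unfolding continuous_on_sequentially o_def by auto
  qed (use assms in auto)
qed

section \<open>The Volterra equation\<close>

text \<open>The removable singularity is filled in so that the Volterra kernel is continuous at
  energy zero as well.\<close>

definition exp_slope :: "complex \<Rightarrow> complex" where
  "exp_slope z = (if z = 0 then 1 else (exp z - 1) / z)"

lemma continuous_on_exp_slope: "continuous_on UNIV exp_slope"
proof -
  have "isCont exp_slope z" for z
  proof (cases "z = 0")
    case True
    have "((\<lambda>h. (exp (0 + h) - exp 0) / h) \<longlongrightarrow> exp (0::complex)) (at 0)"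
      using DERIV_exp[of "0::complex"] unfolding DERIV_def by simp
    then have "(exp_slope \<longlongrightarrow> 1) (at 0)"
      by (simp, elim Lim_transform_eventually) (auto simp: exp_slope_def eventually_at_filter)
    then show ?thesis unfolding isCont_def True by (simp add: exp_slope_def)
  next
    case False
    have "isCont (\<lambda>z. (exp z - 1) / z) z" using False by (intro continuous_intros)
    moreover have "\<forall>\<^sub>F w in nhds z. exp_slope w = (exp w - 1) / w"
      using False by (intro eventually_nhds_in_open[THEN eventually_mono, of "-{0}"]) (auto simp: exp_slope_def)
    ultimately show ?thesis by (subst isCont_cong) auto
  qed
  then show ?thesis by (simp add: continuous_on_eq_continuous_within)
qed

text \<open>On the convex set Re z \<le> 0 the derivative of \<open>exp\<close> has norm at most 1,
  so the mean value inequality gives the first bound; the triangle inequality gives the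
  second.\<close>

lemma norm_exp_minus_one_le:
  fixes z :: complex assumes "Re z \<le> 0"
  shows "norm (exp z - 1) \<le> norm z" "norm (exp z - 1) \<le> 2"
proof -
  have "norm (exp z - exp 0) \<le> 1 * norm (z - 0)"
    by (rule field_differentiable_bound[where S = "{w. Re w \<le> 0}" and f' = exp])
       (use assms in \<open>auto intro!: convex_halfspace_Re_le derivative_eq_intros\<close>)
  then show "norm (exp z - 1) \<le> norm z" by simp
  have "norm (exp z) \<le> 1" using assms by simp
  then show "norm (exp z - 1) \<le> 2" by (intro order_trans[OF norm_triangle_ineq4]) simp
qed

text \<open>The solution k of k'' = 2\<i>z k' with k(0) = 0 and k'(0) = 1. Splitting exp(\<i>zx) off
  a solution leaves m'' + 2\<i>z m' = V m, and k(y - x) inverts the left-hand side starting from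
  infinity.\<close>

definition volterra_kernel :: "real \<Rightarrow> complex \<Rightarrow> complex" where
  "volterra_kernel t z = of_real t * exp_slope (2 * \<i> * z * of_real t)"

lemma volterra_kernel_0 [simp]: "volterra_kernel 0 z = 0"
  by (simp add: volterra_kernel_def)

lemma volterra_kernel_eq:
  "z \<noteq> 0 \<Longrightarrow> volterra_kernel t z = (exp (2 * \<i> * z * of_real t) - 1) / (2 * \<i> * z)"
  by (simp add: volterra_kernel_def exp_slope_def)

lemma volterra_kernel_at_0: "volterra_kernel t 0 = of_real t"
  by (simp add: volterra_kernel_def exp_slope_def)

text \<open>The first bound holds uniformly down to \<open>z = 0\<close> at the price of one moment
  of the potential; the second yields the decay for large \<open>z\<close>.\<close>

lemma norm_volterra_kernel_le:
  assumes "t \<ge> 0" "Im z \<ge> 0"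
  shows "norm (volterra_kernel t z) \<le> t" "z \<noteq> 0 \<Longrightarrow> norm (volterra_kernel t z) \<le> 1 / norm z"
proof -
  have *: "Re (2 * \<i> * z * of_real t) \<le> 0" using assms by simp
  have "norm (exp_slope (2 * \<i> * z * of_real t)) \<le> 1"
    unfolding exp_slope_def using norm_exp_minus_one_le(1)[OF *] by (auto simp: norm_divide divide_le_eq)
  then show "norm (volterra_kernel t z) \<le> t"
    unfolding volterra_kernel_def using assms by (auto simp: norm_mult mult_left_le)
  show "norm (volterra_kernel t z) \<le> 1 / norm z" if "z \<noteq> 0"
    using norm_exp_minus_one_le(2)[OF *] that
    by (simp add: volterra_kernel_eq norm_divide norm_mult divide_le_eq)
qed

lemma continuous_on_volterra_kernel [continuous_intros]:
  assumes "continuous_on S f" "continuous_on S g"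
  shows "continuous_on S (\<lambda>s. volterra_kernel (f s) (g s))"
  unfolding volterra_kernel_def
  by (intro continuous_intros assms continuous_on_compose2[OF continuous_on_exp_slope]) auto

section \<open>The potential, its majorant and the weight\<close>

locale half_line_potential =
  fixes V :: "real \<Rightarrow> real"
  assumes V_measurable: "set_borel_measurable lebesgue {0..} V"
    and V_moment: "set_integrable lebesgue {0..} (\<lambda>x. (1 + x) * \<bar>V x\<bar>)"
begin

text \<open>Extension by zero lets the integrals run over the whole line.\<close>

definition U :: "real \<Rightarrow> real" where "U x = indicator {0..} x * V x"

text \<open>One majorant for |V| and for y |V|, hence for the potential times either kernel
  bound.\<close>

definition q :: "real \<Rightarrow> real" where "q x = indicator {0..} x * ((1 + x) * \<bar>V x\<bar>)"

lemma U_measurable [measurable]: "U \<in> borel_measurable lebesgue"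
  using V_measurable unfolding set_borel_measurable_def U_def by simp

lemma q_integrable: "integrable lebesgue q"
  using V_moment unfolding set_integrable_def q_def by simp

lemma q_nonneg: "q x \<ge> 0" by (simp add: q_def indicator_def)

lemma U_le_q: "\<bar>U y\<bar> \<le> q y"
  by (auto simp: q_def U_def indicator_def mult_right_le_one_le intro!: mult_left_le_one_le)
     (metis abs_ge_zero le_add_same_cancel1 mult.commute mult_right_mono mult_1)

lemma U_mult_le_q: "0 \<le> t \<Longrightarrow> t \<le> max 0 y \<Longrightarrow> \<bar>U y\<bar> * t \<le> q y"
  using mult_left_mono[of t "1 + y" "\<bar>V y\<bar>"] by (auto simp: q_def U_def indicator_def mult.commute)

definition P :: "real \<Rightarrow> real" where "P x = integral {0..x} q"

text \<open>The weight \<open>W\<close> is chosen so that the Volterra operator contracts by the factor \<open>1/2\<close>.\<close>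

definition W :: "real \<Rightarrow> real" where "W x = exp (4 * (integral\<^sup>L lebesgue q - P x))"

lemma q_set_integrable: "S \<in> sets lebesgue \<Longrightarrow> set_integrable lebesgue S q"
  unfolding set_integrable_def using integrable_mult_indicator[OF _ q_integrable] by auto

lemma q_integrable_on: "q integrable_on {a..b}"
  using q_set_integrable[of "{a..b}"] by (simp add: set_lebesgue_integral_eq_integral(1))

lemma P_diff: "0 \<le> a \<Longrightarrow> a \<le> b \<Longrightarrow> P b - P a = integral {a..b} q"
  using Henstock_Kurzweil_Integration.integral_combine[of 0 a b q] q_integrable_on by (simp add: P_def)

lemma P_mono: "0 \<le> a \<Longrightarrow> a \<le> b \<Longrightarrow> P a \<le> P b"
  using P_diff[of a b] integral_nonneg[OF q_integrable_on, of a b] q_nonneg by simp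

lemma P_le: "P x \<le> integral\<^sup>L lebesgue q"
proof -
  have "P x = (LINT t:{0..x}|lebesgue. q t)"
    unfolding P_def by (rule set_lebesgue_integral_eq_integral(2)[symmetric]) (rule q_set_integrable, simp)
  also have "\<dots> \<le> integral\<^sup>L lebesgue q"
    unfolding set_lebesgue_integral_def
    by (rule integral_mono) (use q_set_integrable[of "{0..x}"] q_integrable q_nonneg in
        \<open>auto simp: set_integrable_def indicator_def\<close>)
  finally show ?thesis .
qed

lemma W_ge_1: "W x \<ge> 1" using P_le by (simp add: W_def)

lemma W_pos: "W x > 0" by (simp add: W_def)

lemma W_antimono: "0 \<le> a \<Longrightarrow> a \<le> b \<Longrightarrow> W b \<le> W a"
  using P_mono by (simp add: W_def)

lemma W_le: "0 \<le> x \<Longrightarrow> W x \<le> W 0" by (rule W_antimono) auto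

lemma continuous_on_W: "continuous_on {0..} W"
  unfolding W_def P_def by (intro continuous_intros continuous_on_indefinite_integral q_integrable_on)

lemma qW_integrable: "integrable lebesgue (\<lambda>y. q y * W y)"
proof (rule Bochner_Integration.integrable_bound)
  show "integrable lebesgue (\<lambda>y. W 0 * q y)" using q_integrable by simp
  have "(\<lambda>y. q y * (indicat_real {0..} y *\<^sub>R W y)) \<in> borel_measurable lebesgue"
    by (intro borel_measurable_times borel_measurable_integrable[OF q_integrable] half_line_measurable continuous_on_W)
  moreover have "(\<lambda>y. q y * (indicat_real {0..} y *\<^sub>R W y)) = (\<lambda>y. q y * W y)"
    by (auto simp: q_def indicator_def)
  ultimately show "(\<lambda>y. q y * W y) \<in> borel_measurable lebesgue" by simp
  show "AE y in lebesgue. norm (q y * W y) \<le> norm (W 0 * q y)"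
  proof (rule AE_I2)
    fix y
    have "q y * W y \<le> q y * W 0"
      using mult_left_mono[OF W_le q_nonneg, of y y] by (cases "y \<ge> 0") (simp_all add: q_def)
    then show "norm (q y * W y) \<le> norm (W 0 * q y)"
      using q_nonneg[of y] W_pos[of y] W_pos[of 0] by (simp add: abs_mult mult.commute)
  qed
qed

lemma qW_set_integrable: "S \<in> sets lebesgue \<Longrightarrow> set_integrable lebesgue S (\<lambda>y. q y * W y)"
  unfolding set_integrable_def using integrable_mult_indicator[OF _ qW_integrable] by auto

text \<open>Formally W' = -4qW, so the integral is (W a - W b)/4. As \<open>q\<close> is only
  integrable, the estimate is proved on short intervals and chained; the weaker factor 1/2 leaves
  room for the variation of \<open>W\<close> on them.\<close>

lemma integral_qW_le:
  assumes "0 \<le> a" "a \<le> b"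
  shows "integral {a..b} (\<lambda>y. q y * W y) \<le> (W a - W b) / 2"
proof -
  have int: "(\<lambda>y. q y * W y) integrable_on {a..b}" for a b
    using qW_set_integrable[of "{a..b}"] by (simp add: set_lebesgue_integral_eq_integral(1))
  have "0 \<le> a \<longrightarrow> integral {a..b} (\<lambda>y. q y * W y) \<le> (W a - W b) / 2"
  proof (rule Bolzano[of a b "\<lambda>a b. 0 \<le> a \<longrightarrow> integral {a..b} (\<lambda>y. q y * W y) \<le> (W a - W b) / 2"])
    fix a b c :: real
    assume "0 \<le> a \<longrightarrow> integral {a..b} (\<lambda>y. q y * W y) \<le> (W a - W b) / 2"
      "0 \<le> b \<longrightarrow> integral {b..c} (\<lambda>y. q y * W y) \<le> (W b - W c) / 2" "a \<le> b" "b \<le> c"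
    then show "0 \<le> a \<longrightarrow> integral {a..c} (\<lambda>y. q y * W y) \<le> (W a - W c) / 2"
      using Henstock_Kurzweil_Integration.integral_combine[OF _ _ int, of a b c] by auto
  next
    fix x assume "a \<le> x" "x \<le> b"
    then have "x \<ge> 0" using assms by simp
    then have "continuous (at x within {0..}) W"
      using continuous_on_W by (simp add: continuous_on_eq_continuous_within)
    \<comment> \<open>Within this tolerance \<open>W a\<close> is below 4/3 and \<open>W b\<close>
      above 2/3 of \<open>W x\<close>, so their ratio is below 2.\<close>
    moreover have "W x / 3 > 0" using W_pos by simp
    ultimately obtain d where d: "d > 0" "\<And>t. t \<in> {0..} \<Longrightarrow> dist t x < d \<Longrightarrow> dist (W t) (W x) < W x / 3"
      unfolding continuous_within_eps_delta by metis
    show "\<exists>d>0. \<forall>a b. a \<le> x \<and> x \<le> b \<and> b - a < d \<longrightarrow>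
        0 \<le> a \<longrightarrow> integral {a..b} (\<lambda>y. q y * W y) \<le> (W a - W b) / 2"
    proof (intro exI[of _ d] conjI allI impI)
      fix a b assume ab: "a \<le> x \<and> x \<le> b \<and> b - a < d" "0 \<le> a"
      have "dist (W a) (W x) < W x / 3" "dist (W b) (W x) < W x / 3"
        by (intro d; use ab in \<open>auto simp: dist_real_def\<close>)+
      then have Wab: "W a \<le> 2 * W b" unfolding dist_real_def by linarith
      have Pab: "P a \<le> P b" using P_mono ab by auto
      have "integral {a..b} (\<lambda>y. q y * W y) \<le> integral {a..b} (\<lambda>y. W a * q y)"
        using W_antimono q_nonneg ab int integrable_on_cmult_left[OF q_integrable_on, of "W a"]
        by (intro integral_le) (auto simp: mult.commute intro!: mult_right_mono)
      also have "\<dots> = W a * (P b - P a)" using P_diff ab by simp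
      also have "\<dots> \<le> 2 * W b * (P b - P a)" using Wab Pab by (intro mult_right_mono) auto
      also have "\<dots> = W b * (4 * (P b - P a)) / 2" by simp
      \<comment> \<open>The inequality 1 + s \<le> exp s turns the increment of \<open>P\<close>
        into the decrement of \<open>W\<close>.\<close>
      also have "W b * (4 * (P b - P a)) \<le> W b * (exp (4 * (P b - P a)) - 1)"
        using exp_ge_add_one_self[of "4 * (P b - P a)"] W_pos[of b] by (intro mult_left_mono) linarith+
      also have "\<dots> = W a - W b"
        by (simp add: W_def algebra_simps flip: exp_add)
      finally show "integral {a..b} (\<lambda>y. q y * W y) \<le> (W a - W b) / 2" by simp
    qed (use d in auto)
  qed (use assms in auto)
  then show ?thesis using assms by simp
qed

lemma LINT_qW_tail_le:
  assumes "0 \<le> x"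
  shows "(LINT y:{x..}|lebesgue. q y * W y) \<le> W x / 2"
proof (rule tendsto_upperbound)
  show "((\<lambda>b. LINT y:{x..b}|lebesgue. q y * W y) \<longlongrightarrow> (LINT y:{x..}|lebesgue. q y * W y)) at_top"
    by (intro tendsto_set_lebesgue_integral_at_top qW_set_integrable) auto
  show "\<forall>\<^sub>F b in at_top. (LINT y:{x..b}|lebesgue. q y * W y) \<le> W x / 2"
    using eventually_ge_at_top[of x]
  proof eventually_elim
    case (elim b)
    have "(LINT y:{x..b}|lebesgue. q y * W y) = integral {x..b} (\<lambda>y. q y * W y)"
      by (intro set_lebesgue_integral_eq_integral(2) qW_set_integrable) simp
    then show ?case using integral_qW_le[OF assms elim] W_pos[of b] by simp
  qed
qed simp

text \<open>The kernel vanishes at distance 0, so clamping y - x restricts the integral to y \<ge> x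
  and keeps the integrand continuous in \<open>x\<close> and \<open>z\<close> jointly.\<close>

definition volterra :: "(real \<Rightarrow> complex) \<Rightarrow> real \<Rightarrow> complex \<Rightarrow> complex" where
  "volterra g x z = (LINT y|lebesgue. of_real (U y) * volterra_kernel (max 0 (y - x)) z * g y)"

text \<open>If \<open>f\<close> is not integrable, the left-hand side is 0 by convention, while the
  pointwise bound makes the right-hand side nonnegative.\<close>

lemma norm_integral_le_integral:
  fixes f :: "real \<Rightarrow> complex"
  assumes "integrable M w" "\<And>y. norm (f y) \<le> w y"
  shows "norm (integral\<^sup>L M f) \<le> integral\<^sup>L M w"
proof (cases "integrable M f")
  case True
  then show ?thesis
    by (intro order_trans[OF integral_norm_bound] integral_mono) (use assms in auto)
next
  case False
  have "0 \<le> integral\<^sup>L M w"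
    by (rule integral_nonneg_AE) (use assms(2) order_trans[OF norm_ge_zero] in blast)
  then show ?thesis using False by (simp add: not_integrable_integral_eq)
qed

text \<open>In the supremum norm weighted by 1/W the operator has norm at most 1/2, with one weight
  for all \<open>z\<close> of the closed half-plane.\<close>

lemma norm_volterra_le:
  assumes "x \<ge> 0" "Im z \<ge> 0" "\<And>y. y \<ge> 0 \<Longrightarrow> norm (g y) \<le> c * W y" "c \<ge> 0"
  shows "norm (volterra g x z) \<le> c * W x / 2"
proof -
  have "norm (volterra g x z) \<le> (LINT y|lebesgue. c * (indicator {x..} y *\<^sub>R (q y * W y)))"
    unfolding volterra_def
  proof (rule norm_integral_le_integral)
    show "integrable lebesgue (\<lambda>y. c * (indicator {x..} y *\<^sub>R (q y * W y)))"
      using qW_set_integrable[of "{x..}"] unfolding set_integrable_def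
      by (intro integrable_mult_right) auto
    fix y
    show "norm (of_real (U y) * volterra_kernel (max 0 (y - x)) z * g y)
      \<le> c * (indicator {x..} y *\<^sub>R (q y * W y))"
    proof (cases "y \<ge> x")
      case True
      have "\<bar>U y\<bar> * norm (volterra_kernel (max 0 (y - x)) z) \<le> \<bar>U y\<bar> * (y - x)"
        using norm_volterra_kernel_le(1)[of "y - x" z] True assms by (intro mult_left_mono) auto
      also have "\<dots> \<le> q y" by (rule U_mult_le_q) (use True assms in auto)
      finally have "\<bar>U y\<bar> * norm (volterra_kernel (max 0 (y - x)) z) * norm (g y) \<le> q y * (c * W y)"
        using assms(3)[of y] True assms(1) q_nonneg by (intro mult_mono) auto
      then show ?thesis using True by (simp add: norm_mult mult_ac)
    qed (simp add: max_def)
  qed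
  also have "\<dots> \<le> c * (W x / 2)"
    using LINT_qW_tail_le[OF assms(1)] assms(4) unfolding set_lebesgue_integral_def
    by (simp only: Bochner_Integration.integral_mult_right_zero mult_left_mono)
  finally show ?thesis by simp
qed

text \<open>Boundedness makes the weighted supremum \<open>M\<close> finite, and the contraction
  yields M \<le> M/2. All uniqueness and symmetry statements about \<open>m\<close> go back to
  this.\<close>

lemma volterra_fixpoint_0:
  assumes "Im z \<ge> 0" "\<And>x. x \<ge> 0 \<Longrightarrow> norm (f x) \<le> B" "\<And>x. x \<ge> 0 \<Longrightarrow> f x = volterra f x z" "x \<ge> 0"
  shows "f x = 0"
proof -
  define M where "M = (SUP x\<in>{0..}. norm (f x) / W x)"
  have "norm (f x) / W x \<le> B" if "x \<ge> 0" for x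
    using assms(2)[OF that] W_ge_1[of x] order_trans[OF norm_ge_zero assms(2)[OF that]]
    by (simp add: divide_le_eq) (metis mult_right_mono mult_1 mult.commute order_trans)
  then have bdd: "bdd_above ((\<lambda>x. norm (f x) / W x) ` {0..})" by (intro bdd_aboveI[of _ B]) auto
  have M: "norm (f x) / W x \<le> M" if "x \<ge> 0" for x
    unfolding M_def by (rule cSUP_upper[OF _ bdd]) (use that in auto)
  have "0 \<le> M" using M[of 0] W_pos[of 0] by (meson divide_nonneg_pos norm_ge_zero order_refl order_trans)
  have "norm (f x) / W x \<le> M / 2" if "x \<ge> 0" for x
  proof -
    have "norm (f x) \<le> M * W x / 2"
      unfolding assms(3)[OF that]
      by (rule norm_volterra_le[OF that assms(1) _ \<open>0 \<le> M\<close>]) (use M W_pos in \<open>simp add: divide_le_eq\<close>)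
    then show ?thesis using W_pos[of x] by (simp add: divide_le_eq)
  qed
  then have "M \<le> M / 2" unfolding M_def[symmetric] by (subst (1) M_def, intro cSUP_least) auto
  then have "M = 0" using \<open>0 \<le> M\<close> by simp
  then show ?thesis using M[OF assms(4)] W_pos[of x] by (simp add: divide_le_eq)
qed

text \<open>Bounded continuous functions form a type over all of
  \<open>real \<times> complex\<close>; this retraction sends the remaining parameters back into the
  half-plane.\<close>

lemma half_plane_clamp:
  defines "cl \<equiv> \<lambda>z. complex_of_real (Re z) + \<i> * of_real (max 0 (Im z))"
  shows "Im (cl z) \<ge> 0" "Im z \<ge> 0 \<Longrightarrow> cl z = z" "continuous_on UNIV cl"
  unfolding cl_def by (auto simp: complex_eq_iff intro!: continuous_intros)

lemma continuous_on_W_max: "continuous_on S (\<lambda>s. W (max 0 (f s)))" if "continuous_on S f" for f :: "'s::topological_space \<Rightarrow> real"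
  by (intro continuous_on_compose2[OF continuous_on_W] continuous_intros that) auto

text \<open>Banach's fixed point theorem is applied once, to functions of \<open>x\<close> and
  \<open>z\<close> together, so joint continuity and a uniform bound come with the solution.\<close>

lemma volterra_fixpoint_exists:
  "\<exists>m :: real \<Rightarrow> complex \<Rightarrow> complex. continuous_on UNIV (\<lambda>p. m (fst p) (snd p)) \<and>
     (\<exists>C. \<forall>x z. norm (m x z) \<le> C) \<and>
     (\<forall>x\<ge>0. \<forall>z. Im z \<ge> 0 \<longrightarrow> m x z = 1 + volterra (\<lambda>y. m y z) x z)"
proof -
  define cl where "cl z = complex_of_real (Re z) + \<i> * of_real (max 0 (Im z))" for z
  note cl = half_plane_clamp[folded cl_def]
  define Wm where "Wm x = W (max 0 x)" for x
  have Wm: "Wm x > 0" "Wm x \<ge> 1" "Wm x \<le> W 0" for x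
    using W_pos W_ge_1 W_le by (auto simp: Wm_def)
  \<comment> \<open>The unknown is \<open>m\<close> divided by the weight; the plain supremum norm
    of the quotient is the weighted norm of \<open>m\<close>, in which the operator
    contracts.\<close>
  define T :: "((real \<times> complex) \<Rightarrow>\<^sub>C complex) \<Rightarrow> real \<times> complex \<Rightarrow> complex" where
    "T f p = (1 + volterra (\<lambda>y. of_real (Wm y) * apply_bcontfun f (y, snd p)) (max 0 (fst p)) (cl (snd p))) / of_real (Wm (fst p))" for f p
  define F where "F f p y = of_real (U y) * volterra_kernel (max 0 (y - max 0 (fst p))) (cl (snd p))
      * (of_real (Wm y) * apply_bcontfun f (y, snd p))" for f p y
  have F_le: "norm (F f p y) \<le> q y * (W 0 * norm f)" for f p y
  proof -
    have "\<bar>U y\<bar> * norm (volterra_kernel (max 0 (y - max 0 (fst p))) (cl (snd p))) \<le> \<bar>U y\<bar> * max 0 (y - max 0 (fst p))"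
      using norm_volterra_kernel_le(1) cl by (intro mult_left_mono) auto
    also have "\<dots> \<le> q y" by (rule U_mult_le_q) auto
    finally have "\<bar>U y\<bar> * norm (volterra_kernel (max 0 (y - max 0 (fst p))) (cl (snd p))) * (Wm y * norm (apply_bcontfun f (y, snd p)))
      \<le> q y * (W 0 * norm f)"
      using Wm(1)[of y] Wm(3)[of y] norm_bounded[of f "(y, snd p)"] q_nonneg[of y] by (intro mult_mono) auto
    then show ?thesis using Wm(1)[of y] by (simp add: F_def norm_mult mult_ac)
  qed
  have intq: "integrable lebesgue (\<lambda>y. q y * c)" for c using q_integrable by simp
  have contf: "continuous_on S (\<lambda>s. apply_bcontfun f (g s))" if "continuous_on S g"
    for f and g :: "'s::topological_space \<Rightarrow> real \<times> complex" and S
    by (rule continuous_on_compose2[OF _ that, of UNIV]) (auto simp: continuous_on_apply_bcontfun)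
  have contWm: "continuous_on S (\<lambda>s. Wm (g s))" if "continuous_on S g" for g :: "'s::topological_space \<Rightarrow> real" and S
    unfolding Wm_def by (rule continuous_on_W_max[OF that])
  have contcl: "continuous_on S (\<lambda>s. cl (g s))" if "continuous_on S g" for g :: "'s::topological_space \<Rightarrow> complex" and S
    by (rule continuous_on_compose2[OF cl(3) that]) auto
  have F_meas: "F f p \<in> borel_measurable lebesgue" for f p
  proof -
    have "(\<lambda>y. volterra_kernel (max 0 (y - max 0 (fst p))) (cl (snd p)) * (of_real (Wm y) * apply_bcontfun f (y, snd p)))
        \<in> borel_measurable lebesgue"
      by (intro continuous_imp_measurable_lebesgue continuous_intros contf contWm)
    then have "(\<lambda>y. complex_of_real (U y) * (volterra_kernel (max 0 (y - max 0 (fst p))) (cl (snd p)) * (of_real (Wm y) * apply_bcontfun f (y, snd p))))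
        \<in> borel_measurable lebesgue"
      by (rule borel_measurable_times[rotated]) measurable
    then show ?thesis unfolding F_def by (simp add: mult.assoc)
  qed
  have F_int: "integrable lebesgue (F f p)" for f p
  proof (rule Bochner_Integration.integrable_bound[OF intq[of "W 0 * norm f"] F_meas])
    show "AE y in lebesgue. norm (F f p y) \<le> norm (q y * (W 0 * norm f))"
      by (rule AE_I2) (metis F_le norm_ge_zero order_trans real_norm_def abs_of_nonneg)
  qed
  have T_F: "T f p = (1 + integral\<^sup>L lebesgue (F f p)) / of_real (Wm (fst p))" for f p
    unfolding T_def volterra_def F_def ..
  have T_cont: "continuous_on UNIV (T f)" for f
  proof -
    have "continuous_on UNIV (\<lambda>p. integral\<^sup>L lebesgue (F f p))"
    proof (rule continuous_on_integral_dominated[where w = "\<lambda>y. q y * (W 0 * norm f)"])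
      show "continuous_on UNIV (\<lambda>p. F f p y)" for y
        unfolding F_def by (intro continuous_intros contf contcl)
    qed (use F_meas F_le intq in auto)
    then show ?thesis
      unfolding T_F[abs_def] using Wm(1) by (intro continuous_intros contWm) (auto simp: less_le)
  qed
  have T_bdd: "bounded (range (T f))" for f
  proof (rule boundedI)
    fix v assume "v \<in> range (T f)"
    then obtain p where v: "v = T f p" by auto
    have "norm v \<le> norm (1 + integral\<^sup>L lebesgue (F f p))"
      unfolding v T_F using Wm[of "fst p"] by (simp add: norm_divide divide_le_eq mult_le_cancel_left1)
    also have "\<dots> \<le> 1 + norm (integral\<^sup>L lebesgue (F f p))" by (metis norm_one norm_triangle_ineq)
    also have "norm (integral\<^sup>L lebesgue (F f p)) \<le> (LINT y|lebesgue. q y * (W 0 * norm f))"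
      by (rule norm_integral_le_integral[OF intq F_le])
    finally show "norm v \<le> 1 + (LINT y|lebesgue. q y * (W 0 * norm f))" by simp
  qed
  have T_bc: "T f \<in> bcontfun" for f
    unfolding bcontfun_def using T_cont T_bdd by auto
  have "\<exists>!f. Bcontfun (T f) = f"
  proof (rule banach_fix_type)
    show "\<forall>f g. dist (Bcontfun (T f)) (Bcontfun (T g)) \<le> 1/2 * dist f g"
    proof (intro allI dist_bound)
      fix f g :: "(real \<times> complex) \<Rightarrow>\<^sub>C complex" and p
      have eq: "F f p y - F g p y = F (f - g) p y" for y
        unfolding F_def by (simp add: algebra_simps)
      have "T f p - T g p = integral\<^sup>L lebesgue (F (f - g) p) / of_real (Wm (fst p))"
        unfolding T_F eq[symmetric, abs_def] using F_int by (simp add: diff_divide_distrib[symmetric])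
      also have "norm \<dots> \<le> (norm (f - g) * W (max 0 (fst p)) / 2) / Wm (fst p)"
      proof -
        have "integral\<^sup>L lebesgue (F (f - g) p) = volterra (\<lambda>y. of_real (Wm y) * apply_bcontfun (f - g) (y, snd p)) (max 0 (fst p)) (cl (snd p))"
          unfolding volterra_def F_def ..
        also have "norm \<dots> \<le> norm (f - g) * W (max 0 (fst p)) / 2"
        proof (rule norm_volterra_le)
          fix y :: real assume "y \<ge> 0"
          show "norm (of_real (Wm y) * apply_bcontfun (f - g) (y, snd p)) \<le> norm (f - g) * W y"
            using norm_bounded[of "f - g" "(y, snd p)"] W_pos[of y] \<open>y \<ge> 0\<close>
            by (simp add: norm_mult Wm_def mult.commute)
        qed (use cl in auto)
        finally show ?thesis using Wm(1)[of "fst p"] by (simp add: norm_divide field_simps)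
      qed
      also have "\<dots> = 1/2 * dist f g"
        using Wm(1)[of "fst p"] by (simp add: Wm_def dist_norm)
      finally show "dist (apply_bcontfun (Bcontfun (T f)) p) (apply_bcontfun (Bcontfun (T g)) p) \<le> 1/2 * dist f g"
        by (simp add: Bcontfun_inverse[OF T_bc] dist_norm)
    qed
  qed auto
  then obtain f where "Bcontfun (T f) = f" by auto
  then have f: "apply_bcontfun f p = T f p" for p using Bcontfun_inverse[OF T_bc] by metis
  define m where "m x z = of_real (Wm x) * apply_bcontfun f (x, z)" for x z
  show ?thesis
  proof (intro exI[of _ m] conjI allI impI)
    show "continuous_on UNIV (\<lambda>p. m (fst p) (snd p))"
      unfolding m_def by (intro continuous_intros contf contWm)
    have "norm (m x z) \<le> W 0 * norm f" for x z
      unfolding m_def using norm_bounded[of f "(x, z)"] Wm(1)[of x] Wm(3)[of x]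
      by (simp add: norm_mult mult_mono)
    then show "\<exists>C. \<forall>x z. norm (m x z) \<le> C" by blast
    fix x :: real and z assume "x \<ge> 0" "Im z \<ge> 0"
    then have "m x z = 1 + volterra (\<lambda>y. of_real (Wm y) * apply_bcontfun f (y, z)) x z"
      unfolding m_def f[of "(x, z)"] T_def using Wm(1)[of x] cl(2) by (simp add: less_le)
    then show "m x z = 1 + volterra (\<lambda>y. m y z) x z" unfolding m_def .
  qed
qed

definition m :: "real \<Rightarrow> complex \<Rightarrow> complex" where
  "m = (SOME m. continuous_on UNIV (\<lambda>p. m (fst p) (snd p)) \<and>
     (\<exists>C. \<forall>x z. norm (m x z) \<le> C) \<and>
     (\<forall>x\<ge>0. \<forall>z. Im z \<ge> 0 \<longrightarrow> m x z = 1 + volterra (\<lambda>y. m y z) x z))"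

lemmas m_props = someI_ex[OF volterra_fixpoint_exists, folded m_def]

lemma continuous_on_m [continuous_intros]:
  "continuous_on S f \<Longrightarrow> continuous_on S g \<Longrightarrow> continuous_on S (\<lambda>s. m (f s) (g s))"
  using continuous_on_compose2[OF conjunct1[OF m_props] continuous_on_Pair[of S f g]] by auto

definition C\<^sub>m :: real where "C\<^sub>m = (SOME C. \<forall>x z. norm (m x z) \<le> C)"

lemma norm_m_le: "norm (m x z) \<le> C\<^sub>m"
  using someI_ex[OF conjunct1[OF conjunct2[OF m_props]], folded C\<^sub>m_def] by auto

lemma C\<^sub>m_nonneg: "C\<^sub>m \<ge> 0"
  using norm_m_le[of 0 0] norm_ge_zero order_trans by blast

lemma m_eq: "x \<ge> 0 \<Longrightarrow> Im z \<ge> 0 \<Longrightarrow> m x z = 1 + volterra (\<lambda>y. m y z) x z"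
  using m_props by blast

end

section \<open>The Jost solution\<close>

lemma has_ac_deriv_eq_tail:
  assumes "has_ac_deriv f g" "set_integrable lebesgue {0..} g" "(f \<longlongrightarrow> l) at_top" "x \<ge> 0"
  shows "f x = l - (LINT t:{x..}|lebesgue. g t)"
  using has_ac_deriv_LINT[OF assms(1-3)] LINT_tail[OF assms(2,4)] has_ac_derivD(3)[OF assms(1,4)]
  by (simp add: algebra_simps)

lemma has_ac_deriv_exp: "has_ac_deriv (\<lambda>x. exp (c * of_real x)) (\<lambda>x. c * exp (c * of_real x))"
proof (rule has_ac_deriv_C1)
  fix x :: real
  have "((\<lambda>z. exp (c * z)) has_field_derivative c * exp (c * of_real x)) (at (of_real x))"
    by (auto intro!: derivative_eq_intros)
  from has_vector_derivative_real_field[OF this]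
  show "((\<lambda>x. exp (c * of_real x)) has_vector_derivative c * exp (c * of_real x)) (at x within {0..})"
    by (rule has_vector_derivative_at_within)
qed (intro continuous_intros)

lemma has_ac_deriv_of_real: "has_ac_deriv of_real (\<lambda>x. 1)"
proof (rule has_ac_deriv_C1)
  fix x :: real
  show "(of_real has_vector_derivative 1) (at x within {0..})"
    by (auto intro!: derivative_eq_intros simp: has_vector_derivative_def scaleR_conv_of_real)
qed (intro continuous_intros)

lemma bounded_half_line:
  fixes f :: "real \<Rightarrow> complex"
  assumes "continuous_on {0..} f" "(f \<longlongrightarrow> l) at_top"
  shows "\<exists>B. \<forall>x\<ge>0. norm (f x) \<le> B"
proof -
  have "\<forall>\<^sub>F x in at_top. norm (f x) < norm l + 1"
    by (rule order_tendstoD(2)[OF tendsto_norm[OF assms(2)]]) simp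
  then obtain N where N: "\<And>x. x \<ge> N \<Longrightarrow> norm (f x) < norm l + 1"
    unfolding eventually_at_top_linorder by auto
  have "compact (f ` {0..N})"
    by (intro compact_continuous_image continuous_on_subset[OF assms(1)]) auto
  then obtain B where B: "\<And>x. x \<in> {0..N} \<Longrightarrow> norm (f x) \<le> B"
    using compact_imp_bounded[of "f ` {0..N}"] unfolding bounded_iff by blast
  have "norm (f x) \<le> max B (norm l + 1)" if "x \<ge> 0" for x
    using N[of x] B[of x] that by (cases "x \<ge> N") (auto simp: le_max_iff_disj)
  then show ?thesis by blast
qed

lemma cnj_exp_slope: "cnj (exp_slope z) = exp_slope (cnj z)"
  by (simp add: exp_slope_def exp_cnj)

section \<open>Derivative and decay of the Volterra solution\<close>

context half_line_potential
begin

text \<open>The factor 1 + x in the majorant admits linear growth of \<open>f\<close>; this serves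
  the term y m(y) at zero energy and elements of the form domain.\<close>

lemma U_mult_integrable:
  fixes f :: "real \<Rightarrow> complex"
  assumes "continuous_on {0..} f" "\<And>x. x \<ge> 0 \<Longrightarrow> norm (f x) \<le> B * (1 + x)"
  shows "integrable lebesgue (\<lambda>y. of_real (U y) * f y)"
proof (rule Bochner_Integration.integrable_bound)
  show "integrable lebesgue (\<lambda>y. q y * B)" using q_integrable by simp
  have "(\<lambda>y. complex_of_real (U y) * (indicat_real {0..} y *\<^sub>R f y)) \<in> borel_measurable lebesgue"
    by (rule borel_measurable_times[OF _ half_line_measurable[OF assms(1)]]) measurable
  moreover have "(\<lambda>y. complex_of_real (U y) * (indicat_real {0..} y *\<^sub>R f y)) = (\<lambda>y. of_real (U y) * f y)"
    by (auto simp: U_def indicator_def)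
  ultimately show "(\<lambda>y. of_real (U y) * f y) \<in> borel_measurable lebesgue" by simp
  show "AE y in lebesgue. norm (complex_of_real (U y) * f y) \<le> norm (q y * B)"
  proof (rule AE_I2)
    fix y
    show "norm (complex_of_real (U y) * f y) \<le> norm (q y * B)"
    proof (cases "y \<ge> 0")
      case True
      have "norm (complex_of_real (U y) * f y) \<le> \<bar>V y\<bar> * (B * (1 + y))"
        unfolding norm_mult using assms(2)[OF True] True by (intro mult_mono) (auto simp: U_def)
      also have "\<dots> = q y * B" using True by (simp add: q_def)
      finally show ?thesis by simp
    qed (simp add: U_def)
  qed
qed

lemma U_mult_set_integrable:
  fixes f :: "real \<Rightarrow> complex"
  assumes "continuous_on {0..} f" "\<And>x. x \<ge> 0 \<Longrightarrow> norm (f x) \<le> B"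
  shows "set_integrable lebesgue {0..} (\<lambda>y. of_real (U y) * f y)"
proof -
  have "norm (f x) \<le> B * (1 + x)" if "x \<ge> 0" for x
    using mult_left_mono[of 1 "1 + x" B] assms(2)[OF that] norm_ge_zero[of "f x"] that
    by (auto intro: order_trans)
  then show ?thesis
    unfolding set_integrable_def using U_mult_integrable[OF assms(1)]
    by (intro integrable_mult_indicator) auto
qed

text \<open>Controls the derivative of \<open>m\<close>. In contrast to \<open>\<tau>\<close> below,
  it is shown to be integrable on the half-line, which the analysis at zero energy uses.\<close>

definition \<sigma> :: "real \<Rightarrow> real" where "\<sigma> x = (LINT y:{x..}|lebesgue. \<bar>U y\<bar>)"

lemma absU_set_integrable: "S \<in> sets lebesgue \<Longrightarrow> set_integrable lebesgue S (\<lambda>y. \<bar>U y\<bar>)"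
  unfolding set_integrable_def
proof (rule integrable_mult_indicator)
  show "integrable lebesgue (\<lambda>y. \<bar>U y\<bar>)"
    by (rule Bochner_Integration.integrable_bound[OF q_integrable])
       (use U_le_q in \<open>auto intro!: AE_I2 intro: order_trans[OF _ abs_ge_self]\<close>)
qed

lemma \<sigma>_nonneg: "\<sigma> x \<ge> 0"
  unfolding \<sigma>_def set_lebesgue_integral_def by (rule integral_nonneg_AE) (auto simp: indicator_def)

definition \<tau> :: "real \<Rightarrow> real" where "\<tau> x = (LINT y:{x..}|lebesgue. q y)"

lemma \<tau>_tendsto: "(\<tau> \<longlongrightarrow> 0) at_top"
  unfolding \<tau>_def[abs_def] by (rule tail_tendsto_0) (rule q_set_integrable, simp)

lemma norm_tail_le:
  fixes f :: "real \<Rightarrow> complex"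
  assumes "x \<ge> 0" "\<And>y. y \<ge> x \<Longrightarrow> norm (f y) \<le> q y * B"
  shows "norm (LINT y:{x..}|lebesgue. f y) \<le> \<tau> x * B"
proof -
  have "norm (LINT y:{x..}|lebesgue. f y) \<le> (LINT y|lebesgue. (indicator {x..} y *\<^sub>R q y) * B)"
    unfolding set_lebesgue_integral_def
    by (rule norm_integral_le_integral)
       (use q_set_integrable[of "{x..}"] assms in \<open>auto simp: set_integrable_def indicator_def\<close>)
  then show ?thesis unfolding \<tau>_def set_lebesgue_integral_def by simp
qed

lemma volterra_alt:
  "volterra f x z = (LINT y:{x..}|lebesgue. of_real (U y) * volterra_kernel (y - x) z * f y)"
  unfolding volterra_def set_lebesgue_integral_def
  by (intro Bochner_Integration.integral_cong) (auto simp: indicator_def max_def)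

text \<open>The x-derivative of \<open>m\<close>, read off from the Volterra equation: the kernel
  has derivative exp(2\<i>zt) in t, and its vanishing at 0 leaves no boundary term.\<close>

definition n :: "real \<Rightarrow> complex \<Rightarrow> complex" where
  "n x z = - (LINT y:{x..}|lebesgue. of_real (U y) * (exp (2 * \<i> * z * of_real (y - x)) * m y z))"

lemma norm_m_minus_1_le:
  assumes "x \<ge> 0" "Im z \<ge> 0"
  shows "norm (m x z - 1) \<le> \<tau> x * C\<^sub>m"
proof -
  have "norm (of_real (U y) * volterra_kernel (y - x) z * m y z) \<le> q y * C\<^sub>m" if "y \<ge> x" for y
  proof -
    have "\<bar>U y\<bar> * norm (volterra_kernel (y - x) z) \<le> \<bar>U y\<bar> * (y - x)"
      using norm_volterra_kernel_le(1)[of "y - x" z] that assms by (intro mult_left_mono) auto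
    also have "\<dots> \<le> q y" by (rule U_mult_le_q) (use that assms in auto)
    finally show ?thesis unfolding norm_mult using norm_m_le[of y z] q_nonneg by (intro mult_mono) auto
  qed
  from norm_tail_le[OF assms(1) this] show ?thesis
    using m_eq[OF assms] unfolding volterra_alt by simp
qed

text \<open>The preceding bound serves x to infinity; this one serves z to infinity and gives the
  asymptotics of \<open>w\<close>.\<close>

lemma norm_m_minus_1_le_inverse:
  assumes "x \<ge> 0" "Im z \<ge> 0" "z \<noteq> 0"
  shows "norm (m x z - 1) \<le> \<tau> x * (C\<^sub>m / norm z)"
proof -
  have "norm (of_real (U y) * volterra_kernel (y - x) z * m y z) \<le> q y * (C\<^sub>m / norm z)" if "y \<ge> x" for y
  proof -
    have "\<bar>U y\<bar> * norm (volterra_kernel (y - x) z) * norm (m y z) \<le> q y * (1 / norm z) * C\<^sub>m"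
      using norm_volterra_kernel_le(2)[of "y - x" z] that assms U_le_q[of y] norm_m_le[of y z] q_nonneg
      by (intro mult_mono) auto
    then show ?thesis by (simp add: norm_mult)
  qed
  from norm_tail_le[OF assms(1) this] show ?thesis
    using m_eq[OF assms(1,2)] unfolding volterra_alt by simp
qed

lemma norm_n_le_\<sigma>:
  assumes "x \<ge> 0" "Im z \<ge> 0"
  shows "norm (n x z) \<le> \<sigma> x * C\<^sub>m"
proof -
  have "norm (n x z) \<le> (LINT y|lebesgue. (indicator {x..} y *\<^sub>R \<bar>U y\<bar>) * C\<^sub>m)"
    unfolding n_def norm_minus_cancel set_lebesgue_integral_def
  proof (rule norm_integral_le_integral)
    show "integrable lebesgue (\<lambda>y. (indicator {x..} y *\<^sub>R \<bar>U y\<bar>) * C\<^sub>m)"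
      using absU_set_integrable[of "{x..}"] by (simp add: set_integrable_def)
    fix y
    show "norm (indicat_real {x..} y *\<^sub>R (of_real (U y) * (exp (2 * \<i> * z * of_real (y - x)) * m y z)))
        \<le> indicator {x..} y *\<^sub>R \<bar>U y\<bar> * C\<^sub>m"
    proof (cases "y \<ge> x")
      case True
      have "norm (exp (2 * \<i> * z * of_real (y - x))) * norm (m y z) \<le> 1 * C\<^sub>m"
        using norm_m_le[of y z] assms True by (intro mult_mono) auto
      then have "\<bar>U y\<bar> * (norm (exp (2 * \<i> * z * of_real (y - x))) * norm (m y z)) \<le> \<bar>U y\<bar> * C\<^sub>m"
        by (intro mult_left_mono) auto
      then show ?thesis unfolding norm_scaleR norm_mult norm_of_real using True by simp
    qed simp
  qed
  then show ?thesis unfolding \<sigma>_def set_lebesgue_integral_def by simp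
qed

lemma norm_n_le:
  assumes "x \<ge> 0" "Im z \<ge> 0"
  shows "norm (n x z) \<le> \<tau> x * C\<^sub>m"
proof -
  have "\<sigma> x \<le> \<tau> x"
    unfolding \<sigma>_def \<tau>_def
    by (rule set_integral_mono[OF absU_set_integrable q_set_integrable]) (use U_le_q in auto)
  then show ?thesis
    using norm_n_le_\<sigma>[OF assms] C\<^sub>m_nonneg by (meson mult_right_mono order_trans)
qed

lemma continuous_on_half_line_m: "continuous_on S (\<lambda>x. m x z)"
  by (intro continuous_intros)

lemma continuous_on_n:
  assumes "x \<ge> 0"
  shows "continuous_on {z. Im z \<ge> 0} (\<lambda>z. n x z)"
  unfolding n_def set_lebesgue_integral_def
proof (intro continuous_on_minus continuous_on_integral_dominated[where w = "\<lambda>y. q y * C\<^sub>m"])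
  fix z assume z: "z \<in> {z. Im z \<ge> 0}"
  have "set_integrable lebesgue {x..} (\<lambda>y. of_real (U y) * (exp (2 * \<i> * z * of_real (y - x)) * m y z))"
  proof (rule set_integrable_subset)
    \<comment> \<open>Between 0 and \<open>x\<close> the exponential can exceed 1, hence the
      constant \<open>exp (2 * Im z * x)\<close>, which is harmless for fixed \<open>x\<close> and
      \<open>z\<close>.\<close>
    have "norm (exp (2 * \<i> * z * of_real (y - x)) * m y z) \<le> exp (2 * Im z * x) * C\<^sub>m" if "y \<ge> 0" for y
      unfolding norm_mult using norm_m_le[of y z] z that by (intro mult_mono) (auto simp: algebra_simps)
    then show "set_integrable lebesgue {0..} (\<lambda>y. of_real (U y) * (exp (2 * \<i> * z * of_real (y - x)) * m y z))"
      by (intro U_mult_set_integrable continuous_intros)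
  qed (use assms in auto)
  then show "(\<lambda>y. indicat_real {x..} y *\<^sub>R (of_real (U y) * (exp (2 * \<i> * z * of_real (y - x)) * m y z)))
      \<in> borel_measurable lebesgue"
    unfolding set_integrable_def by auto
  fix y
  show "norm (indicat_real {x..} y *\<^sub>R (of_real (U y) * (exp (2 * \<i> * z * of_real (y - x)) * m y z))) \<le> q y * C\<^sub>m"
  proof (cases "y \<ge> x")
    case True
    then have "norm (of_real (U y) * (exp (2 * \<i> * z * of_real (y - x)) * m y z)) \<le> q y * C\<^sub>m"
      unfolding norm_mult norm_of_real
      using U_le_q[of y] q_nonneg norm_m_le[of y z] z
      by (intro mult_mono mult_left_le_one_le[THEN order_trans]) auto
    with True show ?thesis by simp
  qed (simp add: q_nonneg C\<^sub>m_nonneg)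
qed (auto intro!: continuous_intros integrable_mult_left q_integrable)

text \<open>Once the dependence on \<open>x\<close> is factored out of the integrand, the product
  rule and \<open>has_ac_deriv_tail\<close> apply.\<close>

lemma exp_times_tail:
  assumes "Im z \<ge> 0"
  shows "(LINT y:{x..}|lebesgue. of_real (U y) * (exp (2 * \<i> * z * of_real (y - x)) * f y))
    = exp (- 2 * \<i> * z * of_real x) * (LINT y:{x..}|lebesgue. of_real (U y) * (exp (2 * \<i> * z * of_real y) * f y))"
proof -
  have "exp (2 * \<i> * z * of_real (y - x)) = exp (- 2 * \<i> * z * of_real x) * exp (2 * \<i> * z * of_real y)" for y
    by (simp add: algebra_simps flip: exp_add)
  then have eq: "(\<lambda>y. indicat_real {x..} y *\<^sub>R (of_real (U y) * (exp (2 * \<i> * z * of_real (y - x)) * f y)))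
    = (\<lambda>y. exp (- 2 * \<i> * z * of_real x) *
        (indicat_real {x..} y *\<^sub>R (of_real (U y) * (exp (2 * \<i> * z * of_real y) * f y))))"
    by (simp add: scaleR_conv_of_real mult_ac)
  show ?thesis
    unfolding set_lebesgue_integral_def eq by (rule Bochner_Integration.integral_mult_right_zero)
qed

lemma volterra_integrable:
  fixes f :: "real \<Rightarrow> complex"
  assumes "continuous_on {0..} f" "\<And>x. x \<ge> 0 \<Longrightarrow> norm (f x) \<le> B" "x \<ge> 0" "Im z \<ge> 0"
  shows "integrable lebesgue (\<lambda>y. of_real (U y) * volterra_kernel (max 0 (y - x)) z * f y)"
proof -
  have "norm (volterra_kernel (max 0 (y - x)) z * f y) \<le> B * (1 + y)" if "y \<ge> 0" for y
  proof -
    have "norm (volterra_kernel (max 0 (y - x)) z) \<le> max 0 (y - x)"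
      using norm_volterra_kernel_le(1)[of _ z] assms by simp
    also have "\<dots> \<le> 1 + y" using assms that by simp
    finally show ?thesis
      using mult_mono[of "norm (volterra_kernel (max 0 (y - x)) z)" "1 + y" "norm (f y)" B] assms(2) that
      by (simp add: norm_mult mult.commute)
  qed
  then have "integrable lebesgue (\<lambda>y. of_real (U y) * (volterra_kernel (max 0 (y - x)) z * f y))"
    by (intro U_mult_integrable continuous_intros assms(1))
  then show ?thesis by (simp add: mult.assoc)
qed

lemma volterra_diff:
  fixes f g :: "real \<Rightarrow> complex"
  assumes "continuous_on {0..} f" "\<And>x. x \<ge> 0 \<Longrightarrow> norm (f x) \<le> B"
    "continuous_on {0..} g" "\<And>x. x \<ge> 0 \<Longrightarrow> norm (g x) \<le> B'" "x \<ge> 0" "Im z \<ge> 0"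
  shows "volterra (\<lambda>x. f x - g x) x z = volterra f x z - volterra g x z"
  unfolding volterra_def right_diff_distrib
  by (intro Bochner_Integration.integral_diff volterra_integrable[OF assms(1,2)] volterra_integrable[OF assms(3,4)] assms(5,6))

text \<open>The two terms of the kernel are separated so that each is an explicit factor times a
  tail integral. At \<open>z = 0\<close> the terms y and x of y - x are separated instead, in
  \<open>volterra_at_0\<close>.\<close>

lemma volterra_split:
  assumes "continuous_on {0..} f" "\<And>x. x \<ge> 0 \<Longrightarrow> norm (f x) \<le> B" "x \<ge> 0" "Im z \<ge> 0" "z \<noteq> 0"
  shows "volterra f x z = (exp (- 2 * \<i> * z * of_real x) *
      (LINT y:{x..}|lebesgue. of_real (U y) * (exp (2 * \<i> * z * of_real y) * f y))
      - (LINT y:{x..}|lebesgue. of_real (U y) * f y)) / (2 * \<i> * z)"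
proof -
  have i1: "set_integrable lebesgue {x..} (\<lambda>y. of_real (U y) * f y)"
    by (rule set_integrable_subset[OF U_mult_set_integrable[OF assms(1,2)]]) (use assms in auto)
  have "norm (exp (2 * \<i> * z * of_real (y - x)) * f y) \<le> exp (2 * Im z * x) * B" if "y \<ge> 0" for y
    unfolding norm_mult using assms(2)[of y] assms that by (intro mult_mono) (auto simp: algebra_simps)
  then have i2: "set_integrable lebesgue {x..} (\<lambda>y. of_real (U y) * (exp (2 * \<i> * z * of_real (y - x)) * f y))"
    by (intro set_integrable_subset[OF U_mult_set_integrable] continuous_intros assms) (use assms in auto)
  have "volterra f x z = (LINT y:{x..}|lebesgue.
      (of_real (U y) * (exp (2 * \<i> * z * of_real (y - x)) * f y) - of_real (U y) * f y) / (2 * \<i> * z))"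
    unfolding volterra_alt using assms(5)
    by (intro set_lebesgue_integral_cong) (auto simp: volterra_kernel_eq field_simps)
  also have "\<dots> = ((LINT y:{x..}|lebesgue. of_real (U y) * (exp (2 * \<i> * z * of_real (y - x)) * f y))
      - (LINT y:{x..}|lebesgue. of_real (U y) * f y)) / (2 * \<i> * z)"
    using i1 i2 by (simp add: set_integral_diff)
  finally show ?thesis unfolding exp_times_tail[OF assms(4)] .
qed

lemma volterra_at_0:
  assumes "continuous_on {0..} f" "\<And>x. x \<ge> 0 \<Longrightarrow> norm (f x) \<le> B" "x \<ge> 0"
  shows "volterra f x 0 = (LINT y:{x..}|lebesgue. of_real (U y) * (of_real y * f y))
      - of_real x * (LINT y:{x..}|lebesgue. of_real (U y) * f y)"
proof -
  have i1: "set_integrable lebesgue {x..} (\<lambda>y. of_real (U y) * f y)"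
    by (rule set_integrable_subset[OF U_mult_set_integrable[OF assms(1,2)]]) (use assms in auto)
  have "norm (of_real y * f y) \<le> B * (1 + y)" if "y \<ge> 0" for y
    using mult_mono[of y "1 + y" "norm (f y)" B] assms(2)[of y] that by (simp add: norm_mult mult.commute)
  then have "integrable lebesgue (\<lambda>y. of_real (U y) * (of_real y * f y))"
    by (intro U_mult_integrable continuous_intros assms)
  then have i2: "set_integrable lebesgue {x..} (\<lambda>y. of_real (U y) * (of_real y * f y))"
    unfolding set_integrable_def by (intro integrable_mult_indicator) auto
  have "volterra f x 0 = (LINT y:{x..}|lebesgue.
      (of_real (U y) * (of_real y * f y) - of_real x * (of_real (U y) * f y)))"
    unfolding volterra_alt
    by (intro set_lebesgue_integral_cong) (auto simp: volterra_kernel_at_0 algebra_simps)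
  also have "\<dots> = (LINT y:{x..}|lebesgue. of_real (U y) * (of_real y * f y))
      - of_real x * (LINT y:{x..}|lebesgue. of_real (U y) * f y)"
    using i1 i2 by (simp add: set_integral_diff)
  finally show ?thesis .
qed

lemma n_eq_tail:
  "Im z \<ge> 0 \<Longrightarrow> n x z = - exp (- 2 * \<i> * z * of_real x) *
     (LINT y:{x..}|lebesgue. of_real (U y) * (exp (2 * \<i> * z * of_real y) * m y z))"
  unfolding n_def exp_times_tail by simp

lemma exp_m_integrable:
  assumes "Im z \<ge> 0"
  shows "set_integrable lebesgue {0..} (\<lambda>y. of_real (U y) * (exp (2 * \<i> * z * of_real y) * m y z))"
    "set_integrable lebesgue {0..} (\<lambda>y. of_real (U y) * m y z)"
proof -
  have "norm (exp (2 * \<i> * z * of_real y) * m y z) \<le> 1 * C\<^sub>m" if "y \<ge> 0" for y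
    unfolding norm_mult using norm_m_le[of y z] that assms by (intro mult_mono) auto
  then show "set_integrable lebesgue {0..} (\<lambda>y. of_real (U y) * (exp (2 * \<i> * z * of_real y) * m y z))"
    by (intro U_mult_set_integrable continuous_intros)
  show "set_integrable lebesgue {0..} (\<lambda>y. of_real (U y) * m y z)"
    by (intro U_mult_set_integrable[OF _ norm_m_le] continuous_intros)
qed

lemma exp_cancel:
  "exp (- 2 * \<i> * z * of_real x) * (of_real (U x) * (exp (2 * \<i> * z * of_real x) * y)) = of_real (U x) * y"
  by (simp add: mult.left_commute mult.assoc[symmetric] flip: exp_add)

lemma has_ac_deriv_n:
  assumes "Im z \<ge> 0"
  shows "has_ac_deriv (\<lambda>x. n x z) (\<lambda>x. - 2 * \<i> * z * n x z + of_real (U x) * m x z)"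
proof -
  note 1 = has_ac_deriv_mult[OF has_ac_deriv_cmult[OF has_ac_deriv_exp[of "- 2 * \<i> * z"], of "-1"]
      has_ac_deriv_tail[OF exp_m_integrable(1)[OF assms]]]
  show ?thesis
    by (rule has_ac_deriv_cong[OF 1]) (use exp_cancel in \<open>simp_all add: n_eq_tail[OF assms]\<close>)
qed

text \<open>The Volterra integral is differentiated in its split form, which exists in two versions;
  the boundary contributions of the two tails cancel in both.\<close>

lemma has_ac_deriv_m:
  assumes "Im z \<ge> 0"
  shows "has_ac_deriv (\<lambda>x. m x z) (\<lambda>x. n x z)"
proof (cases "z = 0")
  case True
  have "norm (of_real y * m y z) \<le> C\<^sub>m * (1 + y)" if "y \<ge> 0" for y
    using mult_mono[of y "1 + y" "norm (m y z)" C\<^sub>m] norm_m_le[of y z] that by (simp add: norm_mult mult.commute)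
  then have "integrable lebesgue (\<lambda>y. of_real (U y) * (of_real y * m y z))"
    by (intro U_mult_integrable continuous_intros)
  then have "set_integrable lebesgue {0..} (\<lambda>y. of_real (U y) * (of_real y * m y z))"
    unfolding set_integrable_def by (intro integrable_mult_indicator) auto
  note 1 = has_ac_deriv_add[OF has_ac_deriv_const[of 1] has_ac_deriv_diff[OF has_ac_deriv_tail[OF this]
     has_ac_deriv_mult[OF has_ac_deriv_of_real has_ac_deriv_tail[OF exp_m_integrable(2)[OF assms]]]]]
  show ?thesis
  proof (rule has_ac_deriv_cong[OF 1])
    fix x :: real assume "x \<ge> 0"
    then show "1 + ((LINT y:{x..}|lebesgue. of_real (U y) * (of_real y * m y z))
      - of_real x * (LINT y:{x..}|lebesgue. of_real (U y) * m y z)) = m x z"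
      using m_eq[OF \<open>x \<ge> 0\<close> assms]
      by (simp add: True volterra_at_0[OF continuous_on_half_line_m norm_m_le \<open>x \<ge> 0\<close>])
  qed (simp add: n_def True algebra_simps)
next
  case False
  note 1 = has_ac_deriv_add[OF has_ac_deriv_const[of 1] has_ac_deriv_cmult[OF has_ac_deriv_diff[OF 
    has_ac_deriv_mult[OF has_ac_deriv_exp[of "- 2 * \<i> * z"] has_ac_deriv_tail[OF exp_m_integrable(1)[OF assms]]]
     has_ac_deriv_tail[OF exp_m_integrable(2)[OF assms]]], of "1 / (2 * \<i> * z)"]]
  show ?thesis
  proof (rule has_ac_deriv_cong[OF 1])
    fix x :: real assume "x \<ge> 0"
    then show "1 + 1 / (2 * \<i> * z) * (exp (- 2 * \<i> * z * of_real x) *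
         (LINT t:{x..}|lebesgue. of_real (U t) * (exp (2 * \<i> * z * of_real t) * m t z)) -
         (LINT t:{x..}|lebesgue. of_real (U t) * m t z)) = m x z"
      using m_eq[OF \<open>x \<ge> 0\<close> assms]
      by (simp add: volterra_split[OF continuous_on_half_line_m norm_m_le \<open>x \<ge> 0\<close> assms False])
    show "0 + 1 / (2 * \<i> * z) * (- 2 * \<i> * z * exp (- 2 * \<i> * z * of_real x) *
         (LINT t:{x..}|lebesgue. of_real (U t) * (exp (2 * \<i> * z * of_real t) * m t z)) +
         exp (- 2 * \<i> * z * of_real x) * - (of_real (U x) * (exp (2 * \<i> * z * of_real x) * m x z)) -
         - (of_real (U x) * m x z)) = n x z"
      using exp_cancel[of z x "m x z"] False by (simp add: n_eq_tail[OF assms] field_simps)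
  qed
qed

lemma m_tendsto: "Im z \<ge> 0 \<Longrightarrow> ((\<lambda>x. m x z) \<longlongrightarrow> 1) at_top"
proof (rule Lim_null[THEN iffD2], rule Lim_null_comparison)
  show "Im z \<ge> 0 \<Longrightarrow> \<forall>\<^sub>F x in at_top. norm (m x z - 1) \<le> \<tau> x * C\<^sub>m"
    using norm_m_minus_1_le by (auto intro: eventually_mono[OF eventually_ge_at_top[of 0]])
  show "((\<lambda>x. \<tau> x * C\<^sub>m) \<longlongrightarrow> 0) at_top"
    using tendsto_mult_left_zero[OF \<tau>_tendsto] .
qed

lemma n_tendsto: "Im z \<ge> 0 \<Longrightarrow> ((\<lambda>x. n x z) \<longlongrightarrow> 0) at_top"
proof (rule Lim_null_comparison)
  show "Im z \<ge> 0 \<Longrightarrow> \<forall>\<^sub>F x in at_top. norm (n x z) \<le> \<tau> x * C\<^sub>m"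
    using norm_n_le by (auto intro: eventually_mono[OF eventually_ge_at_top[of 0]])
  show "((\<lambda>x. \<tau> x * C\<^sub>m) \<longlongrightarrow> 0) at_top"
    using tendsto_mult_left_zero[OF \<tau>_tendsto] .
qed

section \<open>Existence and uniqueness of the Jost solution\<close>

definition \<theta> :: "complex \<Rightarrow> real \<Rightarrow> complex" where
  "\<theta> z x = exp (\<i> * z * of_real x) * m x z"

definition \<theta>' :: "complex \<Rightarrow> real \<Rightarrow> complex" where
  "\<theta>' z x = exp (\<i> * z * of_real x) * (\<i> * z * m x z + n x z)"

lemma has_ac_deriv_\<theta>: "Im z \<ge> 0 \<Longrightarrow> has_ac_deriv (\<theta> z) (\<theta>' z)"
  by (rule has_ac_deriv_cong[OF has_ac_deriv_mult[OF has_ac_deriv_exp[of "\<i> * z"] has_ac_deriv_m[of z]]])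
     (simp_all add: \<theta>_def \<theta>'_def algebra_simps)

lemma has_ac_deriv_\<theta>':
  assumes "Im z \<ge> 0"
  shows "has_ac_deriv (\<theta>' z) (\<lambda>x. (of_real (V x) - z\<^sup>2) * \<theta> z x)"
proof -
  note 1 = has_ac_deriv_mult[OF has_ac_deriv_exp[of "\<i> * z"]
      has_ac_deriv_add[OF has_ac_deriv_cmult[OF has_ac_deriv_m[OF assms], of "\<i> * z"] has_ac_deriv_n[OF assms]]]
  show ?thesis
    by (rule has_ac_deriv_cong[OF 1])
       (simp_all add: \<theta>_def \<theta>'_def U_def algebra_simps power2_eq_square)
qed

lemma half_deriv_eq:
  assumes "has_ac_deriv f g" "continuous_on {0..} g" "x \<ge> 0"
  shows "half_deriv f x = g x"
  unfolding half_deriv_def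
  by (rule vector_derivative_half_line[OF has_ac_deriv_has_vector_derivative[OF assms] assms(3)])

lemma half_deriv_\<theta>: "Im z \<ge> 0 \<Longrightarrow> x \<ge> 0 \<Longrightarrow> half_deriv (\<theta> z) x = \<theta>' z x"
  by (intro half_deriv_eq has_ac_deriv_\<theta> has_ac_deriv_continuous_on[OF has_ac_deriv_\<theta>'])

lemma is_jost_solution_\<theta>:
  assumes "Im z \<ge> 0" "z \<noteq> 0"
  shows "is_jost_solution V z (\<theta> z)"
  unfolding is_jost_solution_def schroedinger_solution_def
proof (intro conjI)
  have "(\<theta> z has_vector_derivative \<theta>' z x) (at x within {0..})" if "x \<ge> 0" for x
    by (rule has_ac_deriv_has_vector_derivative[OF has_ac_deriv_\<theta>[OF assms(1)]
        has_ac_deriv_continuous_on[OF has_ac_deriv_\<theta>'[OF assms(1)]] that])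
  then show "\<theta> z differentiable_on {0..}"
    unfolding differentiable_on_def using vector_derivative_works differentiableI_vector by blast
  show "has_ac_deriv (half_deriv (\<theta> z)) (\<lambda>x. (of_real (V x) - z\<^sup>2) * \<theta> z x)"
    by (rule has_ac_deriv_cong[OF has_ac_deriv_\<theta>'[OF assms(1)]]) (simp_all add: half_deriv_\<theta> assms)
  show "((\<lambda>x. \<theta> z x / exp (\<i> * z * of_real x)) \<longlongrightarrow> 1) at_top"
    using m_tendsto[OF assms(1)] by (simp add: \<theta>_def)
  have "((\<lambda>x. m x z + n x z / (\<i> * z)) \<longlongrightarrow> 1 + 0 / (\<i> * z)) at_top"
    using assms by (intro tendsto_intros m_tendsto n_tendsto) auto
  moreover have "\<forall>\<^sub>F x in at_top. m x z + n x z / (\<i> * z) = half_deriv (\<theta> z) x / (\<i> * z * exp (\<i> * z * of_real x))"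
    using eventually_ge_at_top[of 0]
    by eventually_elim (use assms in \<open>simp add: half_deriv_\<theta> \<theta>'_def field_simps\<close>)
  ultimately show "((\<lambda>x. half_deriv (\<theta> z) x / (\<i> * z * exp (\<i> * z * of_real x))) \<longlongrightarrow> 1) at_top"
    by (simp add: Lim_transform_eventually)
qed

text \<open>With the exponential removed, any Jost solution becomes a bounded function \<mu> with
  derivative \<nu>. Two first integrals, evaluated from infinity, recover the Volterra equation for
  \<mu>, whose bounded solution is unique.\<close>

lemma jost_solution_unique:
  assumes "Im z \<ge> 0" "z \<noteq> 0" "is_jost_solution V z \<phi>"
  shows "\<phi> 0 = \<theta> z 0" "half_deriv \<phi> 0 = \<theta>' z 0"
proof -
  define d where "d = half_deriv \<phi>"
  define \<mu> where "\<mu> x = exp (- \<i> * z * of_real x) * \<phi> x" for x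
  define \<nu> where "\<nu> x = exp (- \<i> * z * of_real x) * (d x - \<i> * z * \<phi> x)" for x
  have diff: "\<phi> differentiable_on {0..}"
    and d: "has_ac_deriv d (\<lambda>x. (of_real (V x) - z\<^sup>2) * \<phi> x)"
    and l1: "((\<lambda>x. \<phi> x / exp (\<i> * z * of_real x)) \<longlongrightarrow> 1) at_top"
    and l2: "((\<lambda>x. d x / (\<i> * z * exp (\<i> * z * of_real x))) \<longlongrightarrow> 1) at_top"
    using assms(3) unfolding is_jost_solution_def schroedinger_solution_def d_def by auto
  have \<phi>: "has_ac_deriv \<phi> d"
  proof (rule has_ac_deriv_C1)
    show "continuous_on {0..} d" by (rule has_ac_deriv_continuous_on[OF d])
    fix x :: real assume "x \<ge> 0"
    then show "(\<phi> has_vector_derivative d x) (at x within {0..})"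
      using diff unfolding differentiable_on_def d_def half_deriv_def vector_derivative_works by simp
  qed
  have exp_minus': "exp (- \<i> * z * of_real x) = inverse (exp (\<i> * z * of_real x))" for x
    by (simp flip: exp_minus)
  have \<mu>l: "(\<mu> \<longlongrightarrow> 1) at_top"
    using l1 unfolding \<mu>_def[abs_def] exp_minus' by (simp only: divide_inverse mult.commute)
  have "((\<lambda>x. \<i> * z * (d x / (\<i> * z * exp (\<i> * z * of_real x)) - \<mu> x)) \<longlongrightarrow> \<i> * z * (1 - 1)) at_top"
    by (intro tendsto_intros l2 \<mu>l)
  moreover have "\<i> * z * (d x / (\<i> * z * exp (\<i> * z * of_real x)) - \<mu> x) = \<nu> x" for x
    unfolding \<mu>_def \<nu>_def exp_minus' using assms(2) by (simp add: field_simps)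
  ultimately have \<nu>l: "(\<nu> \<longlongrightarrow> 0) at_top" by simp
  have \<mu>: "has_ac_deriv \<mu> \<nu>"
    by (rule has_ac_deriv_cong[OF has_ac_deriv_mult[OF has_ac_deriv_exp[of "- \<i> * z"] \<phi>]])
       (simp_all add: \<mu>_def \<nu>_def algebra_simps)
  have \<nu>: "has_ac_deriv \<nu> (\<lambda>x. - 2 * \<i> * z * \<nu> x + of_real (U x) * \<mu> x)"
    by (rule has_ac_deriv_cong[OF has_ac_deriv_mult[OF has_ac_deriv_exp[of "- \<i> * z"]
            has_ac_deriv_diff[OF d has_ac_deriv_cmult[OF \<phi>, of "\<i> * z"]]]])
       (simp_all add: \<mu>_def \<nu>_def U_def algebra_simps power2_eq_square)
  have \<mu>c: "continuous_on {0..} \<mu>" by (rule has_ac_deriv_continuous_on[OF \<mu>])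
  obtain B where B: "\<And>x. x \<ge> 0 \<Longrightarrow> norm (\<mu> x) \<le> B"
    using bounded_half_line[OF \<mu>c \<mu>l] by auto
  have i1: "set_integrable lebesgue {0..} (\<lambda>y. of_real (U y) * \<mu> y)"
    by (rule U_mult_set_integrable[OF \<mu>c B])
  have "norm (exp (2 * \<i> * z * of_real y) * \<mu> y) \<le> 1 * B" if "y \<ge> 0" for y
    unfolding norm_mult using B[of y] that assms by (intro mult_mono) auto
  then have i2: "set_integrable lebesgue {0..} (\<lambda>y. of_real (U y) * (exp (2 * \<i> * z * of_real y) * \<mu> y))"
    by (intro U_mult_set_integrable continuous_intros \<mu>c)
  have e: "exp (- 2 * \<i> * z * of_real x) * exp (2 * \<i> * z * of_real x) = 1" for x
    by (simp flip: exp_add)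
  \<comment> \<open>First integral: multiplication by exp(2\<i>zx) removes the term -2\<i>z \<nu>
    from the equation for \<nu>, and this factor has norm at most 1, so the limit at infinity is
    still 0.\<close>
  have nu1: "exp (2 * \<i> * z * of_real x) * \<nu> x =
      0 - (LINT y:{x..}|lebesgue. of_real (U y) * (exp (2 * \<i> * z * of_real y) * \<mu> y))" if "x \<ge> 0" for x
  proof (rule has_ac_deriv_eq_tail[OF _ i2 _ that])
    show "has_ac_deriv (\<lambda>x. exp (2 * \<i> * z * of_real x) * \<nu> x) (\<lambda>y. of_real (U y) * (exp (2 * \<i> * z * of_real y) * \<mu> y))"
      by (rule has_ac_deriv_cong[OF has_ac_deriv_mult[OF has_ac_deriv_exp[of "2 * \<i> * z"] \<nu>]])
         (simp_all add: algebra_simps)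
    show "((\<lambda>x. exp (2 * \<i> * z * of_real x) * \<nu> x) \<longlongrightarrow> 0) at_top"
    proof (rule Lim_null_comparison)
      show "\<forall>\<^sub>F x in at_top. norm (exp (2 * \<i> * z * of_real x) * \<nu> x) \<le> norm (\<nu> x)"
        using eventually_ge_at_top[of 0]
        by eventually_elim (use assms in \<open>simp add: norm_mult mult_left_le_one_le\<close>)
    qed (use \<nu>l in \<open>simp add: tendsto_norm_zero\<close>)
  qed
  have nu2: "\<nu> x = - exp (- 2 * \<i> * z * of_real x) *
      (LINT y:{x..}|lebesgue. of_real (U y) * (exp (2 * \<i> * z * of_real y) * \<mu> y))" if "x \<ge> 0" for x
  proof -
    have "\<nu> x = exp (- 2 * \<i> * z * of_real x) * (exp (2 * \<i> * z * of_real x) * \<nu> x)"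
      using e[of x] by (metis mult.assoc mult_1)
    then show ?thesis unfolding nu1[OF that] by simp
  qed
  \<comment> \<open>Second integral: in this combination \<nu> drops out of the derivative, and only
    the potential term remains.\<close>
  have "\<mu> x + 1 / (2 * \<i> * z) * \<nu> x = (1 + 1 / (2 * \<i> * z) * 0)
      - (LINT y:{x..}|lebesgue. 1 / (2 * \<i> * z) * (of_real (U y) * \<mu> y))" if "x \<ge> 0" for x
  proof (rule has_ac_deriv_eq_tail[OF _ _ _ that])
    show "has_ac_deriv (\<lambda>x. \<mu> x + 1 / (2 * \<i> * z) * \<nu> x) (\<lambda>y. 1 / (2 * \<i> * z) * (of_real (U y) * \<mu> y))"
      by (rule has_ac_deriv_cong[OF has_ac_deriv_add[OF \<mu> has_ac_deriv_cmult[OF \<nu>, of "1 / (2 * \<i> * z)"]]])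
         (use assms(2) in \<open>simp_all add: field_simps\<close>)
    show "set_integrable lebesgue {0..} (\<lambda>y. 1 / (2 * \<i> * z) * (of_real (U y) * \<mu> y))"
      using i1 by (rule set_integrable_mult_right)
  qed (intro tendsto_intros \<mu>l \<nu>l)
  then have mu1: "\<mu> x + 1 / (2 * \<i> * z) * \<nu> x = 1 - 1 / (2 * \<i> * z) * (LINT y:{x..}|lebesgue. of_real (U y) * \<mu> y)" if "x \<ge> 0" for x
    using that by (simp only: set_integral_mult_right mult_zero_right add_0_right)
  have \<mu>V: "\<mu> x = 1 + volterra \<mu> x z" if "x \<ge> 0" for x
  proof -
    have "volterra \<mu> x z = (- \<nu> x - (LINT y:{x..}|lebesgue. of_real (U y) * \<mu> y)) / (2 * \<i> * z)"
      by (subst nu2[OF that], subst volterra_split[OF \<mu>c B that assms(1,2)]) simp_all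
    also have "\<dots> = - (1 / (2 * \<i> * z) * \<nu> x) - 1 / (2 * \<i> * z) * (LINT y:{x..}|lebesgue. of_real (U y) * \<mu> y)"
      by (simp only: diff_divide_distrib minus_divide_left times_divide_eq_left mult_1)
    finally show ?thesis using mu1[OF that] by (simp only: add_diff_eq eq_diff_eq diff_eq_eq) algebra
  qed
  have eq: "\<mu> x = m x z" if "x \<ge> 0" for x
  proof -
    have "\<mu> x - m x z = 0"
    proof (rule volterra_fixpoint_0[OF assms(1) _ _ that])
      show "norm (\<mu> x - m x z) \<le> B + C\<^sub>m" if "x \<ge> 0" for x
        using norm_triangle_ineq4[of "\<mu> x" "m x z"] B[OF that] norm_m_le[of x z] by linarith
      fix x :: real assume x: "x \<ge> 0"
      have "volterra (\<lambda>x. \<mu> x - m x z) x z = volterra \<mu> x z - volterra (\<lambda>x. m x z) x z"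
        by (rule volterra_diff[OF \<mu>c _ continuous_on_half_line_m norm_m_le x assms(1)]) (rule B)
      then show "\<mu> x - m x z = volterra (\<lambda>x. \<mu> x - m x z) x z"
        using \<mu>V[OF x] m_eq[OF x assms(1)] by simp
    qed
    then show ?thesis by simp
  qed
  show 1: "\<phi> 0 = \<theta> z 0" using eq[of 0] by (simp add: \<mu>_def \<theta>_def)
  have "\<nu> 0 = n 0 z"
    unfolding nu2[OF order_refl] n_eq_tail[OF assms(1)]
    by (intro arg_cong2[where f = "(*)"] refl set_lebesgue_integral_cong) (auto simp: eq)
  then show "half_deriv \<phi> 0 = \<theta>' z 0"
    using 1 by (simp add: \<nu>_def \<theta>'_def \<theta>_def d_def algebra_simps)
qed

section \<open>Continuity and reality of the Jost function\<close>

definition w :: "real \<Rightarrow> complex \<Rightarrow> complex" where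
  "w \<gamma> z = of_real \<gamma> * m 0 z - \<i> * z * m 0 z - n 0 z"

lemma w_eq: "w \<gamma> z = of_real \<gamma> * \<theta> z 0 - \<theta>' z 0"
  by (simp add: w_def \<theta>_def \<theta>'_def)

lemma jost_function_nz_eq:
  assumes "Im z \<ge> 0" "z \<noteq> 0"
  shows "jost_function_nz \<gamma> V z = w \<gamma> z"
proof -
  have "is_jost_solution V z (jost_solution V z)"
    unfolding jost_solution_def
    by (rule someI[of "is_jost_solution V z"]) (rule is_jost_solution_\<theta>[OF assms])
  from jost_solution_unique[OF assms this] show ?thesis
    by (simp add: jost_function_nz_def w_eq)
qed

lemma continuous_on_w: "continuous_on {z. Im z \<ge> 0} (w \<gamma>)"
  unfolding w_def by (intro continuous_intros continuous_on_n) auto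

lemma jost_function_eq:
  assumes "Im z \<ge> 0"
  shows "jost_function \<gamma> V z = w \<gamma> z"
proof (cases "z = 0")
  case True
  have "(w \<gamma> \<longlongrightarrow> w \<gamma> 0) (at 0 within {z. Im z \<ge> 0})"
    using continuous_on_w by (simp add: continuous_on)
  then have *: "(jost_function_nz \<gamma> V \<longlongrightarrow> w \<gamma> 0) (at 0 within {z. Im z \<ge> 0})"
    by (rule Lim_transform_eventually) (auto simp: eventually_at_filter jost_function_nz_eq)
  \<comment> \<open>\<open>Lim\<close> is determined by convergence only along a nontrivial filter;
    small positive reals approach 0 inside the half-plane.\<close>
  have "at 0 within {z. Im z \<ge> 0} \<noteq> bot"
  proof -
    have "(0::complex) islimpt {z. Im z \<ge> 0}"
      unfolding islimpt_approachable
    proof (intro allI impI)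
      fix e :: real assume "e > 0"
      then show "\<exists>x'\<in>{z. Im z \<ge> 0}. x' \<noteq> 0 \<and> dist x' 0 < e"
        by (intro bexI[of _ "of_real (e/2)"]) auto
    qed
    then show ?thesis by (simp add: trivial_limit_within)
  qed
  then show ?thesis using tendsto_Lim[OF _ *] True by (simp add: jost_function_def)
qed (simp add: jost_function_def jost_function_nz_eq assms)

text \<open>On the imaginary half-axis the kernel is real, so the conjugate of \<open>m\<close>
  solves the same Volterra equation.\<close>

lemma m_real:
  assumes "t \<ge> 0" "x \<ge> 0"
  shows "cnj (m x (\<i> * of_real t)) = m x (\<i> * of_real t)"
proof -
  let ?z = "\<i> * complex_of_real t"
  have z: "Im ?z \<ge> 0" using assms by simp
  have k: "cnj (volterra_kernel s ?z) = volterra_kernel s ?z" for s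
    by (simp add: volterra_kernel_def cnj_exp_slope)
  have "m x ?z - cnj (m x ?z) = 0"
  proof (rule volterra_fixpoint_0[OF z _ _ assms(2)])
    show "norm (m x ?z - cnj (m x ?z)) \<le> C\<^sub>m + C\<^sub>m" for x
      using norm_triangle_ineq4[of "m x ?z" "cnj (m x ?z)"] norm_m_le[of x ?z] by simp
    fix x :: real assume x: "x \<ge> 0"
    have "cnj (volterra (\<lambda>x. m x ?z) x ?z) = volterra (\<lambda>x. cnj (m x ?z)) x ?z"
      unfolding volterra_def Bochner_Integration.integral_cnj[symmetric] by (simp add: k)
    moreover have "volterra (\<lambda>x. m x ?z) x ?z - cnj (volterra (\<lambda>x. m x ?z) x ?z)
        = volterra (\<lambda>x. m x ?z - cnj (m x ?z)) x ?z"
      unfolding \<open>cnj (volterra (\<lambda>x. m x ?z) x ?z) = _\<close>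
      by (rule volterra_diff[symmetric, OF continuous_on_half_line_m norm_m_le _ _ x z])
         (auto intro!: continuous_intros norm_m_le)
    ultimately show "m x ?z - cnj (m x ?z) = volterra (\<lambda>x. m x ?z - cnj (m x ?z)) x ?z"
      using m_eq[OF x z] by simp
  qed
  then show ?thesis by simp
qed

lemma n_real:
  assumes "t \<ge> 0" "x \<ge> 0"
  shows "cnj (n x (\<i> * of_real t)) = n x (\<i> * of_real t)"
  unfolding n_def set_lebesgue_integral_def complex_cnj_minus Bochner_Integration.integral_cnj[symmetric]
  by (intro arg_cong[where f = uminus] Bochner_Integration.integral_cong)
     (use assms m_real[OF assms(1)] in \<open>auto simp: indicator_def exp_cnj\<close>)

lemma w_real:
  assumes "t \<ge> 0"
  shows "Im (w \<gamma> (\<i> * of_real t)) = 0"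
proof -
  have "cnj (w \<gamma> (\<i> * of_real t)) = w \<gamma> (\<i> * of_real t)"
    using m_real[OF assms, of 0] n_real[OF assms, of 0] by (simp add: w_def)
  then show ?thesis by (simp add: complex_eq_iff)
qed

end

section \<open>Zeros of the Jost function\<close>

lemma set_integrable_exp_minus:
  assumes "a > 0"
  shows "set_integrable lebesgue {0..} (\<lambda>x. exp (- a * x) * c :: real)"
  by (intro set_integrable_mult_left nonnegative_absolutely_integrable_1
        integrable_on_exp_minus_to_infinity assms) auto

text \<open>Monotone convergence along the intervals [0, i], over which the integrals are increments
  of the primitive.\<close>

lemma set_integrable_if_primitive_tendsto:
  fixes g :: "real \<Rightarrow> real"
  assumes "has_ac_deriv f (\<lambda>x. of_real (g x))" "continuous_on {0..} g" "\<And>x. g x \<ge> 0" "(f \<longlongrightarrow> l) at_top"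
  shows "set_integrable lebesgue {0..} g"
  unfolding set_integrable_def
proof (rule integrable_monotone_convergence)
  show int: "integrable lebesgue (\<lambda>x. indicat_real {0..real i} x *\<^sub>R g x)" for i
    using absolutely_integrable_continuous_real[OF continuous_on_subset[OF assms(2)], of 0 "real i"]
    by (simp add: set_integrable_def)
  show "AE x in lebesgue. mono (\<lambda>i. indicat_real {0..real i} x *\<^sub>R g x)"
    using assms(3) by (intro AE_I2) (auto simp: mono_def split: split_indicator)
  show "AE x in lebesgue. (\<lambda>i. indicat_real {0..real i} x *\<^sub>R g x) \<longlonglongrightarrow> indicat_real {0..} x *\<^sub>R g x"
  proof (rule AE_I2)
    fix x :: real
    obtain N where "x \<le> real N" using real_arch_simple by blast
    then have "indicat_real {0..real i} x *\<^sub>R g x = indicat_real {0..} x *\<^sub>R g x" if "i \<ge> N" for i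
      using that by (auto split: split_indicator)
    then show "(\<lambda>i. indicat_real {0..real i} x *\<^sub>R g x) \<longlonglongrightarrow> indicat_real {0..} x *\<^sub>R g x"
      by (intro tendsto_eventually eventually_sequentiallyI[of N])
  qed
  show "(\<lambda>x. indicat_real {0..} x *\<^sub>R g x) \<in> borel_measurable lebesgue"
    by (rule half_line_measurable[OF assms(2)])
  have "(LINT x|lebesgue. indicat_real {0..real i} x *\<^sub>R g x) = Re (f (real i) - f 0)" for i
    using has_ac_derivD(3)[OF assms(1), of "real i"]
    by (simp add: set_lebesgue_integral_def scaleR_conv_of_real flip: of_real_mult)
  moreover have "(\<lambda>i. Re (f (real i) - f 0)) \<longlonglongrightarrow> Re (l - f 0)"
    by (intro tendsto_intros filterlim_compose[OF assms(4) filterlim_real_sequentially])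
  ultimately show "(\<lambda>i. LINT x|lebesgue. indicat_real {0..real i} x *\<^sub>R g x) \<longlonglongrightarrow> Re (l - f 0)" by simp
qed

lemma eq_0_if_integral_0:
  fixes f :: "real \<Rightarrow> real"
  assumes "set_integrable lebesgue {0..} f" "continuous_on {0..} f" "\<And>x. x \<ge> 0 \<Longrightarrow> f x \<ge> 0"
    "(LINT x:{0..}|lebesgue. f x) = 0" "x \<ge> 0"
  shows "f x = 0"
proof -
  have i: "set_integrable lebesgue {0..x+1} f" by (rule set_integrable_subset[OF assms(1)]) auto
  have "integral {0..x+1} f = (LINT x:{0..x+1}|lebesgue. f x)"
    using set_lebesgue_integral_eq_integral(2)[OF i] by simp
  also have "\<dots> \<le> (LINT x:{0..}|lebesgue. f x)"
    unfolding set_lebesgue_integral_def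
    by (rule integral_mono) (use i assms in \<open>auto simp: set_integrable_def indicator_def\<close>)
  finally have "integral {0..x+1} f \<le> 0" using assms by simp
  moreover have "integral {0..x+1} f \<ge> 0"
    using set_lebesgue_integral_eq_integral(1)[OF i] assms(3) by (intro integral_nonneg) auto
  ultimately have "integral {0..x+1} f = 0" by simp
  then have "(f has_integral 0) (cbox 0 (x+1))"
    using set_lebesgue_integral_eq_integral(1)[OF i] by (simp add: has_integral_iff)
  moreover have "continuous_on (cbox 0 (x+1)) f" by (rule continuous_on_subset[OF assms(2)]) auto
  ultimately show ?thesis
    using assms(3,5) by (intro has_integral_0_cbox_imp_0[of 0 "x + 1" f x]) auto
qed

lemma has_ac_deriv_wronskian:
  assumes "has_ac_deriv u u'" "has_ac_deriv u' (\<lambda>x. (of_real (V x) - a) * u x)"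
    "has_ac_deriv v v'" "has_ac_deriv v' (\<lambda>x. (of_real (V x) - b) * v x)"
  shows "has_ac_deriv (\<lambda>x. u' x * v x - u x * v' x) (\<lambda>x. (b - a) * (u x * v x))"
  by (rule has_ac_deriv_cong[OF has_ac_deriv_diff[OF has_ac_deriv_mult[OF assms(2,3)] has_ac_deriv_mult[OF assms(1,4)]]])
     (simp_all add: algebra_simps)

section \<open>The zero at zero energy\<close>

context half_line_potential
begin

lemma has_ac_deriv_\<sigma>: "has_ac_deriv (\<lambda>x. of_real (\<sigma> x)) (\<lambda>x. - of_real \<bar>U x\<bar>)"
proof -
  have i: "set_integrable lebesgue {0..} (\<lambda>y. complex_of_real \<bar>U y\<bar>)"
    using absU_set_integrable[of "{0..}"] unfolding set_integrable_def
    by (simp add: scaleR_conv_of_real flip: of_real_mult)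
  have "(LINT y:{x..}|lebesgue. complex_of_real \<bar>U y\<bar>) = of_real (\<sigma> x)" for x
    unfolding \<sigma>_def set_lebesgue_integral_def
    by (simp add: scaleR_conv_of_real flip: of_real_mult integral_complex_of_real)
  with has_ac_deriv_tail[OF i] show ?thesis by simp
qed

lemma mult_\<sigma>_le_\<tau>: "x \<ge> 0 \<Longrightarrow> x * \<sigma> x \<le> \<tau> x"
proof -
  assume "x \<ge> 0"
  have "x * \<sigma> x = (LINT y|lebesgue. x * (indicator {x..} y *\<^sub>R \<bar>U y\<bar>))"
    unfolding \<sigma>_def set_lebesgue_integral_def by simp
  also have "\<dots> \<le> \<tau> x"
    unfolding \<tau>_def set_lebesgue_integral_def
  proof (rule integral_mono)
    show "integrable lebesgue (\<lambda>y. x * (indicat_real {x..} y *\<^sub>R \<bar>U y\<bar>))"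
      using absU_set_integrable[of "{x..}"] unfolding set_integrable_def by (intro integrable_mult_right) auto
    show "integrable lebesgue (\<lambda>y. indicat_real {x..} y *\<^sub>R q y)"
      using q_set_integrable[of "{x..}"] unfolding set_integrable_def by auto
    show "x * (indicat_real {x..} y *\<^sub>R \<bar>U y\<bar>) \<le> indicat_real {x..} y *\<^sub>R q y" for y
      using U_mult_le_q[of x y] \<open>x \<ge> 0\<close> by (auto simp: indicator_def mult.commute)
  qed
  finally show ?thesis .
qed

text \<open>x \<sigma>(x) minus the tail integral of y |V(y)| has derivative \<sigma>(x), since the
  terms x |V(x)| cancel, and both parts tend to 0 by the moment condition.\<close>

lemma \<sigma>_set_integrable: "set_integrable lebesgue {0..} \<sigma>"
proof -
  have "integrable lebesgue (\<lambda>y. y * \<bar>U y\<bar>)"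
  proof (rule Bochner_Integration.integrable_bound[OF q_integrable])
    show "AE y in lebesgue. norm (y * \<bar>U y\<bar>) \<le> norm (q y)"
    proof (rule AE_I2)
      fix y show "norm (y * \<bar>U y\<bar>) \<le> norm (q y)"
        using U_mult_le_q[of y y] q_nonneg[of y] by (cases "y \<ge> 0") (auto simp: abs_mult mult.commute U_def)
    qed
    have [measurable]: "(\<lambda>y::real. y) \<in> borel_measurable lebesgue"
      by (intro continuous_imp_measurable_lebesgue continuous_intros)
    show "(\<lambda>y. y * \<bar>U y\<bar>) \<in> borel_measurable lebesgue" by measurable
  qed
  then have gi: "set_integrable lebesgue {0..} (\<lambda>y. complex_of_real (y * \<bar>U y\<bar>))"
    unfolding set_integrable_def by (intro integrable_mult_indicator integrable_of_real) auto
  have lim: "((\<lambda>x. complex_of_real x * of_real (\<sigma> x)) \<longlongrightarrow> 0) at_top"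
  proof (rule Lim_null_comparison[OF _ \<tau>_tendsto])
    show "\<forall>\<^sub>F x in at_top. norm (complex_of_real x * of_real (\<sigma> x)) \<le> \<tau> x"
      using eventually_ge_at_top[of 0]
      by eventually_elim (use mult_\<sigma>_le_\<tau> \<sigma>_nonneg in \<open>auto simp: norm_mult\<close>)
  qed
  show ?thesis
  proof (rule set_integrable_if_primitive_tendsto[OF _ _ \<sigma>_nonneg tendsto_diff[OF lim tail_tendsto_0[OF gi]]])
    show "has_ac_deriv (\<lambda>x. of_real x * of_real (\<sigma> x) - (LINT y:{x..}|lebesgue. complex_of_real (y * \<bar>U y\<bar>))) (\<lambda>x. of_real (\<sigma> x))"
      by (rule has_ac_deriv_cong[OF has_ac_deriv_diff[OF has_ac_deriv_mult[OF has_ac_deriv_of_real has_ac_deriv_\<sigma>] has_ac_deriv_tail[OF gi]]])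
         auto
    show "continuous_on {0..} \<sigma>"
      using continuous_on_Re[OF has_ac_deriv_continuous_on[OF has_ac_deriv_\<sigma>]] by simp
  qed
qed

text \<open>Up to the factor 2\<i>z, the integral over the half-line of the derivative of the
  Wronskian of m(., 0) and m(., z).\<close>

definition J :: "complex \<Rightarrow> complex" where
  "J z = (LINT y:{0..}|lebesgue. m y 0 * n y z)"

lemma J_integrable:
  assumes "Im z \<ge> 0"
  shows "set_integrable lebesgue {0..} (\<lambda>y. m y 0 * n y z)"
proof (rule set_integrable_bound_continuous)
  show "set_integrable lebesgue {0..} (\<lambda>y. C\<^sub>m * (\<sigma> y * C\<^sub>m))"
    by (intro set_integrable_mult_right set_integrable_mult_left \<sigma>_set_integrable)
  show "continuous_on {0..} (\<lambda>y. m y 0 * n y z)"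
    by (intro continuous_intros has_ac_deriv_continuous_on[OF has_ac_deriv_n] assms)
  show "norm (m x 0 * n x z) \<le> C\<^sub>m * (\<sigma> x * C\<^sub>m)" if "x \<ge> 0" for x
    unfolding norm_mult by (intro mult_mono norm_m_le norm_n_le_\<sigma> that assms C\<^sub>m_nonneg) auto
qed

lemma continuous_on_J: "continuous_on {z. Im z \<ge> 0} J"
  unfolding J_def set_lebesgue_integral_def
proof (rule continuous_on_integral_dominated[where w = "\<lambda>y. indicator {0..} y *\<^sub>R (C\<^sub>m * (\<sigma> y * C\<^sub>m))"])
  show "continuous_on {z. Im z \<ge> 0} (\<lambda>z. indicat_real {0..} y *\<^sub>R (m y 0 * n y z))" for y
    by (cases "y \<ge> 0") (auto intro!: continuous_intros continuous_on_n)
  fix z assume z: "z \<in> {z. Im z \<ge> 0}"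
  show "(\<lambda>y. indicat_real {0..} y *\<^sub>R (m y 0 * n y z)) \<in> borel_measurable lebesgue"
    using J_integrable[of z] z unfolding set_integrable_def by auto
  show "norm (indicat_real {0..} y *\<^sub>R (m y 0 * n y z)) \<le> indicator {0..} y *\<^sub>R (C\<^sub>m * (\<sigma> y * C\<^sub>m))" for y
    using mult_mono[OF norm_m_le[of y 0] norm_n_le_\<sigma>[of y z] C\<^sub>m_nonneg] z
    by (auto simp: indicator_def norm_mult)
next
  show "integrable lebesgue (\<lambda>y. indicat_real {0..} y *\<^sub>R (C\<^sub>m * (\<sigma> y * C\<^sub>m)))"
    using set_integrable_mult_right[OF set_integrable_mult_left[OF \<sigma>_set_integrable, of C\<^sub>m], of C\<^sub>m]
    unfolding set_integrable_def by simp
qed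

text \<open>At \<open>z = 0\<close> the integrand is half the derivative of the square of m(., 0),
  which tends to 1.\<close>

lemma J_0: "2 * J 0 = 1 - (m 0 0)\<^sup>2"
proof -
  have "has_ac_deriv (\<lambda>x. m x 0 * m x 0) (\<lambda>x. 2 * (m x 0 * n x 0))"
    by (rule has_ac_deriv_cong[OF has_ac_deriv_mult[OF has_ac_deriv_m has_ac_deriv_m]]) auto
  then have "(LINT y:{0..}|lebesgue. 2 * (m y 0 * n y 0)) = 1 * 1 - m 0 0 * m 0 0"
    by (rule has_ac_deriv_LINT) (intro set_integrable_mult_right J_integrable tendsto_mult m_tendsto; simp)+
  then show ?thesis by (simp add: J_def power2_eq_square)
qed

text \<open>In the derivative of this Wronskian the potential cancels and only the first-order term
  -2\<i>z n of the equation for \<open>n\<close> survives.\<close>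

lemma low_energy_wronskian:
  assumes "Im z \<ge> 0"
  shows "n 0 0 * m 0 z - m 0 0 * n 0 z = - 2 * \<i> * z * J z"
proof -
  have "has_ac_deriv (\<lambda>x. n x 0 * m x z - m x 0 * n x z) (\<lambda>x. 2 * \<i> * z * (m x 0 * n x z))"
    by (rule has_ac_deriv_cong[OF has_ac_deriv_diff[OF has_ac_deriv_mult[OF has_ac_deriv_n[of 0] has_ac_deriv_m[of z]]
            has_ac_deriv_mult[OF has_ac_deriv_m[of 0] has_ac_deriv_n[of z]]]])
       (use assms in \<open>auto simp: algebra_simps\<close>)
  then have "(LINT y:{0..}|lebesgue. 2 * \<i> * z * (m y 0 * n y z)) = (0 * 1 - 1 * 0) - (n 0 0 * m 0 z - m 0 0 * n 0 z)"
    by (rule has_ac_deriv_LINT) (intro set_integrable_mult_right J_integrable tendsto_intros m_tendsto n_tendsto; use assms in simp)+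
  then show ?thesis by (simp add: J_def)
qed

text \<open>Identities of the form 0 = (z - a) f(z) determine f only away from a; approaching a
  along the vertical ray supplies the missing value.\<close>

lemma zero_from_above:
  fixes f :: "complex \<Rightarrow> complex"
  assumes "continuous_on {z. Im z \<ge> 0} f" "Im a \<ge> 0" "\<And>s. s > 0 \<Longrightarrow> f (a + \<i> * of_real s) = 0"
  shows "f a = 0"
proof -
  have "(\<lambda>k. f (a + \<i> * of_real (inverse (real (Suc k))))) \<longlonglongrightarrow> f a"
  proof (rule continuous_on_tendsto_compose[OF assms(1)])
    have "(\<lambda>k. a + \<i> * complex_of_real (inverse (real (Suc k)))) \<longlonglongrightarrow> a + \<i> * of_real 0"
      by (intro tendsto_intros LIMSEQ_inverse_real_of_nat)
    then show "(\<lambda>k. a + \<i> * complex_of_real (inverse (real (Suc k)))) \<longlonglongrightarrow> a" by simp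
  qed (use assms(2) in auto)
  moreover have "f (a + \<i> * of_real (inverse (real (Suc k)))) = 0" for k
    by (rule assms(3)) simp
  ultimately have "(\<lambda>k::nat. 0) \<longlonglongrightarrow> f a" by (simp only:)
  then show ?thesis by (simp add: LIMSEQ_const_iff)
qed

text \<open>A continuous stand-in for a simple zero of a holomorphic function; it applies at
  boundary points of the half-plane too.\<close>

definition simple_zero :: "real \<Rightarrow> complex \<Rightarrow> bool" where
  "simple_zero \<gamma> a \<longleftrightarrow> (\<exists>h. continuous_on {z. Im z \<ge> 0} h \<and> h a \<noteq> 0 \<and>
     (\<forall>z. Im z \<ge> 0 \<longrightarrow> w \<gamma> z = (z - a) * h z))"

text \<open>If w(0) = 0, then \<gamma> m(0,0) = n(0,0), and the low-energy Wronskian gives m(0,0)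
  w(z) = -\<i>z b(z). The evaluation of J(0) makes b(0) = 1, whatever the potential.\<close>

lemma simple_zero_0:
  assumes "w \<gamma> 0 = 0"
  shows "simple_zero \<gamma> 0"
proof -
  define b where "b z = 2 * J z + m 0 0 * m 0 z" for z
  have b0: "b 0 = 1" using J_0 by (simp add: b_def power2_eq_square)
  have bc: "continuous_on {z. Im z \<ge> 0} b"
    unfolding b_def by (intro continuous_intros continuous_on_J)
  have *: "m 0 0 * w \<gamma> z = - \<i> * z * b z" if "Im z \<ge> 0" for z
  proof -
    have "of_real \<gamma> * m 0 0 = n 0 0" using assms by (simp add: w_def)
    then have "m 0 0 * w \<gamma> z = n 0 0 * m 0 z - m 0 0 * n 0 z - \<i> * z * m 0 0 * m 0 z"
      by (simp add: w_def algebra_simps)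
    then show ?thesis unfolding low_energy_wronskian[OF that] by (simp add: b_def algebra_simps)
  qed
  \<comment> \<open>Otherwise z b(z) vanishes identically, hence b vanishes above 0 and by
    continuity at 0, against b(0) = 1.\<close>
  have "m 0 0 \<noteq> 0"
  proof
    assume 0: "m 0 0 = 0"
    have "b 0 = 0"
    proof (rule zero_from_above[OF bc])
      show "b (0 + \<i> * of_real s) = 0" if "s > 0" for s
        using *[of "\<i> * of_real s"] 0 that by simp
    qed simp
    then show False using b0 by simp
  qed
  then show ?thesis
    unfolding simple_zero_def using * b0
    by (intro exI[of _ "\<lambda>z. - \<i> * b z / m 0 0"]) (auto intro!: continuous_intros bc simp: field_simps)
qed

section \<open>Location and simplicity of the nonzero zeros\<close>

lemma norm_\<theta>_le: "x \<ge> 0 \<Longrightarrow> norm (\<theta> z x) \<le> exp (- Im z * x) * C\<^sub>m"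
  unfolding \<theta>_def norm_mult using norm_m_le[of x z] by simp

lemma norm_\<theta>'_le:
  assumes "x \<ge> 0" "Im z \<ge> 0"
  shows "norm (\<theta>' z x) \<le> exp (- Im z * x) * (norm z * C\<^sub>m + \<tau> 0 * C\<^sub>m)"
proof -
  have "\<tau> x \<le> \<tau> 0"
    unfolding \<tau>_def set_lebesgue_integral_def
    using q_set_integrable[of "{x..}"] q_set_integrable[of "{0..}"] assms q_nonneg
    by (intro integral_mono) (auto simp: set_integrable_def indicator_def)
  then have "norm (n x z) \<le> \<tau> 0 * C\<^sub>m"
    using norm_n_le[OF assms] C\<^sub>m_nonneg by (meson mult_right_mono order_trans)
  moreover have "norm (\<i> * z * m x z) \<le> norm z * C\<^sub>m"
    unfolding norm_mult using norm_m_le[of x z] by (simp add: mult_left_mono)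
  ultimately have "norm (\<i> * z * m x z + n x z) \<le> norm z * C\<^sub>m + \<tau> 0 * C\<^sub>m"
    using norm_triangle_ineq[of "\<i> * z * m x z" "n x z"] by linarith
  then show ?thesis unfolding \<theta>'_def norm_mult by simp
qed

lemma exp_tendsto_0: "a > 0 \<Longrightarrow> ((\<lambda>x. exp (- a * x) * c) \<longlongrightarrow> (0::real)) at_top"
  by (intro tendsto_mult_left_zero filterlim_compose[OF exp_at_bot]
      filterlim_tendsto_neg_mult_at_bot[OF tendsto_const]) (auto simp: filterlim_ident)

lemma \<theta>_tendsto:
  assumes "Im z > 0"
  shows "(\<theta> z \<longlongrightarrow> 0) at_top" "(\<theta>' z \<longlongrightarrow> 0) at_top"
proof -
  show "(\<theta> z \<longlongrightarrow> 0) at_top"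
    by (rule Lim_null_comparison[OF _ exp_tendsto_0[OF assms, of C\<^sub>m]])
       (rule eventually_mono[OF eventually_ge_at_top[of 0] norm_\<theta>_le])
  show "(\<theta>' z \<longlongrightarrow> 0) at_top"
    by (rule Lim_null_comparison[OF _ exp_tendsto_0[OF assms]])
       (rule eventually_mono[OF eventually_ge_at_top[of 0] norm_\<theta>'_le], use assms in auto)
qed

lemma \<theta>_mult_integrable:
  assumes "Im a > 0" "Im z \<ge> 0"
  shows "set_integrable lebesgue {0..} (\<lambda>x. \<theta> a x * \<theta> z x)"
    "set_integrable lebesgue {0..} (\<lambda>x. \<theta> a x * cnj (\<theta> z x))"
proof -
  have b: "norm (\<theta> a x) * norm (\<theta> z x) \<le> exp (- Im a * x) * (C\<^sub>m * C\<^sub>m)" if "x \<ge> 0" for x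
  proof -
    have "norm (\<theta> a x) * norm (\<theta> z x) \<le> (exp (- Im a * x) * C\<^sub>m) * (1 * C\<^sub>m)"
      using norm_\<theta>_le[OF that] that assms C\<^sub>m_nonneg
      by (intro mult_mono norm_\<theta>_le order_trans[OF norm_\<theta>_le mult_right_mono]) auto
    then show ?thesis by (simp add: mult_ac)
  qed
  have c: "continuous_on {0..} (\<theta> a)" "continuous_on {0..} (\<theta> z)"
    using has_ac_deriv_continuous_on[OF has_ac_deriv_\<theta>] assms by auto
  show "set_integrable lebesgue {0..} (\<lambda>x. \<theta> a x * \<theta> z x)" "set_integrable lebesgue {0..} (\<lambda>x. \<theta> a x * cnj (\<theta> z x))"
    by (rule set_integrable_bound_continuous[OF set_integrable_exp_minus[OF assms(1), of "C\<^sub>m * C\<^sub>m"]];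
        use b in \<open>auto intro!: continuous_intros c simp: norm_mult\<close>)+
qed

lemma \<theta>_nontrivial: "\<exists>x\<ge>0. \<theta> z x \<noteq> 0" if "Im z \<ge> 0"
proof -
  have "\<forall>\<^sub>F x in at_top. m x z \<noteq> 0"
    by (rule tendsto_imp_eventually_ne[OF m_tendsto[OF that]]) simp
  then have "\<forall>\<^sub>F x in at_top. \<theta> z x \<noteq> 0 \<and> x \<ge> 0"
    using eventually_ge_at_top[of 0] by eventually_elim (simp add: \<theta>_def)
  then show ?thesis by (auto dest!: eventually_happens)
qed

text \<open>Real \<open>z\<close> is included, where the second solution only oscillates. Splitting
  off its exponential, of norm at most 1, leaves a Wronskian expression that decays with the first
  solution.\<close>

lemma \<theta>_wronskian_integral:
  assumes "Im a > 0" "Im z \<ge> 0"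
  shows "\<theta>' a 0 * \<theta> z 0 - \<theta> a 0 * \<theta>' z 0 = (a\<^sup>2 - z\<^sup>2) * (LINT x:{0..}|lebesgue. \<theta> a x * \<theta> z x)"
proof -
  have 1: "has_ac_deriv (\<lambda>x. \<theta>' a x * \<theta> z x - \<theta> a x * \<theta>' z x) (\<lambda>x. (z\<^sup>2 - a\<^sup>2) * (\<theta> a x * \<theta> z x))"
    using assms by (intro has_ac_deriv_wronskian[where V = V] has_ac_deriv_\<theta> has_ac_deriv_\<theta>') auto
  have bd: "\<theta>' a x * \<theta> z x - \<theta> a x * \<theta>' z x = exp (\<i> * z * of_real x) * (\<theta>' a x * m x z - \<theta> a x * (\<i> * z * m x z + n x z))" for x
    by (simp add: \<theta>_def[of z] \<theta>'_def[of z] algebra_simps)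
  have "((\<lambda>x. \<theta>' a x * m x z - \<theta> a x * (\<i> * z * m x z + n x z)) \<longlongrightarrow> 0 * 1 - 0 * (\<i> * z * 1 + 0)) at_top"
    by (intro tendsto_intros \<theta>_tendsto m_tendsto n_tendsto assms)
  then have l: "((\<lambda>x. \<theta>' a x * m x z - \<theta> a x * (\<i> * z * m x z + n x z)) \<longlongrightarrow> 0) at_top" by simp
  have "((\<lambda>x. \<theta>' a x * \<theta> z x - \<theta> a x * \<theta>' z x) \<longlongrightarrow> 0) at_top"
  proof (rule Lim_null_comparison[OF _ tendsto_norm_zero[OF l]])
    show "\<forall>\<^sub>F x in at_top. norm (\<theta>' a x * \<theta> z x - \<theta> a x * \<theta>' z x) \<le> norm (\<theta>' a x * m x z - \<theta> a x * (\<i> * z * m x z + n x z))"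
      using eventually_ge_at_top[of 0]
      by eventually_elim (use assms in \<open>simp add: bd norm_mult mult_left_le_one_le\<close>)
  qed
  from has_ac_deriv_LINT[OF 1 set_integrable_mult_right[OF \<theta>_mult_integrable(1)[OF assms]] this]
  have "(z\<^sup>2 - a\<^sup>2) * (LINT x:{0..}|lebesgue. \<theta> a x * \<theta> z x) = - (\<theta>' a 0 * \<theta> z 0 - \<theta> a 0 * \<theta>' z 0)" by simp
  then show ?thesis by (simp add: algebra_simps)
qed

lemma has_ac_deriv_wronskian_cnj:
  assumes "Im a \<ge> 0"
  shows "has_ac_deriv (\<lambda>x. \<theta>' a x * cnj (\<theta> a x) - \<theta> a x * cnj (\<theta>' a x))
    (\<lambda>x. (cnj a ^ 2 - a\<^sup>2) * (\<theta> a x * cnj (\<theta> a x)))"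
proof (rule has_ac_deriv_wronskian)
  show "has_ac_deriv (\<lambda>x. cnj (\<theta>' a x)) (\<lambda>x. (of_real (V x) - (cnj a)\<^sup>2) * cnj (\<theta> a x))"
    using has_ac_deriv_cnj[OF has_ac_deriv_\<theta>'[of a]] assms by simp
qed (use assms in \<open>auto intro!: has_ac_deriv_\<theta> has_ac_deriv_\<theta>' has_ac_deriv_cnj\<close>)

text \<open>The self-adjointness argument: the Wronskian of \<theta> with its conjugate vanishes at
  both ends because \<gamma> is real, so a^2 - (cnj a)^2 times the squared norm of \<theta> is 0.
  Hence a^2 is real.\<close>

lemma zero_imaginary:
  assumes "Im a > 0" "w \<gamma> a = 0"
  shows "Re a = 0"
proof -
  note 1 = has_ac_deriv_wronskian_cnj[OF less_imp_le[OF assms(1)]]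
  have "((\<lambda>x. \<theta>' a x * cnj (\<theta> a x) - \<theta> a x * cnj (\<theta>' a x)) \<longlongrightarrow> 0 * cnj 0 - 0 * cnj 0) at_top"
    by (intro tendsto_intros \<theta>_tendsto assms)
  moreover have "\<theta>' a 0 = of_real \<gamma> * \<theta> a 0" using assms(2) by (simp add: w_eq)
  ultimately have 2: "(cnj a ^ 2 - a\<^sup>2) * (LINT x:{0..}|lebesgue. \<theta> a x * cnj (\<theta> a x)) = 0"
    using has_ac_deriv_LINT[OF 1 set_integrable_mult_right[OF \<theta>_mult_integrable(2)], of 0] assms by simp
  have i: "set_integrable lebesgue {0..} (\<lambda>x. (norm (\<theta> a x))\<^sup>2)"
  proof -
    have "integrable lebesgue (\<lambda>x. Re (indicat_real {0..} x *\<^sub>R (\<theta> a x * cnj (\<theta> a x))))"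
      using \<theta>_mult_integrable(2)[of a a] assms unfolding set_integrable_def by (intro integrable_Re) auto
    then show ?thesis unfolding set_integrable_def complex_norm_square[symmetric] by simp
  qed
  have "(LINT x:{0..}|lebesgue. \<theta> a x * cnj (\<theta> a x)) \<noteq> 0"
  proof
    assume "(LINT x:{0..}|lebesgue. \<theta> a x * cnj (\<theta> a x)) = 0"
    moreover have "(LINT x:{0..}|lebesgue. \<theta> a x * cnj (\<theta> a x)) = of_real (LINT x:{0..}|lebesgue. (norm (\<theta> a x))\<^sup>2)"
      unfolding set_lebesgue_integral_def integral_complex_of_real[symmetric]
      by (simp only: complex_norm_square[symmetric] scaleR_conv_of_real of_real_mult of_real_power of_real_eq_id id_apply)
    ultimately have "(LINT x:{0..}|lebesgue. (norm (\<theta> a x))\<^sup>2) = 0" by simp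
    then have "(norm (\<theta> a x))\<^sup>2 = 0" if "x \<ge> 0" for x
      using assms that by (intro eq_0_if_integral_0[OF i]) (auto intro!: continuous_intros has_ac_deriv_continuous_on[OF has_ac_deriv_\<theta>])
    then show False using \<theta>_nontrivial[of a] assms by auto
  qed
  with 2 have "cnj a ^ 2 - a\<^sup>2 = 0" by simp
  then have "Im (a\<^sup>2) = 0" by (metis Reals_cnj_iff complex_cnj_power complex_is_Real_iff eq_iff_diff_eq_0)
  then show ?thesis using assms by (simp add: power2_eq_square)
qed

text \<open>For real k the Wronskian of \<theta> with its conjugate is constant and equals 2\<i>k at
  infinity, whereas the boundary condition with real \<gamma> would make it 0 at the origin.\<close>

lemma w_nonzero_real:
  assumes "Im k = 0" "k \<noteq> 0"
  shows "w \<gamma> k \<noteq> 0"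
proof
  assume w: "w \<gamma> k = 0"
  have ck: "cnj k = k" using assms by (simp add: complex_eq_iff)
  have 1: "has_ac_deriv (\<lambda>x. \<theta>' k x * cnj (\<theta> k x) - \<theta> k x * cnj (\<theta>' k x))
      (\<lambda>x. (k ^ 2 - k\<^sup>2) * (\<theta> k x * cnj (\<theta> k x)))"
    using has_ac_deriv_wronskian_cnj[of k] assms(1) by (simp only: ck order_refl)
  have e: "exp (\<i> * k * of_real x) * cnj (exp (\<i> * k * of_real x)) = 1" for x
    by (simp add: exp_cnj ck flip: exp_add)
  have "\<theta>' k x * cnj (\<theta> k x) - \<theta> k x * cnj (\<theta>' k x) =
     (exp (\<i> * k * of_real x) * cnj (exp (\<i> * k * of_real x))) * 
     ((\<i> * k * m x k + n x k) * cnj (m x k) - m x k * cnj (\<i> * k * m x k + n x k))" for x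
    by (simp add: \<theta>_def \<theta>'_def algebra_simps)
  then have eq: "\<theta>' k x * cnj (\<theta> k x) - \<theta> k x * cnj (\<theta>' k x) =
     (\<i> * k * m x k + n x k) * cnj (m x k) - m x k * cnj (\<i> * k * m x k + n x k)" for x
    unfolding e by simp
  have "((\<lambda>x. \<theta>' k x * cnj (\<theta> k x) - \<theta> k x * cnj (\<theta>' k x)) \<longlongrightarrow> (\<i> * k * 1 + 0) * cnj 1 - 1 * cnj (\<i> * k * 1 + 0)) at_top"
    unfolding eq using assms by (intro tendsto_intros m_tendsto n_tendsto) auto
  then have "(LINT x:{0..}|lebesgue. (k ^ 2 - k\<^sup>2) * (\<theta> k x * cnj (\<theta> k x))) =
      (\<i> * k * 1 + 0) * cnj 1 - 1 * cnj (\<i> * k * 1 + 0) - (\<theta>' k 0 * cnj (\<theta> k 0) - \<theta> k 0 * cnj (\<theta>' k 0))"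
    by (rule has_ac_deriv_LINT[OF 1, rotated]) (simp add: set_integrable_def)
  moreover have "\<theta>' k 0 = of_real \<gamma> * \<theta> k 0" using w by (simp add: w_eq)
  ultimately show False using assms ck by simp
qed

lemma \<theta>_real:
  assumes "t \<ge> 0" "x \<ge> 0"
  shows "cnj (\<theta> (\<i> * of_real t) x) = \<theta> (\<i> * of_real t) x" "cnj (\<theta>' (\<i> * of_real t) x) = \<theta>' (\<i> * of_real t) x"
  using m_real[OF assms] n_real[OF assms] by (simp_all add: \<theta>_def \<theta>'_def exp_cnj)

text \<open>At a zero a the boundary condition reduces the Wronskian of \<theta>(a) and \<theta>(z)
  at the origin to \<theta>(a,0) w(z), which therefore equals (a^2 - z^2) I(z). Reality of
  \<theta>(a) makes I(a) the integral of a square, hence nonzero.\<close>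

lemma simple_zero_imaginary:
  assumes "t > 0" "w \<gamma> (\<i> * of_real t) = 0"
  shows "simple_zero \<gamma> (\<i> * of_real t)" "\<theta> (\<i> * of_real t) 0 \<noteq> 0"
proof -
  let ?a = "\<i> * complex_of_real t"
  have a: "Im ?a > 0" using assms by simp
  define I where "I z = (LINT x:{0..}|lebesgue. \<theta> ?a x * \<theta> z x)" for z
  have Ic: "continuous_on {z. Im z \<ge> 0} I"
    unfolding I_def set_lebesgue_integral_def
  proof (rule continuous_on_integral_dominated[where w = "\<lambda>y. indicator {0..} y *\<^sub>R (exp (- t * y) * (C\<^sub>m * C\<^sub>m))"])
    show "continuous_on {z. Im z \<ge> 0} (\<lambda>z. indicat_real {0..} x *\<^sub>R (\<theta> ?a x * \<theta> z x))" for x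
      unfolding \<theta>_def by (intro continuous_intros)
    show "integrable lebesgue (\<lambda>y. indicat_real {0..} y *\<^sub>R (exp (- t * y) * (C\<^sub>m * C\<^sub>m)))"
      using set_integrable_exp_minus[OF assms(1)] unfolding set_integrable_def by simp
    fix z assume z: "z \<in> {z. Im z \<ge> 0}"
    show "(\<lambda>x. indicat_real {0..} x *\<^sub>R (\<theta> ?a x * \<theta> z x)) \<in> borel_measurable lebesgue"
      using \<theta>_mult_integrable(1)[OF a, of z] z unfolding set_integrable_def by auto
    fix x
    show "norm (indicat_real {0..} x *\<^sub>R (\<theta> ?a x * \<theta> z x)) \<le> indicat_real {0..} x *\<^sub>R (exp (- t * x) * (C\<^sub>m * C\<^sub>m))"
    proof (cases "x \<ge> 0")
      case True
      have "norm (\<theta> ?a x) * norm (\<theta> z x) \<le> (exp (- Im ?a * x) * C\<^sub>m) * (1 * C\<^sub>m)"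
        using True z C\<^sub>m_nonneg
        by (intro mult_mono norm_\<theta>_le order_trans[OF norm_\<theta>_le mult_right_mono]) auto
      then show ?thesis using True by (simp add: norm_mult mult_ac)
    qed simp
  qed
  have \<theta>a: "\<theta>' ?a 0 = of_real \<gamma> * \<theta> ?a 0" using assms by (simp add: w_eq)
  have *: "\<theta> ?a 0 * w \<gamma> z = (?a\<^sup>2 - z\<^sup>2) * I z" if "Im z \<ge> 0" for z
    using \<theta>_wronskian_integral[OF a that] unfolding I_def \<theta>a by (simp add: w_eq algebra_simps)
  have "I ?a \<noteq> 0"
  proof
    assume "I ?a = 0"
    have i: "set_integrable lebesgue {0..} (\<lambda>x. Re (\<theta> ?a x) ^ 2)"
    and e: "(LINT x:{0..}|lebesgue. Re (\<theta> ?a x) ^ 2) = 0"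
    proof -
      have eq: "indicat_real {0..} x *\<^sub>R (\<theta> ?a x * \<theta> ?a x) = of_real (indicat_real {0..} x *\<^sub>R (Re (\<theta> ?a x) ^ 2))" for x
        using \<theta>_real(1)[of t x] assms(1) by (auto simp: indicator_def complex_eq_iff power2_eq_square)
      show "set_integrable lebesgue {0..} (\<lambda>x. Re (\<theta> ?a x) ^ 2)"
        using \<theta>_mult_integrable(1)[OF a, of ?a] a unfolding set_integrable_def eq
        using integrable_Re[of lebesgue "\<lambda>x. of_real (indicat_real {0..} x *\<^sub>R (Re (\<theta> ?a x) ^ 2))"] by simp
      show "(LINT x:{0..}|lebesgue. Re (\<theta> ?a x) ^ 2) = 0"
        using \<open>I ?a = 0\<close> unfolding I_def set_lebesgue_integral_def eq integral_complex_of_real by simp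
    qed
    have "Re (\<theta> ?a x) ^ 2 = 0" if "x \<ge> 0" for x
      using a that by (intro eq_0_if_integral_0[OF i _ _ e])
        (auto intro!: continuous_intros has_ac_deriv_continuous_on[OF has_ac_deriv_\<theta>])
    then have "\<theta> ?a x = 0" if "x \<ge> 0" for x
      using \<theta>_real(1)[of t x] assms(1) that by (simp add: complex_eq_iff)
    then show False using \<theta>_nontrivial[of ?a] a by auto
  qed
  \<comment> \<open>If this value vanished, the same identity would force \<open>I\<close> to vanish
    on the ray above the zero and so at the zero itself.\<close>
  show "\<theta> ?a 0 \<noteq> 0"
  proof
    assume 0: "\<theta> ?a 0 = 0"
    have "I (?a + \<i> * of_real s) = 0" if "s > 0" for s
    proof -
      have "t\<^sup>2 < (t + s)\<^sup>2" using assms(1) that by (intro power_strict_mono) auto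
      moreover have "?a\<^sup>2 - (?a + \<i> * of_real s)\<^sup>2 = of_real ((t + s)\<^sup>2 - t\<^sup>2)"
        by (simp add: power_mult_distrib power2_sum algebra_simps)
      ultimately have "?a\<^sup>2 - (?a + \<i> * of_real s)\<^sup>2 \<noteq> 0" by (simp only: of_real_eq_0_iff)
      moreover have "Im (?a + \<i> * of_real s) \<ge> 0" using assms(1) that by simp
      from *[OF this] have "(?a\<^sup>2 - (?a + \<i> * of_real s)\<^sup>2) * I (?a + \<i> * of_real s) = 0"
        unfolding 0 mult_zero_left by (rule sym)
      ultimately show ?thesis unfolding mult_eq_0_iff by blast
    qed
    then have "I ?a = 0" by (rule zero_from_above[OF Ic less_imp_le[OF a]])
    then show False using \<open>I ?a \<noteq> 0\<close> by simp
  qed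
  then have "w \<gamma> z = (?a\<^sup>2 - z\<^sup>2) * I z / \<theta> ?a 0" if "Im z \<ge> 0" for z
    using *[OF that] by (metis nonzero_mult_div_cancel_left)
  \<comment> \<open>Only z - a is split off from a^2 - z^2; the other factor z + a is nonzero at z =
    a.\<close>
  moreover have "(a\<^sup>2 - z\<^sup>2) * i / th = (z - a) * (- (z + a) * i / th)" for a z i th :: complex
    by (simp add: power2_eq_square algebra_simps)
  ultimately have "w \<gamma> z = (z - ?a) * (- (z + ?a) * I z / \<theta> ?a 0)" if "Im z \<ge> 0" for z
    using that by (simp only:)
  then show "simple_zero \<gamma> ?a"
    unfolding simple_zero_def using \<open>\<theta> ?a 0 \<noteq> 0\<close> \<open>I ?a \<noteq> 0\<close> assms(1)
    by (intro exI[of _ "\<lambda>z. - (z + ?a) * I z / \<theta> ?a 0"] conjI continuous_intros Ic allI impI) auto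
qed

lemma w_zero_cases:
  assumes "Im z \<ge> 0" "w \<gamma> z = 0"
  obtains t where "t \<ge> 0" "z = \<i> * of_real t"
proof (cases "Im z = 0")
  case True
  then have "z = 0" using w_nonzero_real assms by blast
  then show ?thesis using that[of 0] by simp
next
  case False
  then have "Re z = 0" using zero_imaginary assms by auto
  then have "z = \<i> * of_real (Im z)" by (simp add: complex_eq_iff)
  with that[of "Im z"] assms show ?thesis by blast
qed

lemma simple_zero_w:
  assumes "Im z \<ge> 0" "w \<gamma> z = 0"
  shows "simple_zero \<gamma> z"
proof -
  obtain t where "t \<ge> 0" "z = \<i> * of_real t" using w_zero_cases[OF assms] .
  then show ?thesis using simple_zero_0 simple_zero_imaginary assms by (cases "t = 0") auto
qed

text \<open>The leading term -\<i>z m(0,z) is controlled by the inverse kernel bound, and the other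
  two terms are bounded. The explicit rate also confines the zeros to a bounded set.\<close>

lemma w_asymptotic: "\<exists>A. \<forall>z. Im z \<ge> 0 \<longrightarrow> z \<noteq> 0 \<longrightarrow> norm (w \<gamma> z / (- \<i> * z) - 1) \<le> A / norm z"
proof (intro exI allI impI)
  fix z :: complex assume z: "Im z \<ge> 0" "z \<noteq> 0"
  have "w \<gamma> z / (- \<i> * z) - 1 = (m 0 z - 1) + (of_real \<gamma> * m 0 z - n 0 z) / (- \<i> * z)"
    using z by (simp add: w_def field_simps)
  also have "norm \<dots> \<le> norm (m 0 z - 1) + norm ((of_real \<gamma> * m 0 z - n 0 z) / (- \<i> * z))"
    by (rule norm_triangle_ineq)
  also have "norm ((of_real \<gamma> * m 0 z - n 0 z) / (- \<i> * z)) \<le> (\<bar>\<gamma>\<bar> * C\<^sub>m + \<tau> 0 * C\<^sub>m) / norm z"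
  proof -
    have "norm (of_real \<gamma> * m 0 z - n 0 z) \<le> norm (of_real \<gamma> * m 0 z) + norm (n 0 z)"
      by (rule norm_triangle_ineq4)
    also have "\<dots> \<le> \<bar>\<gamma>\<bar> * C\<^sub>m + \<tau> 0 * C\<^sub>m"
      using norm_m_le[of 0 z] norm_n_le[of 0 z] z by (intro add_mono) (auto simp: norm_mult mult_left_mono)
    finally show ?thesis by (simp add: norm_divide norm_mult divide_right_mono)
  qed
  finally have "norm (w \<gamma> z / (- \<i> * z) - 1) \<le> \<tau> 0 * (C\<^sub>m / norm z) + (\<bar>\<gamma>\<bar> * C\<^sub>m + \<tau> 0 * C\<^sub>m) / norm z"
    using norm_m_minus_1_le_inverse[of 0 z] z by simp
  then show "norm (w \<gamma> z / (- \<i> * z) - 1) \<le> (\<tau> 0 * C\<^sub>m + (\<bar>\<gamma>\<bar> * C\<^sub>m + \<tau> 0 * C\<^sub>m)) / norm z"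
    by (simp only: add_divide_distrib times_divide_eq_right)
qed

end

section \<open>The limit phase\<close>

text \<open>Continuity of the quotient is local: near a zero p it equals the cofactor at p divided
  by the factors of the other zeros, which do not vanish there.\<close>

lemma continuous_factorization:
  fixes f :: "complex \<Rightarrow> complex"
  assumes "continuous_on H f" "finite Z" "Z = {z \<in> H. f z = 0}"
    and "\<And>a. a \<in> Z \<Longrightarrow> \<exists>h. continuous_on H h \<and> h a \<noteq> 0 \<and> (\<forall>z\<in>H. f z = (z - a) * h z)"
  shows "\<exists>g. continuous_on H g \<and> (\<forall>z\<in>H. g z \<noteq> 0) \<and> (\<forall>z\<in>H. f z = g z * (\<Prod>a\<in>Z. z - a))"
proof -
  obtain h where h: "\<And>a. a \<in> Z \<Longrightarrow> continuous_on H (h a)" "\<And>a. a \<in> Z \<Longrightarrow> h a a \<noteq> 0"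
    "\<And>a z. a \<in> Z \<Longrightarrow> z \<in> H \<Longrightarrow> f z = (z - a) * h a z"
    using assms(4) by metis
  \<comment> \<open>At a zero the value is the limit of the quotient, namely the cofactor divided by
    the product over the remaining zeros.\<close>
  define g where "g z = (if z \<in> Z then h z z / (\<Prod>a\<in>Z - {z}. z - a) else f z / (\<Prod>a\<in>Z. z - a))" for z
  have prod_nz: "(\<Prod>a\<in>A. z - a) \<noteq> 0" if "A \<subseteq> Z" "z \<notin> A" for A z
    using that finite_subset[OF that(1) assms(2)] by (auto simp: prod_zero_iff)
  have rem: "(\<Prod>a\<in>Z. z - a) = (z - p) * (\<Prod>a\<in>Z - {p}. z - a)" if "p \<in> Z" for z p
    by (rule prod.remove[OF assms(2) that])
  have g_near: "g z = h p z / (\<Prod>a\<in>Z - {p}. z - a)" if "p \<in> Z" "z \<in> H" "z \<notin> Z - {p}" for p z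
  proof (cases "z \<in> Z")
    case True
    then have "z = p" using that by auto
    then show ?thesis using True by (simp add: g_def)
  next
    case False
    then have "z - p \<noteq> 0" using that by auto
    have "g z = ((z - p) * h p z) / ((z - p) * (\<Prod>a\<in>Z - {p}. z - a))"
      using False by (simp only: g_def if_False h(3)[OF that(1,2)] rem[OF that(1)])
    also have "\<dots> = h p z / (\<Prod>a\<in>Z - {p}. z - a)"
      by (rule mult_divide_mult_cancel_left[OF \<open>z - p \<noteq> 0\<close>])
    finally show ?thesis .
  qed
  show ?thesis
  proof (intro exI[of _ g] conjI ballI)
    show "continuous_on H g"
      unfolding continuous_on_eq_continuous_within
    proof
      fix p assume p: "p \<in> H"
      show "continuous (at p within H) g"
      proof (cases "p \<in> Z")
        case False
        have o: "open (- Z)" using assms(2) by (simp add: finite_imp_closed open_Compl)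
        have "continuous (at p within H) (\<lambda>z. f z / (\<Prod>a\<in>Z. z - a))"
          using assms(1) p prod_nz[OF order_refl False]
          by (intro continuous_intros) (auto simp: continuous_on_eq_continuous_within)
        moreover have "\<forall>\<^sub>F z in at p within H. f z / (\<Prod>a\<in>Z. z - a) = g z"
        proof -
          have "\<forall>\<^sub>F z in at p within H. z \<in> - Z"
            unfolding eventually_at_topological using o False by auto
          then show ?thesis by eventually_elim (simp add: g_def)
        qed
        moreover have "g p = f p / (\<Prod>a\<in>Z. p - a)" using False by (simp add: g_def)
        ultimately show ?thesis
          unfolding continuous_within by (simp only: Lim_transform_eventually)
      next
        case True
        have o: "open (- (Z - {p}))" by (intro open_Compl finite_imp_closed finite_Diff assms(2))
        have "continuous (at p within H) (\<lambda>z. h p z / (\<Prod>a\<in>Z - {p}. z - a))"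
          using h(1)[OF True] p prod_nz[of "Z - {p}" p]
          by (intro continuous_intros) (auto simp: continuous_on_eq_continuous_within)
        moreover have "\<forall>\<^sub>F z in at p within H. h p z / (\<Prod>a\<in>Z - {p}. z - a) = g z"
        proof -
          have "\<forall>\<^sub>F z in at p within H. z \<in> - (Z - {p}) \<and> z \<in> H"
            unfolding eventually_at_topological using o by auto
          then show ?thesis by eventually_elim (rule g_near[OF True, symmetric]; blast)
        qed
        moreover have "g p = h p p / (\<Prod>a\<in>Z - {p}. p - a)" using True by (simp add: g_def)
        ultimately show ?thesis
          unfolding continuous_within by (simp only: Lim_transform_eventually)
      qed
    qed
    fix z assume z: "z \<in> H"
    show "g z \<noteq> 0"
    proof (cases "z \<in> Z")
      case True
      then show ?thesis using h(2) prod_nz[of "Z - {z}" z] by (auto simp: g_def)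
    next
      case False
      then have "f z \<noteq> 0" using assms(3) z by auto
      then show ?thesis using prod_nz[OF order_refl False] False by (simp add: g_def)
    qed
    show "f z = g z * (\<Prod>a\<in>Z. z - a)"
    proof (cases "z \<in> Z")
      case True
      then have "f z = 0" "(\<Prod>a\<in>Z. z - a) = 0" using assms(2,3) by (auto simp: prod_zero_iff)
      then show ?thesis by simp
    next
      case False
      then show ?thesis using prod_nz[OF order_refl False] by (simp add: g_def)
    qed
  qed
qed

text \<open>The values lie in 2 pi \<i> times the integers, hence are 2 pi apart. Two continuous
  logarithms or phases of the same function thus differ by a constant.\<close>

lemma exp_eq_1_connected_constant:
  fixes f :: "'a::topological_space \<Rightarrow> complex"
  assumes "connected S" "continuous_on S f" "\<And>x. x \<in> S \<Longrightarrow> exp (f x) = 1"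
  shows "f constant_on S"
proof (rule continuous_discrete_range_constant[OF assms(1,2)])
  fix x assume x: "x \<in> S"
  show "\<exists>e>0. \<forall>y. y \<in> S \<and> f y \<noteq> f x \<longrightarrow> e \<le> norm (f y - f x)"
  proof (intro exI[of _ "2 * pi"] conjI allI impI)
    fix y assume y: "y \<in> S \<and> f y \<noteq> f x"
    then have "exp (f y - f x) = 1" using assms(3) x by (simp add: exp_diff)
    then obtain k :: int where k: "Re (f y - f x) = 0" "Im (f y - f x) = of_int (2 * k) * pi"
      by (auto simp: exp_eq_1)
    then have "k \<noteq> 0" using y by (auto simp: complex_eq_iff)
    then have "1 \<le> \<bar>real_of_int k\<bar>" by linarith
    then have "2 * pi * 1 \<le> 2 * pi * \<bar>real_of_int k\<bar>" by (intro mult_left_mono) auto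
    also have "\<dots> = \<bar>Im (f y - f x)\<bar>" by (simp only: k(2) abs_mult) simp
    also have "\<dots> \<le> norm (f y - f x)" by (rule abs_Im_le_cmod)
    finally show "2 * pi \<le> norm (f y - f x)" by simp
  qed auto
qed

section \<open>The continuous logarithm on the first quadrant\<close>

definition quadrant :: "complex set" where "quadrant = {z. Re z \<ge> 0 \<and> Im z \<ge> 0}"

lemma convex_quadrant: "convex quadrant"
proof -
  have "quadrant = {z. Re z \<ge> 0} \<inter> {z. Im z \<ge> 0}" by (auto simp: quadrant_def)
  then show ?thesis
    using convex_Int[OF convex_halfspace_Re_ge[of 0] convex_halfspace_Im_ge[of 0]] by (simp only:)
qed

abbreviation quadrant_infinity :: "complex filter" where
  "quadrant_infinity \<equiv> inf at_infinity (principal quadrant)"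

text \<open>
  A continuous logarithm of \<open>G\<close> that vanishes at infinity is real on the imaginary half-axis,
  hence also at the corner of the quadrant, where the two half-axes meet.
\<close>

lemma quadrant_phase:
  assumes "continuous_on quadrant G" "\<And>z. z \<in> quadrant \<Longrightarrow> G z \<noteq> 0"
    and "(G \<longlongrightarrow> 1) quadrant_infinity"
    and "\<And>t. t \<ge> 0 \<Longrightarrow> Im (G (\<i> * of_real t)) = 0"
  shows "\<exists>\<psi>. continuous_on {0..} \<psi> \<and> \<psi> 0 = 0 \<and> (\<psi> \<longlongrightarrow> 0) at_top \<and>
    (\<forall>k\<ge>0. G (of_real k) = of_real (norm (G (of_real k))) * cis (\<psi> k))"
proof -
  obtain L where L: "continuous_on quadrant L" "\<And>z. z \<in> quadrant \<Longrightarrow> G z = exp (L z)"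
    using continuous_logarithm_on_contractible[OF assms(1) convex_imp_contractible[OF convex_quadrant] assms(2)] by metis
  have "\<forall>\<^sub>F z in quadrant_infinity. dist (G z) 1 < 1"
    using assms(3) by (rule tendstoD) simp
  then obtain R where R: "\<And>z. norm z \<ge> R \<Longrightarrow> z \<in> quadrant \<Longrightarrow> dist (G z) 1 < 1"
    unfolding eventually_inf_principal eventually_at_infinity by auto
  \<comment> \<open>Cutting by a line instead of a circle makes the far region convex, hence
    connected; Re z + Im z \<ge> 2|R| forces norm z \<ge> |R|.\<close>
  define S where "S = {z \<in> quadrant. Re z + Im z \<ge> 2 * \<bar>R\<bar>}"
  have SG: "Re (G z) > 0" if "z \<in> S" for z
  proof -
    have "2 * \<bar>R\<bar> \<le> 2 * norm z"
      using that abs_Re_le_cmod[of z] abs_Im_le_cmod[of z] by (auto simp: S_def)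
    then have "dist (G z) 1 < 1" using that R[of z] by (auto simp: S_def)
    then have "\<bar>Re (G z - 1)\<bar> < 1"
      using abs_Re_le_cmod[of "G z - 1"] by (simp add: dist_norm)
    then show ?thesis by simp
  qed
  have "convex {z. Re z + Im z \<ge> 2 * \<bar>R\<bar>}"
  proof -
    have "{z. Re z + Im z \<ge> 2 * \<bar>R\<bar>} = {z. inner (Complex 1 1) z \<ge> 2 * \<bar>R\<bar>}"
      by (simp add: inner_complex_def)
    then show ?thesis by (simp add: convex_halfspace_ge)
  qed
  moreover have "S = quadrant \<inter> {z. Re z + Im z \<ge> 2 * \<bar>R\<bar>}" by (auto simp: S_def)
  ultimately have "convex S" using convex_quadrant by (simp add: convex_Int)
  have SQ: "S \<subseteq> quadrant" by (auto simp: S_def)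
  have LnG: "continuous_on S (\<lambda>z. Ln (G z))"
  proof (rule continuous_on_compose2[OF continuous_on_Ln])
    show "continuous_on S G" by (rule continuous_on_subset[OF assms(1) SQ])
    show "G ` S \<subseteq> - \<real>\<^sub>\<le>\<^sub>0" using SG by (force simp: complex_nonpos_Reals_iff)
  qed auto
  have "(\<lambda>z. L z - Ln (G z)) constant_on S"
  proof (rule exp_eq_1_connected_constant)
    show "connected S" using \<open>convex S\<close> by (rule convex_connected)
    show "continuous_on S (\<lambda>z. L z - Ln (G z))"
      by (intro continuous_intros LnG continuous_on_subset[OF L(1) SQ])
    show "exp (L z - Ln (G z)) = 1" if "z \<in> S" for z
      using that SQ L(2)[of z] assms(2)[of z] by (auto simp: exp_diff)
  qed
  then obtain c where c: "\<And>z. z \<in> S \<Longrightarrow> L z - Ln (G z) = c" by (auto simp: constant_on_def)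
  \<comment> \<open>This normalises the logarithm to agree with \<open>Ln\<close> far out, where
    \<open>G\<close> is close to 1; it then tends to 0 at infinity.\<close>
  define M where "M z = L z - c" for z
  have far: "\<i> * of_real (2 * \<bar>R\<bar>) \<in> S" by (simp add: S_def quadrant_def)
  have "exp c = 1"
    using c[OF far] L(2)[of "\<i> * of_real (2 * \<bar>R\<bar>)"] assms(2)[of "\<i> * of_real (2 * \<bar>R\<bar>)"] far SQ
    by (auto simp: exp_diff simp flip: c[OF far])
  then have M: "continuous_on quadrant M" "\<And>z. z \<in> quadrant \<Longrightarrow> G z = exp (M z)"
    "\<And>z. z \<in> S \<Longrightarrow> M z = Ln (G z)"
    using L c unfolding M_def by (auto intro!: continuous_intros simp: exp_diff algebra_simps)
  have imQ: "\<i> * of_real t \<in> quadrant" if "t \<ge> 0" for t using that by (simp add: quadrant_def)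
  have Gi: "continuous_on {0..} (\<lambda>t. Re (G (\<i> * of_real t)))"
    using imQ by (intro continuous_intros continuous_on_compose2[OF assms(1)]) auto
  have Gr: "G (\<i> * of_real t) = of_real (Re (G (\<i> * of_real t)))" if "t \<ge> 0" for t
    using assms(4)[OF that] by (simp add: complex_eq_iff)
  \<comment> \<open>On the imaginary half-axis \<open>G\<close> is real, nonzero and positive far
    out; a sign change would produce a zero.\<close>
  have pos: "Re (G (\<i> * of_real t)) > 0" if "t \<ge> 0" for t
  proof (rule ccontr)
    assume neg: "\<not> Re (G (\<i> * of_real t)) > 0"
    have farpos: "Re (G (\<i> * of_real (t + 2 * \<bar>R\<bar>))) > 0"
      by (rule SG) (use that in \<open>simp add: S_def quadrant_def\<close>)
    have "\<exists>s. t \<le> s \<and> s \<le> t + 2 * \<bar>R\<bar> \<and> Re (G (\<i> * of_real s)) = 0"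
      using neg farpos that
      by (intro IVT') (auto intro!: continuous_on_subset[OF Gi])
    then obtain s where "t \<le> s" "Re (G (\<i> * of_real s)) = 0" by blast
    then have "s \<ge> 0" using that by simp
    then show False using Gr[of s] assms(2)[OF imQ, of s] \<open>Re (G (\<i> * of_real s)) = 0\<close> by simp
  qed
  \<comment> \<open>\<open>G\<close> is positive on this axis, so the imaginary part of its
    logarithm is locked to multiples of 2 pi; far out it is 0.\<close>
  have "(\<lambda>t. \<i> * of_real (Im (M (\<i> * of_real t)))) constant_on {0..}"
  proof (rule exp_eq_1_connected_constant)
    show "continuous_on {0..} (\<lambda>t. \<i> * of_real (Im (M (\<i> * of_real t))))"
      using imQ by (intro continuous_intros continuous_on_compose2[OF M(1)]) auto
    fix t :: real assume "t \<in> {0..}"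
    then have t: "t \<ge> 0" by simp
    let ?u = "M (\<i> * of_real t)"
    have 1: "exp ?u = of_real (exp (Re ?u)) * exp (\<i> * of_real (Im ?u))"
      using exp_eq_polar[of ?u] by (simp only: cis_conv_exp)
    have 2: "exp ?u = of_real (Re (G (\<i> * of_real t)))"
      using trans[OF M(2)[OF imQ[OF t], symmetric] Gr[OF t]] .
    from arg_cong[OF this, of norm] have "exp (Re ?u) = Re (G (\<i> * of_real t))"
      using pos[OF t] by (simp only: norm_exp_eq_Re norm_of_real abs_of_pos)
    with 1 2 have "of_real (exp (Re ?u)) = complex_of_real (exp (Re ?u)) * exp (\<i> * of_real (Im ?u))"
      by (simp only:)
    then show "exp (\<i> * of_real (Im ?u)) = 1" by simp
  qed simp
  then obtain d where d: "\<And>t. t \<ge> 0 \<Longrightarrow> \<i> * of_real (Im (M (\<i> * of_real t))) = d" by (auto simp: constant_on_def)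
  have "Im (M (\<i> * of_real (2 * \<bar>R\<bar>))) = 0"
    unfolding M(3)[OF far] using pos[of "2 * \<bar>R\<bar>"] by (subst Gr) (auto simp: Ln_of_real)
  then have "d = 0" using d[of "2 * \<bar>R\<bar>"] by simp
  then have M0: "Im (M 0) = 0" using d[of 0] by simp
  have reQ: "of_real k \<in> quadrant" if "k \<ge> 0" for k using that by (simp add: quadrant_def)
  show ?thesis
  proof (intro exI[of _ "\<lambda>k. Im (M (of_real k))"] conjI allI impI)
    show "continuous_on {0..} (\<lambda>k. Im (M (of_real k)))"
      using reQ by (intro continuous_intros continuous_on_compose2[OF M(1)]) auto
    show "Im (M (of_real 0)) = 0" using M0 by simp
    have lim: "filterlim complex_of_real quadrant_infinity at_top"
      unfolding filterlim_inf filterlim_principal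
      by (intro conjI filterlim_norm_at_top_imp_at_infinity eventually_mono[OF eventually_ge_at_top[of 0]] reQ)
         (simp_all add: filterlim_abs_real)
    have "((\<lambda>k. Ln (G (of_real k))) \<longlongrightarrow> Ln 1) at_top"
      by (intro tendsto_Ln filterlim_compose[OF assms(3) lim]) auto
    then have "((\<lambda>k. Im (Ln (G (of_real k)))) \<longlongrightarrow> 0) at_top" using tendsto_Im by force
    moreover have "\<forall>\<^sub>F k in at_top. Im (Ln (G (of_real k))) = Im (M (of_real k))"
      using eventually_ge_at_top[of "2 * \<bar>R\<bar>"]
      by eventually_elim (subst M(3), auto simp: S_def quadrant_def)
    ultimately show "((\<lambda>k. Im (M (of_real k))) \<longlongrightarrow> 0) at_top"
      by (rule Lim_transform_eventually)
    fix k :: real assume "k \<ge> 0"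
    then have eq: "G (of_real k) = exp (M (of_real k))" by (intro M(2) reQ)
    then have "norm (G (of_real k)) = exp (Re (M (of_real k)))" by simp
    with eq show "G (of_real k) = of_real (norm (G (of_real k))) * cis (Im (M (of_real k)))"
      using exp_eq_polar[of "M (of_real k)"] by metis
  qed
qed

text \<open>For positive k the point lies in the right half-plane, so \<open>arctan\<close> is a
  phase that is continuous in k and tends to 0 at infinity.\<close>

lemma polar_arctan:
  assumes "k > 0"
  shows "\<exists>r>0. of_real k + \<i> * of_real t = of_real r * cis (arctan (t / k))"
proof (intro exI conjI)
  have "cos (arctan (t / k)) > 0" using arctan[of "t / k"] by (intro cos_gt_zero_pi) auto
  then show "k / cos (arctan (t / k)) > 0" using assms by simp
  have "t = k * tan (arctan (t / k))" using assms by (simp add: tan_arctan)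
  then have "t = k / cos (arctan (t / k)) * sin (arctan (t / k))" by (simp add: tan_def)
  then show "of_real k + \<i> * of_real t = of_real (k / cos (arctan (t / k))) * cis (arctan (t / k))"
    using \<open>cos (arctan (t / k)) > 0\<close> by (simp add: complex_eq_iff)
qed

lemma prod_cis: "finite S \<Longrightarrow> (\<Prod>t\<in>S. cis (f t)) = cis (\<Sum>t\<in>S. f t)"
  by (induction S rule: finite_induct) (simp_all add: cis_mult)

lemma tendsto_arctan_divide_at_top: "((\<lambda>k. arctan (t / k)) \<longlongrightarrow> 0) at_top"
proof -
  have "((\<lambda>k. arctan (t / k)) \<longlongrightarrow> arctan 0) at_top"
    by (intro tendsto_arctan tendsto_divide_0[OF tendsto_const] filterlim_at_top_imp_at_infinity filterlim_ident)
  then show ?thesis by simp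
qed

text \<open>The convention sgn 0 = 0 lets one formula cover t = 0, which occurs for \<gamma> = 0 and
  for w(0) = 0.\<close>

lemma tendsto_arctan_divide_at_right_0: "((\<lambda>k. arctan (t / k)) \<longlongrightarrow> sgn t * (pi / 2)) (at_right 0)"
proof (cases "t = 0")
  case False
  have inv: "filterlim (\<lambda>k::real. inverse k) at_top (at_right 0)" by (rule filterlim_inverse_at_top_right)
  show ?thesis
  proof (cases "t > 0")
    case True
    have "((\<lambda>k. arctan (t * inverse k)) \<longlongrightarrow> pi / 2) (at_right 0)"
      by (rule filterlim_compose[OF tendsto_arctan_at_top])
         (rule filterlim_tendsto_pos_mult_at_top[OF tendsto_const True inv])
    then show ?thesis unfolding divide_inverse[of t] using True by simp
  next
    case neg: False
    then have "t < 0" using False by simp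
    then have "((\<lambda>k. arctan (t * inverse k)) \<longlongrightarrow> - (pi / 2)) (at_right 0)"
      by (intro filterlim_compose[OF tendsto_arctan_at_bot]
          filterlim_tendsto_neg_mult_at_bot[OF tendsto_const _ inv]) auto
    then show ?thesis unfolding divide_inverse[of t] using \<open>t < 0\<close> by simp
  qed
qed simp

lemma tendsto_moebius_at_infinity: "((\<lambda>z::complex. (z + a) / (z + b)) \<longlongrightarrow> 1) at_infinity"
proof -
  have inf: "filterlim (\<lambda>z. z + b) at_infinity at_infinity"
    by (rule tendsto_add_filterlim_at_infinity'[OF filterlim_ident tendsto_const])
  have "((\<lambda>z. 1 + (a - b) / (z + b)) \<longlongrightarrow> 1 + 0) at_infinity"
    by (intro tendsto_add tendsto_const tendsto_divide_0[OF tendsto_const inf])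
  then have "((\<lambda>z. 1 + (a - b) / (z + b)) \<longlongrightarrow> 1) at_infinity" by simp
  moreover have "\<forall>\<^sub>F z in at_infinity. 1 + (a - b) / (z + b) = (z + a) / (z + b)"
    using eventually_not_equal_at_infinity[of "- b"]
    by eventually_elim (auto simp: field_simps add_eq_0_iff2)
  ultimately show ?thesis by (rule Lim_transform_eventually)
qed

text \<open>Comparing norms makes the amplitudes equal, so two phases differ by a constant multiple
  of 2 pi, which the limit at infinity forces to be 0. This identifies the phase picked by choice
  with the one constructed below.\<close>

lemma is_limit_phase_unique:
  assumes "is_limit_phase \<gamma> V \<eta>" "is_limit_phase \<gamma> V \<eta>'" "k > 0"
  shows "\<eta> k = \<eta>' k"
proof -
  have "(\<lambda>k. \<i> * of_real (\<eta> k - \<eta>' k)) constant_on {0<..}"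
  proof (rule exp_eq_1_connected_constant)
    show "continuous_on {0<..} (\<lambda>k. \<i> * complex_of_real (\<eta> k - \<eta>' k))"
      using assms unfolding is_limit_phase_def by (intro continuous_intros) auto
    fix k :: real assume "k \<in> {0<..}"
    then have k: "k > 0" by simp
    obtain a a' where a: "a > 0" "a' > 0"
      "jost_function \<gamma> V (of_real k) = of_real a * exp (\<i> * of_real (\<eta> k)) * (of_real \<gamma> - \<i> * of_real k)"
      "jost_function \<gamma> V (of_real k) = of_real a' * exp (\<i> * of_real (\<eta>' k)) * (of_real \<gamma> - \<i> * of_real k)"
      using assms k unfolding is_limit_phase_def by metis
    have "of_real \<gamma> - \<i> * of_real k \<noteq> 0" using k by (simp add: complex_eq_iff)
    then have eq: "of_real a * exp (\<i> * of_real (\<eta> k)) = of_real a' * exp (\<i> * of_real (\<eta>' k))"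
      using trans[OF a(3)[symmetric] a(4)] by (simp only: mult_cancel_right simp_thms)
    from arg_cong[OF eq, of norm] have "a = a'" using a by (simp add: norm_mult)
    with eq a have "exp (\<i> * of_real (\<eta> k)) = exp (\<i> * of_real (\<eta>' k))" by simp
    then show "exp (\<i> * of_real (\<eta> k - \<eta>' k)) = 1" by (simp add: right_diff_distrib exp_diff)
  qed simp
  then obtain c where c: "\<And>k. k > 0 \<Longrightarrow> \<i> * of_real (\<eta> k - \<eta>' k) = c" by (auto simp: constant_on_def)
  have "((\<lambda>k. \<i> * complex_of_real (\<eta> k - \<eta>' k)) \<longlongrightarrow> \<i> * of_real (0 - 0)) at_top"
    using assms unfolding is_limit_phase_def by (intro tendsto_intros) auto
  moreover have "\<forall>\<^sub>F k in at_top. \<i> * complex_of_real (\<eta> k - \<eta>' k) = c"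
    using eventually_gt_at_top[of 0] by eventually_elim (rule c)
  ultimately have "((\<lambda>k::real. c) \<longlongrightarrow> \<i> * of_real (0 - 0)) at_top"
    by (rule Lim_transform_eventually)
  then have "c = 0" by (simp add: tendsto_const_iff)
  then show ?thesis using c[OF assms(3)] by simp
qed

section \<open>Counting the zeros and evaluating the phase\<close>

context half_line_potential
begin

definition bound_momenta :: "real \<Rightarrow> real set" where
  "bound_momenta \<gamma> = {t. t > 0 \<and> w \<gamma> (\<i> * of_real t) = 0}"

text \<open>The asymptotics bound the zeros. An accumulation point would itself be a zero by
  continuity, and its cofactor would vanish along the sequence and hence at the point, against
  simplicity.\<close>

lemma finite_zeros: "finite {z. Im z \<ge> 0 \<and> w \<gamma> z = 0}"
proof (rule ccontr)
  let ?Z = "{z. Im z \<ge> 0 \<and> w \<gamma> z = 0}"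
  assume inf: "infinite ?Z"
  obtain A where A: "\<And>z. Im z \<ge> 0 \<Longrightarrow> z \<noteq> 0 \<Longrightarrow> norm (w \<gamma> z / (- \<i> * z) - 1) \<le> A / norm z"
    using w_asymptotic by metis
  have "norm z \<le> \<bar>A\<bar>" if "z \<in> ?Z" for z
    using A[of z] that by (cases "z = 0") (auto simp: le_divide_eq)
  then have "bounded ?Z" by (rule boundedI)
  then obtain p where p: "p islimpt ?Z" using bounded_infinite_imp_islimpt[OF order_refl _ inf] by blast
  have H: "closed {z. Im z \<ge> 0}" by (simp add: closed_halfspace_Im_ge)
  have "p islimpt {z. Im z \<ge> 0}" by (rule islimpt_subset[OF p]) auto
  then have pH: "Im p \<ge> 0" using H unfolding closed_limpt by blast
  obtain s where s: "\<And>k. s k \<in> ?Z - {p}" "s \<longlonglongrightarrow> p"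
    using p unfolding islimpt_sequential by blast
  have lim: "(\<lambda>k. f (s k)) \<longlonglongrightarrow> f p" if "continuous_on {z. Im z \<ge> 0} f" for f :: "complex \<Rightarrow> complex"
    by (rule continuous_on_tendsto_compose[OF that s(2)]) (use pH s(1) in auto)
  have "(\<lambda>k. w \<gamma> (s k)) \<longlonglongrightarrow> w \<gamma> p" by (rule lim[OF continuous_on_w])
  then have "w \<gamma> p = 0" using s(1) by (simp add: LIMSEQ_const_iff)
  from simple_zero_w[OF pH this] obtain h where h: "continuous_on {z. Im z \<ge> 0} h" "h p \<noteq> 0"
    "\<And>z. Im z \<ge> 0 \<Longrightarrow> w \<gamma> z = (z - p) * h z" unfolding simple_zero_def by auto
  have "h (s k) = 0" for k using h(3)[of "s k"] s(1)[of k] by auto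
  then have "h p = 0" using lim[OF h(1)] by (simp add: LIMSEQ_const_iff)
  then show False using h by simp
qed

lemma finite_bound_momenta: "finite (bound_momenta \<gamma>)"
proof (rule finite_imageD)
  show "finite ((\<lambda>t. \<i> * complex_of_real t) ` bound_momenta \<gamma>)"
    by (rule finite_subset[OF _ finite_zeros[of \<gamma>]]) (auto simp: bound_momenta_def)
qed (auto simp: inj_on_def)

lemma zeros_eq: "{z. Im z \<ge> 0 \<and> w \<gamma> z = 0} =
   (if w \<gamma> 0 = 0 then {0} else {}) \<union> (\<lambda>t. \<i> * of_real t) ` bound_momenta \<gamma>" (is "?Z = ?R")
proof
  show "?Z \<subseteq> ?R"
  proof
    fix z assume z: "z \<in> ?Z"
    then obtain t where "t \<ge> 0" "z = \<i> * of_real t" using w_zero_cases by blast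
    then show "z \<in> ?R" using z by (cases "t = 0") (auto simp: bound_momenta_def)
  qed
qed (auto simp: bound_momenta_def)

text \<open>On the positive half-axis \<open>w\<close> is \<open>G\<close> times explicit linear
  factors. The phase of \<open>G\<close> vanishes at both ends, so the limit at 0 is a sum of
  arctangent limits: -pi for each bound momentum, pi/2 from z + \<i> if w(0) is nonzero, and the
  subtracted reference phase of \<gamma> - \<i>k.\<close>

lemma limit_phase_limits:
  fixes \<gamma> :: real
  defines "\<eta>0 \<equiv> - pi * card (bound_momenta \<gamma>) + (if w \<gamma> 0 = 0 then 0 else pi / 2) - sgn \<gamma> * (pi / 2)"
  shows "(limit_phase \<gamma> V \<longlongrightarrow> \<eta>0) (at_right 0)" "(limit_phase \<gamma> V \<longlongrightarrow> 0) at_top"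
proof -
  let ?S = "bound_momenta \<gamma>" and ?H = "{z. Im z \<ge> 0}"
  let ?Z = "{z. Im z \<ge> 0 \<and> w \<gamma> z = 0}"
  have QH: "quadrant \<subseteq> ?H" by (auto simp: quadrant_def)
  have fin: "finite ?S" by (rule finite_bound_momenta)
  have Spos: "t > 0" if "t \<in> ?S" for t using that by (simp add: bound_momenta_def)
  obtain g where g: "continuous_on ?H g" "\<And>z. z \<in> ?H \<Longrightarrow> g z \<noteq> 0"
     "\<And>z. z \<in> ?H \<Longrightarrow> w \<gamma> z = g z * (\<Prod>a\<in>?Z. z - a)"
    using continuous_factorization[OF continuous_on_w finite_zeros, of \<gamma>] simple_zero_w
    unfolding simple_zero_def by (simp add: Ball_def) blast
  \<comment> \<open>The factor z + \<i>b is z when w(0) = 0 and absorbs that zero; otherwise it is z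
    + \<i>, which does not vanish on the half-plane but grows alike.\<close>
  define b where "b = (if w \<gamma> 0 = 0 then 0 else 1 :: real)"
  define G where "G z = \<i> * g z * (\<Prod>t\<in>?S. z + \<i> * of_real t) / (if w \<gamma> 0 = 0 then 1 else z + \<i>)" for z
  have prodZ: "(\<Prod>a\<in>?Z. z - a) = (if w \<gamma> 0 = 0 then z else 1) * (\<Prod>t\<in>?S. z - \<i> * of_real t)" for z
  proof -
    have "(\<Prod>a\<in>(\<lambda>t. \<i> * of_real t) ` ?S. z - a) = (\<Prod>t\<in>?S. z - \<i> * of_real t)"
      by (subst prod.reindex) (auto simp: inj_on_def)
    moreover have "0 \<notin> (\<lambda>t. \<i> * complex_of_real t) ` ?S" by (auto dest: Spos)
    ultimately show ?thesis unfolding zeros_eq using fin by simp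
  qed
  have nz: "(\<Prod>t\<in>?S. z + \<i> * of_real t) \<noteq> 0" if "z \<in> ?H" for z
  proof -
    have "z + \<i> * of_real t \<noteq> 0" if "t \<in> ?S" for t
      using \<open>z \<in> ?H\<close> Spos[OF that] by (auto simp: complex_eq_iff)
    then show ?thesis using fin by (simp add: prod_zero_iff)
  qed
  have nzi: "z + \<i> \<noteq> 0" if "z \<in> ?H" for z using that by (auto simp: complex_eq_iff)
  have wG: "w \<gamma> z * (\<Prod>t\<in>?S. z + \<i> * of_real t) =
      - \<i> * G z * (z + \<i> * of_real b) * (\<Prod>t\<in>?S. z - \<i> * of_real t)" if "z \<in> ?H" for z
    using g(3)[OF that] nzi[OF that] complex_i_mult_minus unfolding prodZ
    by (auto simp: G_def b_def mult_ac)
  have Gc: "continuous_on ?H G"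
    unfolding G_def using nzi by (cases "w \<gamma> 0 = 0") (auto intro!: continuous_intros g(1))
  have Gnz: "G z \<noteq> 0" if "z \<in> ?H" for z
    unfolding G_def using g(2)[OF that] nz[OF that] nzi[OF that] by auto
  obtain A where A: "\<And>z. Im z \<ge> 0 \<Longrightarrow> z \<noteq> 0 \<Longrightarrow> norm (w \<gamma> z / (- \<i> * z) - 1) \<le> A / norm z"
    using w_asymptotic by metis
  have wlim: "((\<lambda>z. w \<gamma> z / (- \<i> * z)) \<longlongrightarrow> 1) quadrant_infinity"
  proof (rule Lim_null[THEN iffD2], rule Lim_null_comparison)
    have "((\<lambda>z::complex. A / norm z) \<longlongrightarrow> 0) at_infinity"
      by (intro tendsto_divide_0[OF tendsto_const] filterlim_at_top_imp_at_infinity filterlim_norm_at_top)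
    then show "((\<lambda>z::complex. A / norm z) \<longlongrightarrow> 0) quadrant_infinity"
      by (rule tendsto_mono[rotated]) simp
    show "\<forall>\<^sub>F z in quadrant_infinity. norm (w \<gamma> z / (- \<i> * z) - 1) \<le> A / norm z"
      unfolding eventually_inf_principal using eventually_not_equal_at_infinity[of 0]
      by eventually_elim (use A QH in auto)
  qed
  have Glim: "(G \<longlongrightarrow> 1) quadrant_infinity"
  proof -
    \<comment> \<open>Away from finitely many points \<open>G\<close> is \<open>w\<close> over
      -\<i>z times Moebius quotients, each tending to 1.\<close>
    have "((\<lambda>z. w \<gamma> z / (- \<i> * z) * ((z + 0) / (z + \<i> * of_real b)) *
        (\<Prod>t\<in>?S. (z + \<i> * of_real t) / (z + - \<i> * of_real t))) \<longlongrightarrow> 1 * 1 * (\<Prod>t\<in>?S. 1)) quadrant_infinity"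
      by (intro tendsto_mult tendsto_prod wlim tendsto_mono[OF inf_le1 tendsto_moebius_at_infinity])
    then have *: "((\<lambda>z. w \<gamma> z / (- \<i> * z) * ((z + 0) / (z + \<i> * of_real b)) *
        (\<Prod>t\<in>?S. (z + \<i> * of_real t) / (z + - \<i> * of_real t))) \<longlongrightarrow> 1) quadrant_infinity" by simp
    have ev: "\<forall>\<^sub>F z in quadrant_infinity. z \<notin> insert 0 ((\<lambda>t. \<i> * of_real t) ` ?S) \<and> z \<in> quadrant"
    proof -
      have "\<forall>\<^sub>F z in at_infinity. z \<notin> insert 0 ((\<lambda>t. \<i> * complex_of_real t) ` ?S)"
        by (rule eventually_mono[OF eventually_ball_finite[of "insert 0 ((\<lambda>t. \<i> * complex_of_real t) ` ?S)" "\<lambda>z a. z \<noteq> a"]])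
           (use fin eventually_not_equal_at_infinity in blast)+
      then show ?thesis unfolding eventually_inf_principal by eventually_elim auto
    qed
    show ?thesis
    proof (rule Lim_transform_eventually[OF *], rule eventually_mono[OF ev])
      fix z assume z: "z \<notin> insert 0 ((\<lambda>t. \<i> * of_real t) ` ?S) \<and> z \<in> quadrant"
      then have zH: "z \<in> ?H" using QH by auto
      have p: "(\<Prod>t\<in>?S. z - \<i> * of_real t) \<noteq> 0" using z fin by (auto simp: prod_zero_iff)
      have b: "z + \<i> * of_real b \<noteq> 0" using z nzi[OF zH] by (auto simp: b_def)
      have "w \<gamma> z / (- \<i> * z) * ((z + 0) / (z + \<i> * of_real b)) * (\<Prod>t\<in>?S. (z + \<i> * of_real t) / (z + - \<i> * of_real t))
        = (w \<gamma> z * (\<Prod>t\<in>?S. z + \<i> * of_real t)) / (- \<i> * (z + \<i> * of_real b) * (\<Prod>t\<in>?S. z - \<i> * of_real t))"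
      proof -
        have "u / (c * z) * (z / B) * (N / D) = (u * N) / (c * B * D)" for u B N D c
          using z by simp
        moreover have "z + - \<i> * of_real t = z - \<i> * of_real t" for t by simp
        ultimately show ?thesis by (simp only: prod_dividef add_0_right)
      qed
      also have "\<dots> = G z"
        unfolding wG[OF zH] using p b by simp
      finally show "w \<gamma> z / (- \<i> * z) * ((z + 0) / (z + \<i> * of_real b)) *
        (\<Prod>t\<in>?S. (z + \<i> * of_real t) / (z + - \<i> * of_real t)) = G z" .
    qed
  qed
  have Greal: "Im (G (\<i> * of_real s)) = 0" if "s \<ge> 0" for s
  proof -
    \<comment> \<open>At z = \<i>r every linear factor is \<i> times a real number; the powers of
      \<i> cancel against each other and against -\<i>. Reality of \<open>w\<close> passes to
      \<open>G\<close> wherever no factor r - t vanishes.\<close>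
    have off: "Im (G (\<i> * of_real r)) = 0" if r: "r > 0" "r \<notin> ?S" for r
    proof -
      have p1: "(\<Prod>t\<in>?S. \<i> * of_real r + \<i> * of_real t) = \<i> ^ card ?S * of_real (\<Prod>t\<in>?S. r + t)"
        by (simp add: prod.distrib flip: distrib_left)
      have p2: "(\<Prod>t\<in>?S. \<i> * of_real r - \<i> * of_real t) = \<i> ^ card ?S * of_real (\<Prod>t\<in>?S. r - t)"
        by (simp add: prod.distrib flip: right_diff_distrib)
      have p3: "(\<Prod>t\<in>?S. r - t) \<noteq> 0" using r fin by (auto simp: prod_zero_iff)
      have "w \<gamma> (\<i> * of_real r) * of_real (\<Prod>t\<in>?S. r + t) =
          G (\<i> * of_real r) * of_real ((r + b) * (\<Prod>t\<in>?S. r - t))"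
      proof -
        have "v * A = H * ((of_real r + of_real b) * D)"
          if "v * (I * A) = - \<i> * H * (\<i> * of_real r + \<i> * of_real b) * (I * D)" "I \<noteq> 0"
          for v A D H I :: complex
        proof -
          have "I * (v * A) = I * (H * ((of_real r + of_real b) * D))"
            using that(1) by (simp add: algebra_simps)
          then show ?thesis using that(2) by simp
        qed
        from this[OF wG[of "\<i> * of_real r", unfolded p1 p2]] show ?thesis using r by simp
      qed
      from arg_cong[OF this, of Im]
      have "Im (w \<gamma> (\<i> * of_real r)) * (\<Prod>t\<in>?S. r + t) = Im (G (\<i> * of_real r)) * ((r + b) * (\<Prod>t\<in>?S. r - t))"
        by (simp only: times_complex.sel Re_complex_of_real Im_complex_of_real mult_zero_right add_0_left)
      moreover have "r + b > 0" using r by (simp add: b_def)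
      ultimately show ?thesis using w_real[of r \<gamma>] r p3 by simp
    qed
    \<comment> \<open>The excluded points are finite in number and each, as well as 0, is a limit
      from the right of admissible ones.\<close>
    have "((\<lambda>r. Im (G (\<i> * of_real r))) \<longlongrightarrow> Im (G (\<i> * of_real s))) (at s within {s<..})"
    proof -
      have "continuous_on {s..} (\<lambda>r. Im (G (\<i> * of_real r)))"
        using that by (intro continuous_intros continuous_on_compose2[OF Gc]) auto
      then have "((\<lambda>r. Im (G (\<i> * of_real r))) \<longlongrightarrow> Im (G (\<i> * of_real s))) (at s within {s..})"
        by (simp add: continuous_on)
      then show ?thesis by (rule tendsto_within_subset) auto
    qed
    moreover have "\<forall>\<^sub>F r in at_right s. Im (G (\<i> * of_real r)) = 0"
    proof -
      have "open (- (?S - {s}))" by (intro open_Compl finite_imp_closed finite_Diff fin)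
      then have "\<forall>\<^sub>F r in at_right s. r \<in> - (?S - {s}) \<and> r > s"
        unfolding eventually_at_topological by (intro exI[of _ "- (?S - {s})"]) auto
      then show ?thesis by eventually_elim (use off that in auto)
    qed
    ultimately have "((\<lambda>r. 0) \<longlongrightarrow> Im (G (\<i> * of_real s))) (at_right s)"
      by (rule Lim_transform_eventually)
    then show ?thesis by (simp add: tendsto_const_iff)
  qed
  obtain \<psi> where \<psi>: "continuous_on {0..} \<psi>" "\<psi> 0 = 0" "(\<psi> \<longlongrightarrow> 0) at_top"
    "\<And>k. k \<ge> 0 \<Longrightarrow> G (of_real k) = of_real (norm (G (of_real k))) * cis (\<psi> k)"
    using quadrant_phase[OF continuous_on_subset[OF Gc QH] _ Glim Greal] Gnz QH by blast
  \<comment> \<open>Each bound momentum enters twice: through z - \<i>t in the numerator of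
    \<open>w\<close> and through z + \<i>t in the compensating denominator, with opposite
    arguments.\<close>
  define \<eta> where "\<eta> k = \<psi> k - 2 * (\<Sum>t\<in>?S. arctan (t / k)) + arctan (b / k) - arctan (\<gamma> / k)" for k
  have \<eta>top: "(\<eta> \<longlongrightarrow> 0) at_top"
  proof -
    have "(\<eta> \<longlongrightarrow> 0 - 2 * (\<Sum>t\<in>?S. 0) + 0 - 0) at_top"
      unfolding \<eta>_def by (intro tendsto_intros \<psi>(3) tendsto_arctan_divide_at_top)
    then show ?thesis by simp
  qed
  have \<eta>zero: "(\<eta> \<longlongrightarrow> \<eta>0) (at_right 0)"
  proof -
    have "(\<psi> \<longlongrightarrow> \<psi> 0) (at 0 within {0..})" using \<psi>(1) by (simp add: continuous_on)
    then have "(\<psi> \<longlongrightarrow> 0) (at_right 0)" unfolding \<psi>(2) by (rule tendsto_within_subset) auto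
    then have "(\<eta> \<longlongrightarrow> 0 - 2 * (\<Sum>t\<in>?S. sgn t * (pi / 2)) + sgn b * (pi / 2) - sgn \<gamma> * (pi / 2)) (at_right 0)"
      unfolding \<eta>_def by (intro tendsto_intros tendsto_arctan_divide_at_right_0)
    moreover have "(\<Sum>t\<in>?S. sgn t * (pi / 2)) = (\<Sum>t\<in>?S. pi / 2)"
      by (rule sum.cong) (auto dest: Spos)
    ultimately show ?thesis by (cases "w \<gamma> 0 = 0") (simp_all add: \<eta>0_def b_def mult.commute)
  qed
  have phase: "is_limit_phase \<gamma> V \<eta>"
    unfolding is_limit_phase_def
  proof (intro conjI allI impI \<eta>top)
    show "continuous_on {0<..} \<eta>"
      unfolding \<eta>_def by (intro continuous_intros continuous_on_subset[OF \<psi>(1)]) auto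
    fix k :: real assume k: "k > 0"
    obtain r where r: "\<And>t. r t > 0" "\<And>t. of_real k + \<i> * of_real t = of_real (r t) * cis (arctan (t / k))"
      using polar_arctan[OF k] by metis
    have rm: "of_real k - \<i> * of_real t = of_real (r t) * cis (- arctan (t / k))" for t
      using arg_cong[OF r(2)[of t], of cnj] by (simp add: cis_cnj)
    define \<Sigma> Q where "\<Sigma> = (\<Sum>t\<in>?S. arctan (t / k))" and "Q = (\<Prod>t\<in>?S. r t)"
    have pp: "(\<Prod>t\<in>?S. of_real k + \<i> * of_real t) = of_real Q * cis \<Sigma>"
      unfolding r(2) \<Sigma>_def Q_def by (simp add: prod.distrib prod_cis[OF fin])
    have pm: "(\<Prod>t\<in>?S. of_real k - \<i> * of_real t) = of_real Q * cis (- \<Sigma>)"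
      unfolding rm \<Sigma>_def Q_def by (simp add: prod.distrib prod_cis[OF fin] flip: sum_negf)
    have "Q \<noteq> 0" unfolding Q_def using r(1) prod_pos[of ?S r] by simp
    \<comment> \<open>The reference factor is -\<i> times k + \<i>\<gamma>; its -\<i> matches the
      one in \<open>w\<close>, so only arctan(\<gamma>/k) remains to be subtracted.\<close>
    have \<gamma>k: "of_real \<gamma> - \<i> * of_real k = - \<i> * (of_real (r \<gamma>) * cis (arctan (\<gamma> / k)))"
      using r(2)[of \<gamma>] by (simp add: algebra_simps flip: r(2))
    have main: "w \<gamma> (of_real k) * (of_real Q * cis \<Sigma>) = - \<i> * (of_real (norm (G (of_real k))) * cis (\<psi> k)) *
        (of_real (r b) * cis (arctan (b / k))) * (of_real Q * cis (- \<Sigma>))"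
      using wG[of "of_real k"] \<psi>(4)[of k] k unfolding pp pm r(2)[of b] by simp
    have cancel: "v = A * R * (F * B * (E' * E')) * (- \<i>)"
      if "v * (Q * E) = - \<i> * (A * F) * (R * B) * (Q * E')" "Q \<noteq> 0" "E * E' = 1"
      for v Q E E' A F R B :: complex
    proof -
      have "Q * (v * (E * E')) = v * (Q * E) * E'" by (simp only: mult_ac)
      also have "\<dots> = Q * (A * R * (F * B * (E' * E')) * (- \<i>))" unfolding that(1) by (simp only: mult_ac)
      finally show ?thesis
        using that(2) by (simp only: that(3) mult_1_right mult_cancel_left simp_thms)
    qed
    have "w \<gamma> (of_real k) = of_real (norm (G (of_real k))) * of_real (r b) *
        (cis (\<psi> k) * cis (arctan (b / k)) * (cis (- \<Sigma>) * cis (- \<Sigma>))) * (- \<i>)"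
      by (rule cancel[OF main]) (simp_all add: \<open>Q \<noteq> 0\<close> cis_mult)
    also have "cis (\<psi> k) * cis (arctan (b / k)) * (cis (- \<Sigma>) * cis (- \<Sigma>)) = cis (\<eta> k) * cis (arctan (\<gamma> / k))"
      by (simp add: cis_mult \<eta>_def \<Sigma>_def algebra_simps)
    also have "of_real (norm (G (of_real k))) * of_real (r b) * (cis (\<eta> k) * cis (arctan (\<gamma> / k))) * (- \<i>)
        = of_real (norm (G (of_real k)) * r b / r \<gamma>) * cis (\<eta> k) * (of_real \<gamma> - \<i> * of_real k)"
      unfolding \<gamma>k using r(1)[of \<gamma>] by simp
    finally have "jost_function \<gamma> V (of_real k) =
        of_real (norm (G (of_real k)) * r b / r \<gamma>) * exp (\<i> * of_real (\<eta> k)) * (of_real \<gamma> - \<i> * of_real k)"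
      by (simp add: jost_function_eq cis_conv_exp)
    moreover have "norm (G (of_real k)) * r b / r \<gamma> > 0" using Gnz[of "of_real k"] r(1) k by simp
    ultimately show "\<exists>a>0. jost_function \<gamma> V (of_real k) = of_real a * exp (\<i> * of_real (\<eta> k)) * (of_real \<gamma> - \<i> * of_real k)"
      by blast
  qed
  have "is_limit_phase \<gamma> V (limit_phase \<gamma> V)"
    unfolding limit_phase_def using phase by (rule someI[of "is_limit_phase \<gamma> V"])
  then have eq: "\<eta> k = limit_phase \<gamma> V k" if "k > 0" for k
    using is_limit_phase_unique[OF phase _ that] by blast
  show "(limit_phase \<gamma> V \<longlongrightarrow> \<eta>0) (at_right 0)"
    by (rule Lim_transform_eventually[OF \<eta>zero]) (auto simp: eventually_at_filter eq)
  show "(limit_phase \<gamma> V \<longlongrightarrow> 0) at_top"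
    by (rule Lim_transform_eventually[OF \<eta>top])
       (rule eventually_mono[OF eventually_gt_at_top[of 0] eq])
qed

end

section \<open>Negative eigenvalues\<close>

lemma L2_half_mult_integrable:
  assumes "L2_half f" "L2_half g"
  shows "set_integrable lebesgue {0..} (\<lambda>x. f x * g x)"
  unfolding set_integrable_def
proof (rule Bochner_Integration.integrable_bound)
  show "integrable lebesgue (\<lambda>x. indicat_real {0..} x *\<^sub>R (cmod (f x))\<^sup>2 + indicat_real {0..} x *\<^sub>R (cmod (g x))\<^sup>2)"
    using assms unfolding L2_half_def set_integrable_def by auto
  have "(\<lambda>x. (indicat_real {0..} x *\<^sub>R f x) * (indicat_real {0..} x *\<^sub>R g x)) \<in> borel_measurable lebesgue"
    using assms unfolding L2_half_def set_borel_measurable_def by (intro borel_measurable_times) auto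
  moreover have "(\<lambda>x. (indicat_real {0..} x *\<^sub>R f x) * (indicat_real {0..} x *\<^sub>R g x)) = (\<lambda>x. indicat_real {0..} x *\<^sub>R (f x * g x))"
    by (auto split: split_indicator)
  ultimately show "(\<lambda>x. indicat_real {0..} x *\<^sub>R (f x * g x)) \<in> borel_measurable lebesgue" by simp
  have "cmod a * cmod b \<le> (cmod a)\<^sup>2 + (cmod b)\<^sup>2" for a b :: complex
    using sum_squares_bound[of "cmod a" "cmod b"] mult_nonneg_nonneg[OF norm_ge_zero norm_ge_zero, of a b] by linarith
  then show "AE x in lebesgue. norm (indicat_real {0..} x *\<^sub>R (f x * g x))
      \<le> norm (indicat_real {0..} x *\<^sub>R (cmod (f x))\<^sup>2 + indicat_real {0..} x *\<^sub>R (cmod (g x))\<^sup>2)"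
    by (intro AE_I2) (auto simp: norm_mult split: split_indicator intro: order_trans[OF _ abs_ge_self])
qed

lemma L2_half_cnj: "L2_half f \<Longrightarrow> L2_half (\<lambda>x. cnj (f x))"
proof -
  assume f: "L2_half f"
  have "(\<lambda>x. indicat_real {0..} x *\<^sub>R f x) \<in> borel_measurable lebesgue"
    using f unfolding L2_half_def set_borel_measurable_def by (rule conjunct1)
  then have "(\<lambda>x. cnj (indicat_real {0..} x *\<^sub>R f x)) \<in> borel_measurable lebesgue"
    by (rule measurable_compose) (intro borel_measurable_continuous_onI continuous_intros)
  moreover have "cnj (indicat_real {0..} x *\<^sub>R f x) = indicat_real {0..} x *\<^sub>R cnj (f x)" for x
    by (rule complex_cnj_scaleR)
  ultimately show ?thesis
    using f unfolding L2_half_def set_borel_measurable_def by (simp only: complex_mod_cnj simp_thms)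
qed

lemma L2_half_continuous:
  assumes "continuous_on {0..} f" "set_integrable lebesgue {0..} g" "\<And>x. x \<ge> 0 \<Longrightarrow> (cmod (f x))\<^sup>2 \<le> g x"
  shows "L2_half f"
  unfolding L2_half_def
proof
  show "set_borel_measurable lebesgue {0..} f"
    unfolding set_borel_measurable_def by (rule half_line_measurable[OF assms(1)])
  show "set_integrable lebesgue {0..} (\<lambda>x. (cmod (f x))\<^sup>2)"
    by (rule set_integrable_bound_continuous[OF assms(2)]) (use assms in \<open>auto intro!: continuous_intros\<close>)
qed

lemma L2_half_cmult: "L2_half f \<Longrightarrow> L2_half (\<lambda>x. c * f x)"
proof -
  assume f: "L2_half f"
  have "(\<lambda>x. c * (indicat_real {0..} x *\<^sub>R f x)) \<in> borel_measurable lebesgue"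
    using f unfolding L2_half_def set_borel_measurable_def by (intro borel_measurable_times) auto
  moreover have "(\<lambda>x. c * (indicat_real {0..} x *\<^sub>R f x)) = (\<lambda>x. indicat_real {0..} x *\<^sub>R (c * f x))" by auto
  ultimately show ?thesis
    using f unfolding L2_half_def set_borel_measurable_def by (simp add: norm_mult power_mult_distrib)
qed

lemma L2_half_add:
  assumes f: "L2_half f" and g: "L2_half g"
  shows "L2_half (\<lambda>x. f x + g x)"
  unfolding L2_half_def
proof
  have "(\<lambda>x. indicat_real {0..} x *\<^sub>R f x + indicat_real {0..} x *\<^sub>R g x) \<in> borel_measurable lebesgue"
    using f g unfolding L2_half_def set_borel_measurable_def by (intro borel_measurable_add) auto
  then have meas: "(\<lambda>x. indicat_real {0..} x *\<^sub>R (f x + g x)) \<in> borel_measurable lebesgue"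
    by (simp add: scaleR_add_right)
  then show "set_borel_measurable lebesgue {0..} (\<lambda>x. f x + g x)" by (simp add: set_borel_measurable_def)
  show "set_integrable lebesgue {0..} (\<lambda>x. (cmod (f x + g x))\<^sup>2)"
    unfolding set_integrable_def
  proof (rule Bochner_Integration.integrable_bound)
    show "integrable lebesgue (\<lambda>x. 2 * (indicat_real {0..} x *\<^sub>R (cmod (f x))\<^sup>2) + 2 * (indicat_real {0..} x *\<^sub>R (cmod (g x))\<^sup>2))"
      using assms unfolding L2_half_def set_integrable_def by auto
    have "(\<lambda>x. (cmod (indicat_real {0..} x *\<^sub>R (f x + g x)))\<^sup>2) \<in> borel_measurable lebesgue"
      by (intro borel_measurable_power measurable_compose[OF meas borel_measurable_continuous_onI] continuous_intros)
    moreover have "(\<lambda>x. (cmod (indicat_real {0..} x *\<^sub>R (f x + g x)))\<^sup>2) = (\<lambda>x. indicat_real {0..} x *\<^sub>R (cmod (f x + g x))\<^sup>2)"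
      by (rule ext) (auto split: split_indicator)
    ultimately show "(\<lambda>x. indicat_real {0..} x *\<^sub>R (cmod (f x + g x))\<^sup>2) \<in> borel_measurable lebesgue" by simp
    have "(cmod (a + b))\<^sup>2 \<le> 2 * (cmod a)\<^sup>2 + 2 * (cmod b)\<^sup>2" for a b :: complex
    proof -
      have "(cmod (a + b))\<^sup>2 \<le> (cmod a + cmod b)\<^sup>2" by (intro power_mono norm_triangle_ineq) auto
      then show ?thesis using sum_squares_bound[of "cmod a" "cmod b"] by (simp add: power2_sum)
    qed
    then show "AE x in lebesgue. norm (indicat_real {0..} x *\<^sub>R (cmod (f x + g x))\<^sup>2)
        \<le> norm (2 * (indicat_real {0..} x *\<^sub>R (cmod (f x))\<^sup>2) + 2 * (indicat_real {0..} x *\<^sub>R (cmod (g x))\<^sup>2))"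
      by (intro AE_I2) (auto split: split_indicator intro: order_trans[OF _ abs_ge_self])
  qed
qed

lemma L2_half_truncate:
  assumes "set_borel_measurable lebesgue {0..} g" "set_integrable lebesgue {0..R} (\<lambda>x. (cmod (g x))\<^sup>2)"
  shows "L2_half (\<lambda>x. if x \<le> R then g x else 0)"
  unfolding L2_half_def
proof
  have "(\<lambda>x. indicat_real {..R} x *\<^sub>R (indicat_real {0..} x *\<^sub>R g x)) \<in> borel_measurable lebesgue"
    by (rule borel_measurable_scaleR, rule borel_measurable_indicator)
       (use assms in \<open>simp_all add: set_borel_measurable_def\<close>)
  moreover have "(\<lambda>x. indicat_real {..R} x *\<^sub>R (indicat_real {0..} x *\<^sub>R g x)) =
      (\<lambda>x. indicat_real {0..} x *\<^sub>R (if x \<le> R then g x else 0))"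
    by (rule ext) (auto split: split_indicator)
  ultimately show "set_borel_measurable lebesgue {0..} (\<lambda>x. if x \<le> R then g x else 0)"
    unfolding set_borel_measurable_def by simp
  have "(\<lambda>x. indicat_real {0..R} x *\<^sub>R (cmod (g x))\<^sup>2) =
      (\<lambda>x. indicat_real {0..} x *\<^sub>R (cmod (if x \<le> R then g x else 0))\<^sup>2)"
    by (rule ext) (auto split: split_indicator)
  then show "set_integrable lebesgue {0..} (\<lambda>x. (cmod (if x \<le> R then g x else 0))\<^sup>2)"
    using assms(2) unfolding set_integrable_def by simp
qed

lemma H1_half_cnj: "H1_half v v' \<Longrightarrow> H1_half (\<lambda>x. cnj (v x)) (\<lambda>x. cnj (v' x))"
  by (simp add: H1_half_def L2_half_cnj has_ac_deriv_cnj)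

text \<open>A crude bound that suffices: the potential has a first moment, and the Jost solutions
  tested against decay exponentially.\<close>

lemma H1_half_growth:
  assumes "H1_half v v'"
  shows "\<exists>c\<ge>0. \<forall>x\<ge>0. norm (v x) \<le> c * (1 + x)"
proof -
  have ac: "has_ac_deriv v v'" and sq: "set_integrable lebesgue {0..} (\<lambda>x. (cmod (v' x))\<^sup>2)"
    using assms by (auto simp: H1_half_def L2_half_def)
  define I where "I = (LINT x:{0..}|lebesgue. (cmod (v' x))\<^sup>2)"
  have I: "I \<ge> 0"
    unfolding I_def set_lebesgue_integral_def by (rule integral_nonneg_AE) simp
  have "norm (v x) \<le> (norm (v 0) + I + 1) * (1 + x)" if "x \<ge> 0" for x
  proof -
    have i: "set_integrable lebesgue {0..x} v'" by (rule has_ac_deriv_integrable[OF ac order_refl])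
    have isq: "set_integrable lebesgue {0..x} (\<lambda>x. (cmod (v' x))\<^sup>2)"
      by (rule set_integrable_subset[OF sq]) auto
    have i1: "set_integrable lebesgue {0..x} (\<lambda>x. 1::real)"
      by (rule absolutely_integrable_continuous_real) simp
    have "norm (LINT t:{0..x}|lebesgue. v' t) \<le> (LINT t:{0..x}|lebesgue. norm (v' t))"
      by (rule set_integral_norm_bound[OF i])
    \<comment> \<open>s \<le> 1 + s^2 trades the norm for its integrable square; the 1 produces the
      linear growth.\<close>
    also have "\<dots> \<le> (LINT t:{0..x}|lebesgue. 1 + (cmod (v' t))\<^sup>2)"
    proof (rule set_integral_mono[OF set_integrable_norm[OF i] set_integral_add(1)[OF i1 isq]])
      fix t
      show "norm (v' t) \<le> 1 + (cmod (v' t))\<^sup>2"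
        using sum_squares_bound[of 1 "cmod (v' t)"] norm_ge_zero[of "v' t"] by (simp only: mult_1_right power_one)
    qed
    also have "\<dots> = (LINT t:{0..x}|lebesgue. 1) + (LINT t:{0..x}|lebesgue. (cmod (v' t))\<^sup>2)"
      by (rule set_integral_add(2)[OF i1 isq])
    also have "(LINT t:{0..x}|lebesgue. 1::real) = x"
      using set_lebesgue_integral_eq_integral(2)[OF i1] that by simp
    also have "(LINT t:{0..x}|lebesgue. (cmod (v' t))\<^sup>2) \<le> I"
      unfolding I_def set_lebesgue_integral_def
      by (rule integral_mono) (use sq isq in \<open>auto simp: set_integrable_def split: split_indicator\<close>)
    finally have "norm (v x) \<le> norm (v 0) + (x + I)"
      using has_ac_derivD(3)[OF ac that] norm_triangle_ineq[of "v 0" "LINT t:{0..x}|lebesgue. v' t"] by simp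
    also have "\<dots> \<le> (norm (v 0) + I + 1) * (1 + x)"
      using that I by (simp add: algebra_simps)
    finally show ?thesis .
  qed
  then show ?thesis using I by (intro exI[of _ "norm (v 0) + I + 1"]) auto
qed

lemma exp_minus_linear_tendsto_0:
  assumes "a > 0"
  shows "((\<lambda>x. exp (- a * x) * c * (1 + x)) \<longlongrightarrow> (0::real)) at_top"
proof -
  have f: "filterlim (\<lambda>x. a * x) at_top at_top"
    by (rule filterlim_tendsto_pos_mult_at_top[OF tendsto_const assms filterlim_ident])
  have "((\<lambda>x. c * ((a * x) ^ 0 / exp (a * x)) + c / a * ((a * x) ^ 1 / exp (a * x))) \<longlongrightarrow> c * 0 + c / a * 0) at_top"
    by (intro tendsto_intros filterlim_compose[OF tendsto_power_div_exp_0 f])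
  moreover have "c * ((a * x) ^ 0 / exp (a * x)) + c / a * ((a * x) ^ 1 / exp (a * x)) = exp (- a * x) * c * (1 + x)" for x
    using assms by (simp add: exp_minus field_simps)
  ultimately show ?thesis by simp
qed

lemma set_integrable_extend_0:
  fixes f :: "real \<Rightarrow> complex"
  assumes "set_integrable lebesgue {0..R} f" "\<And>x. x > R \<Longrightarrow> f x = 0"
  shows "set_integrable lebesgue {0..} f"
proof -
  have "(\<lambda>x. indicat_real {0..R} x *\<^sub>R f x) = (\<lambda>x. indicat_real {0..} x *\<^sub>R f x)"
    using assms(2) by (intro ext) (auto split: split_indicator)
  then show ?thesis using assms(1) unfolding set_integrable_def by simp
qed

text \<open>Zero propagates: on an interval of length at most 1 over which |k| integrates to at most
  1/2, the maximum M of |u| satisfies M \<le> M/2.\<close>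

lemma has_ac_deriv_ivp_unique:
  assumes u: "has_ac_deriv u F" "u 0 = 0" and F: "has_ac_deriv F (\<lambda>x. k x * u x)" "F 0 = 0"
    and k: "\<And>x. x \<ge> 0 \<Longrightarrow> set_integrable lebesgue {0..x} k" and x: "x \<ge> 0"
  shows "u x = 0"
proof -
  define K where "K x = integral {0..x} (\<lambda>t. norm (k t))" for x
  have ki: "(\<lambda>t. norm (k t)) integrable_on {0..x}" for x
  proof (cases "x \<ge> 0")
    case True
    from set_integrable_norm[OF k[OF this]] show ?thesis by (rule set_lebesgue_integral_eq_integral(1))
  qed (simp add: integrable_on_empty)
  have Kc: "continuous (at x within {0..}) K" if "x \<ge> 0" for x
    using continuous_on_indefinite_integral[of "\<lambda>t. norm (k t)", OF ki] that
    unfolding K_def continuous_on_eq_continuous_within by simp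
  have uc: "continuous_on {0..} u" by (rule has_ac_deriv_continuous_on[OF u(1)])
  have Fc: "continuous_on {0..} F" by (rule has_ac_deriv_continuous_on[OF F(1)])
  have "(\<forall>t\<in>{0..0}. u t = 0) \<longrightarrow> (\<forall>t\<in>{0..x}. u t = 0)"
  proof (rule Bolzano[of 0 x "\<lambda>a b. (\<forall>t\<in>{0..a}. u t = 0) \<longrightarrow> (\<forall>t\<in>{0..b}. u t = 0)"])
    fix y assume y: "0 \<le> y" "y \<le> x"
    have "\<exists>d>0. \<forall>t\<in>{0..}. dist t y < d \<longrightarrow> dist (K t) (K y) < 1/4"
      using Kc[OF y(1)] unfolding continuous_within_eps_delta by (metis zero_less_divide_1_iff zero_less_numeral)
    then obtain d where d: "d > 0" "\<And>t. t \<ge> 0 \<Longrightarrow> dist t y < d \<Longrightarrow> dist (K t) (K y) < 1/4" by auto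
    show "\<exists>d>0. \<forall>a b. a \<le> y \<and> y \<le> b \<and> b - a < d \<longrightarrow>
        (\<forall>t\<in>{0..a}. u t = 0) \<longrightarrow> (\<forall>t\<in>{0..b}. u t = 0)"
    proof (intro exI[of _ "min d 1"] conjI allI impI)
      fix a b assume ab: "a \<le> y \<and> y \<le> b \<and> b - a < min d 1" and 0: "\<forall>t\<in>{0..a}. u t = 0"
      \<comment> \<open>The subdivision argument admits negative left endpoints, which are moved to
        0, where the initial data are known.\<close>
      define a' where "a' = max 0 a"
      have a': "0 \<le> a'" "a' \<le> y" "b - a' < d" "b - a' \<le> 1" "a' \<le> b" using ab y by (auto simp: a'_def)
      have u0: "u t = 0" if "t \<in> {0..a'}" for t
        using 0 u(2) that by (cases "a \<ge> 0") (auto simp: a'_def max_def split: if_splits)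
      have F0: "F a' = 0"
      proof -
        have "F a' = integral {0..a'} (\<lambda>x. k x * u x)"
          using has_ac_derivD(2)[OF F(1) a'(1)] F(2) by simp
        also have "\<dots> = integral {0..a'} (\<lambda>x. 0)" by (rule integral_cong) (simp add: u0)
        finally show ?thesis by simp
      qed
      have "dist (K b) (K y) < 1/4" "dist (K a') (K y) < 1/4"
        by (rule d(2); use a' ab y in \<open>auto simp: dist_real_def\<close>)+
      then have Kab: "K b - K a' \<le> 1/2" unfolding dist_real_def by linarith
      have "compact (norm ` u ` {a'..b})"
        using a' by (intro compact_continuous_image continuous_intros continuous_on_subset[OF uc]) auto
      then obtain s where s: "s \<in> {a'..b}" "\<And>t. t \<in> {a'..b} \<Longrightarrow> norm (u t) \<le> norm (u s)"
        using compact_attains_sup[of "norm ` u ` {a'..b}"] a' by auto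
      define M where "M = norm (u s)"
      have FM: "norm (F t) \<le> M / 2" if t: "t \<in> {a'..b}" for t
      proof -
        have kt: "(\<lambda>x. norm (k x)) integrable_on {a'..t}"
          by (rule integrable_on_subinterval[OF ki[of t]]) (use a' in auto)
        have "F t = integral {a'..t} (\<lambda>x. k x * u x)"
          using has_ac_deriv_increment[OF F(1) a'(1), of t] F0 t by simp
        also have "norm \<dots> \<le> integral {a'..t} (\<lambda>x. M * norm (k x))"
        proof (rule integral_norm_bound_integral)
          show "(\<lambda>x. k x * u x) integrable_on {a'..t}"
            using has_ac_deriv_integrable[OF F(1) a'(1)] by (rule set_lebesgue_integral_eq_integral(1))
          show "(\<lambda>x. M * norm (k x)) integrable_on {a'..t}"
            using integrable_on_cmult_left[OF kt, of M] by simp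
          show "norm (k x * u x) \<le> M * norm (k x)" if "x \<in> {a'..t}" for x
            using s(2)[of x] that t by (simp add: norm_mult M_def mult.commute mult_left_mono)
        qed
        also have "\<dots> = M * (K t - K a')"
        proof -
          have "integral {a'..t} (\<lambda>x. norm (k x)) = K t - K a'"
            using Henstock_Kurzweil_Integration.integral_combine[OF a'(1) _ ki[of t]] t by (simp add: K_def)
          then show ?thesis by simp
        qed
        also have "\<dots> \<le> M * (K b - K a')"
        proof -
          have "K t \<le> K b"
            unfolding K_def using t a' by (intro integral_subset_le ki) auto
          then show ?thesis by (simp add: M_def mult_left_mono)
        qed
        also have "\<dots> \<le> M * (1/2)" using Kab by (intro mult_left_mono) (auto simp: M_def)
        finally show ?thesis by simp
      qed
      have "u s = integral {a'..s} F"
        using has_ac_deriv_increment[OF u(1) a'(1), of s] u0[of a'] s a' by simp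
      also have "norm \<dots> \<le> integral {a'..s} (\<lambda>x. M / 2)"
        using FM s a' by (intro integral_norm_bound_integral integrable_continuous_interval continuous_on_subset[OF Fc]) auto
      also have "\<dots> = (s - a') * (M / 2)" using s by simp
      also have "\<dots> \<le> 1 * (M / 2)" using s a' by (intro mult_right_mono) (auto simp: M_def)
      finally have "M = 0" by (simp add: M_def)
      then have z: "u t = 0" if "t \<in> {a'..b}" for t using s(2)[OF that] by (simp add: M_def)
      show "\<forall>t\<in>{0..b}. u t = 0"
      proof
        fix t assume "t \<in> {0..b}"
        then show "u t = 0" using z[of t] u0[of t] by (cases "t \<le> a'") auto
      qed
    qed (use d in auto)
  qed (use x in blast)+
  then show ?thesis using u(2) x by simp
qed

section \<open>Eigenvalues as zeros of the Jost function\<close>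

context half_line_potential
begin

lemma H1_half_\<theta>:
  assumes "Im a > 0"
  shows "H1_half (\<theta> a) (\<theta>' a)"
  unfolding H1_half_def
proof (intro conjI has_ac_deriv_\<theta>)
  have sq: "(exp (- Im a * x) * c)\<^sup>2 = exp (- (2 * Im a) * x) * c\<^sup>2" for x c
    by (simp add: power_mult_distrib exp_double[symmetric] mult_ac)
  show "L2_half (\<theta> a)"
  proof (rule L2_half_continuous[OF has_ac_deriv_continuous_on[OF has_ac_deriv_\<theta>] set_integrable_exp_minus])
    show "(cmod (\<theta> a x))\<^sup>2 \<le> exp (- (2 * Im a) * x) * C\<^sub>m\<^sup>2" if "x \<ge> 0" for x
      unfolding sq[symmetric] using norm_\<theta>_le[OF that] by (intro power_mono) auto
  qed (use assms in auto)
  show "L2_half (\<theta>' a)"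
  proof (rule L2_half_continuous[OF has_ac_deriv_continuous_on[OF has_ac_deriv_\<theta>'] set_integrable_exp_minus])
    show "(cmod (\<theta>' a x))\<^sup>2 \<le> exp (- (2 * Im a) * x) * (norm a * C\<^sub>m + \<tau> 0 * C\<^sub>m)\<^sup>2" if "x \<ge> 0" for x
      unfolding sq[symmetric] using norm_\<theta>'_le[OF that, of a] assms by (intro power_mono) auto
  qed (use assms in auto)
qed (use assms in auto)

lemma potential_H1_integrable:
  assumes "H1_half v v'" "Im a > 0"
  shows "set_integrable lebesgue {0..} (\<lambda>x. of_real (V x) * (\<theta> a x * v x))"
proof -
  obtain c where c: "c \<ge> 0" "\<And>x. x \<ge> 0 \<Longrightarrow> norm (v x) \<le> c * (1 + x)"
    using H1_half_growth[OF assms(1)] by auto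
  have "norm (\<theta> a x * v x) \<le> C\<^sub>m * c * (1 + x)" if "x \<ge> 0" for x
  proof -
    have "norm (\<theta> a x) \<le> 1 * C\<^sub>m"
      using norm_\<theta>_le[OF that, of a] assms(2) that C\<^sub>m_nonneg
      by (intro order_trans[OF norm_\<theta>_le[OF that]] mult_right_mono) auto
    then show ?thesis
      unfolding norm_mult using mult_mono[OF _ c(2)[OF that], of "norm (\<theta> a x)" C\<^sub>m] C\<^sub>m_nonneg by (simp add: mult.assoc)
  qed
  moreover have "continuous_on {0..} (\<lambda>x. \<theta> a x * v x)"
    using assms by (intro continuous_intros has_ac_deriv_continuous_on[OF has_ac_deriv_\<theta>] has_ac_deriv_continuous_on[of v v'])
      (auto simp: H1_half_def)
  ultimately have "integrable lebesgue (\<lambda>x. of_real (U x) * (\<theta> a x * v x))" by (intro U_mult_integrable)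
  moreover have "(\<lambda>x. of_real (U x) * (\<theta> a x * v x)) = (\<lambda>x. indicat_real {0..} x *\<^sub>R (of_real (V x) * (\<theta> a x * v x)))"
    by (rule ext) (simp add: U_def scaleR_conv_of_real)
  ultimately show ?thesis unfolding set_integrable_def by simp
qed

text \<open>Integration by parts against an arbitrary element of the form domain; at infinity
  exponential decay beats the linear growth of \<open>v\<close>, so only the boundary term at 0
  remains.\<close>

lemma form_\<theta>:
  assumes v: "H1_half v v'" and a: "Im a > 0"
  shows "(LINT x:{0..}|lebesgue. \<theta>' a x * v' x + of_real (V x) * (\<theta> a x * v x))
    = a\<^sup>2 * (LINT x:{0..}|lebesgue. \<theta> a x * v x) - \<theta>' a 0 * v 0"
proof -
  have L2: "L2_half v" "L2_half v'" "has_ac_deriv v v'" "L2_half (\<theta> a)" "L2_half (\<theta>' a)"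
    using v H1_half_\<theta>[OF a] by (auto simp: H1_half_def)
  note i1 = L2_half_mult_integrable[OF L2(5,2)]
  note i2 = potential_H1_integrable[OF v a]
  have i3: "set_integrable lebesgue {0..} (\<lambda>x. a\<^sup>2 * (\<theta> a x * v x))"
    by (rule set_integrable_mult_right) (rule L2_half_mult_integrable[OF L2(4,1)])
  have ac: "has_ac_deriv (\<lambda>x. \<theta>' a x * v x)
      (\<lambda>x. (\<theta>' a x * v' x + of_real (V x) * (\<theta> a x * v x)) - a\<^sup>2 * (\<theta> a x * v x))"
    by (rule has_ac_deriv_cong[OF has_ac_deriv_mult[OF has_ac_deriv_\<theta>' L2(3)]])
       (use a in \<open>auto simp: algebra_simps\<close>)
  obtain c where c: "c \<ge> 0" "\<And>x. x \<ge> 0 \<Longrightarrow> norm (v x) \<le> c * (1 + x)"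
    using H1_half_growth[OF v] by auto
  have lim: "((\<lambda>x. \<theta>' a x * v x) \<longlongrightarrow> 0) at_top"
  proof (rule Lim_null_comparison[OF _ exp_minus_linear_tendsto_0[OF a]])
    show "\<forall>\<^sub>F x in at_top. norm (\<theta>' a x * v x) \<le> exp (- Im a * x) * ((norm a * C\<^sub>m + \<tau> 0 * C\<^sub>m) * c) * (1 + x)"
      using eventually_ge_at_top[of 0]
    proof eventually_elim
      case (elim x)
      have "norm (\<theta>' a x) * norm (v x) \<le> (exp (- Im a * x) * (norm a * C\<^sub>m + \<tau> 0 * C\<^sub>m)) * (c * (1 + x))"
        using norm_\<theta>'_le[OF elim, of a] c(2)[OF elim] a by (intro mult_mono) (auto intro: order_trans[OF norm_ge_zero])
      then show ?case by (simp add: norm_mult mult_ac)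
    qed
  qed
  have "(LINT x:{0..}|lebesgue. (\<theta>' a x * v' x + of_real (V x) * (\<theta> a x * v x)) - a\<^sup>2 * (\<theta> a x * v x)) = 0 - \<theta>' a 0 * v 0"
    by (rule has_ac_deriv_LINT[OF ac set_integral_diff(1)[OF set_integral_add(1)[OF i1 i2] i3] lim])
  then show ?thesis
    unfolding set_integral_diff(2)[OF set_integral_add(1)[OF i1 i2] i3] set_integral_mult_right
    by (simp only: diff_eq_eq) simp
qed

lemma bound_momentum_imp_eigenvalue:
  assumes "t > 0" "w \<gamma> (\<i> * of_real t) = 0"
  shows "is_eigenvalue \<gamma> V (- t\<^sup>2)"
  unfolding is_eigenvalue_def schroedinger_op_def
proof (rule exI[of _ "\<theta> (\<i> * of_real t)"], intro conjI, goal_cases)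
  case 1
  then show ?case using \<theta>_nontrivial[of "\<i> * of_real t"] assms by simp
next
  case 2
  then show ?case using H1_half_\<theta>[of "\<i> * of_real t"] assms by (intro L2_half_cmult) (simp add: H1_half_def)
next
  case 3
  show ?case
  proof (intro exI[of _ "\<theta>' (\<i> * of_real t)"] conjI allI impI)
    let ?a = "\<i> * complex_of_real t"
    have a: "Im ?a > 0" using assms by simp
    show "H1_half (\<theta> ?a) (\<theta>' ?a)" by (rule H1_half_\<theta>[OF a])
    fix v v' assume "H1_half v v'"
    from form_\<theta>[OF H1_half_cnj[OF this] a]
    show "schroedinger_form \<gamma> V (\<theta> ?a) (\<theta>' ?a) v v' = (LINT x:{0..}|lebesgue. of_real (- t\<^sup>2) * \<theta> ?a x * cnj (v x))"
      using assms(2) unfolding mult.assoc[of "of_real (- t\<^sup>2)"] set_integral_mult_right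
      by (simp add: schroedinger_form_def w_eq power_mult_distrib)
  qed
qed

text \<open>The test functions are free at 0, so the identity encodes u'(0) = 0 in addition to u(0)
  = 0. The natural candidate for u' is the primitive \<open>F\<close> of (V - \<mu>)u with F(0) = 0;
  once u' = F, the Cauchy data vanish and so does \<open>u\<close>.\<close>

lemma weak_solution_0:
  assumes u: "H1_half u u'" "u 0 = 0"
    and weak: "\<And>v v'. H1_half v v' \<Longrightarrow>
      (LINT x:{0..}|lebesgue. u' x * cnj (v' x) + of_real (V x) * (u x * cnj (v x)))
        = (LINT x:{0..}|lebesgue. of_real \<mu> * u x * cnj (v x))"
    and "x \<ge> 0"
  shows "u x = 0"
proof -
  define k where "k x = complex_of_real (V x) - of_real \<mu>" for x
  have uL: "L2_half u" "L2_half u'" "has_ac_deriv u u'" using u by (auto simp: H1_half_def)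
  have uc: "continuous_on {0..} u" by (rule has_ac_deriv_continuous_on[OF uL(3)])
  have Vi: "set_integrable lebesgue {0..R} (\<lambda>x. complex_of_real (V x))" for R
  proof -
    have "set_integrable lebesgue {0..} (\<lambda>y. complex_of_real (U y) * 1)"
      by (rule U_mult_set_integrable[where B = 1]) auto
    then have "set_integrable lebesgue {0..R} (\<lambda>y. complex_of_real (U y) * 1)"
      by (rule set_integrable_subset) auto
    moreover have "(\<lambda>x. indicat_real {0..R} x *\<^sub>R (complex_of_real (U x) * 1)) = (\<lambda>x. indicat_real {0..R} x *\<^sub>R complex_of_real (V x))"
      by (rule ext) (auto simp: U_def split: split_indicator)
    ultimately show ?thesis unfolding set_integrable_def by simp
  qed
  have ki: "set_integrable lebesgue {0..R} k" for R
    unfolding k_def by (intro set_integral_diff Vi absolutely_integrable_continuous_real continuous_intros)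
  have kui: "set_integrable lebesgue {0..R} (\<lambda>x. k x * u x)" for R
    by (intro absolutely_integrable_mult_continuous ki continuous_on_subset[OF uc]) auto
  define F where "F x = integral {0..x} (\<lambda>t. k t * u t)" for x
  have F: "has_ac_deriv F (\<lambda>x. k x * u x)"
    by (rule has_ac_derivI) (simp_all add: kui F_def)
  have Fc: "continuous_on {0..} F" by (rule has_ac_deriv_continuous_on[OF F])
  have uF: "u R = integral {0..R} F" if R: "R \<ge> 0" for R
  proof -
    text \<open>Du Bois-Reymond: test against the primitive of the truncated residual \<open>u' - F\<close>.\<close>
    define e where "e x = (if x \<le> R then u' x - F x else 0)" for x
    \<comment> \<open>The primitive is normalised to vanish beyond \<open>R\<close>, hence lies in
      the form domain; its value at 0 stays arbitrary, which is what forces the constant in u' = F +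
      const to be 0.\<close>
    define v where "v x = (-1) * (LINT t:{x..}|lebesgue. e t)" for x
    have u'i: "set_integrable lebesgue {0..R} u'" by (rule has_ac_deriv_integrable[OF uL(3) order_refl])
    have Fi: "set_integrable lebesgue {0..R} F"
      by (intro absolutely_integrable_continuous_real continuous_on_subset[OF Fc]) auto
    have eR: "set_integrable lebesgue {0..R} e"
    proof -
      have "set_integrable lebesgue {0..R} e = set_integrable lebesgue {0..R} (\<lambda>x. u' x - F x)"
        by (rule set_integrable_cong) (auto simp: e_def)
      then show ?thesis using set_integral_diff(1)[OF u'i Fi] by simp
    qed
    have ei: "set_integrable lebesgue {0..} e"
      by (rule set_integrable_extend_0[OF eR]) (simp add: e_def)
    have v: "has_ac_deriv v e"
      by (rule has_ac_deriv_cong[OF has_ac_deriv_cmult[OF has_ac_deriv_tail[OF ei], of "-1"]]) (simp_all add: v_def)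
    have vc: "continuous_on {0..} v" by (rule has_ac_deriv_continuous_on[OF v])
    have v0: "v x = 0" if "x > R" for x
    proof -
      have "(LINT t:{x..}|lebesgue. e t) = (LINT t:{x..}|lebesgue. 0)"
        by (rule set_lebesgue_integral_cong) (use that in \<open>auto simp: e_def\<close>)
      then show ?thesis by (simp add: v_def)
    qed
    have L2v: "L2_half v"
    proof -
      have "compact (v ` {0..R})"
        by (intro compact_continuous_image continuous_on_subset[OF vc]) auto
      then obtain B where B: "\<And>x. x \<in> {0..R} \<Longrightarrow> norm (v x) \<le> B"
        using compact_imp_bounded[of "v ` {0..R}"] unfolding bounded_iff by blast
      show ?thesis
      proof (rule L2_half_continuous[OF vc])
        have "integrable lebesgue (\<lambda>x. indicat_real {0..R} x * B\<^sup>2)"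
          using R by (intro integrable_mult_left integrable_real_indicator) auto
        then show "set_integrable lebesgue {0..} (\<lambda>x. indicat_real {0..R} x * B\<^sup>2)"
          unfolding set_integrable_def by (intro integrable_mult_indicator) auto
        show "(cmod (v x))\<^sup>2 \<le> indicat_real {0..R} x * B\<^sup>2" if "x \<ge> 0" for x
          using B[of x] v0[of x] that by (cases "x \<le> R") (auto intro!: power_mono)
      qed
    qed
    have L2e: "L2_half e"
    proof -
      have "L2_half (\<lambda>x. if x \<le> R then u' x else 0)"
        by (rule L2_half_truncate, use uL(2) in \<open>simp add: L2_half_def\<close>,
            rule set_integrable_subset[of _ "{0..}"]) (use uL(2) in \<open>auto simp: L2_half_def\<close>)
      moreover have "L2_half (\<lambda>x. if x \<le> R then F x else 0)"
        by (intro L2_half_truncate absolutely_integrable_continuous_real continuous_intros continuous_on_subset[OF Fc])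
           (auto simp: set_borel_measurable_def half_line_measurable[OF Fc])
      ultimately have "L2_half (\<lambda>x. (if x \<le> R then u' x else 0) + (-1) * (if x \<le> R then F x else 0))"
        by (intro L2_half_add L2_half_cmult)
      moreover have "(\<lambda>x. (if x \<le> R then u' x else 0) + (-1) * (if x \<le> R then F x else 0)) = e"
        by (rule ext) (simp add: e_def)
      ultimately show ?thesis by simp
    qed
    have H1v: "H1_half v e" using L2v L2e v by (simp add: H1_half_def)
    have vcR: "continuous_on {0..R} (\<lambda>x. cnj (v x))"
      by (intro continuous_intros continuous_on_subset[OF vc]) auto
    have i1: "set_integrable lebesgue {0..} (\<lambda>x. u' x * cnj (e x))"
      by (rule L2_half_mult_integrable[OF uL(2) L2_half_cnj[OF L2e]])
    have i2: "set_integrable lebesgue {0..} (\<lambda>x. of_real (V x) * (u x * cnj (v x)))"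
    proof (rule set_integrable_extend_0)
      have "set_integrable lebesgue {0..R} (\<lambda>x. of_real (V x) * (u x * cnj (v x)))"
        by (intro absolutely_integrable_mult_continuous Vi continuous_on_mult continuous_on_subset[OF uc] vcR) auto
      then show "set_integrable lebesgue {0..R} (\<lambda>x. of_real (V x) * (u x * cnj (v x)))" .
    qed (simp add: v0)
    have i3: "set_integrable lebesgue {0..} (\<lambda>x. of_real \<mu> * u x * cnj (v x))"
      unfolding mult.assoc by (rule set_integrable_mult_right) (rule L2_half_mult_integrable[OF uL(1) L2_half_cnj[OF L2v]])
    have i4: "set_integrable lebesgue {0..} (\<lambda>x. F x * cnj (e x))"
    proof (rule set_integrable_extend_0)
      have "set_integrable lebesgue {0..R} (\<lambda>x. cnj (e x))"
        by (rule has_ac_deriv_integrable[OF has_ac_deriv_cnj[OF v] order_refl])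
      then show "set_integrable lebesgue {0..R} (\<lambda>x. F x * cnj (e x))"
        by (intro absolutely_integrable_mult_continuous continuous_on_subset[OF Fc]) auto
    qed (simp add: e_def)
    have "(LINT x:{0..}|lebesgue. (u' x * cnj (e x) + of_real (V x) * (u x * cnj (v x))) - of_real \<mu> * u x * cnj (v x)) = 0"
      using weak[OF H1v] set_integral_diff(2)[OF set_integral_add(1)[OF i1 i2] i3] by simp
    \<comment> \<open>Integration by parts moves the zeroth-order terms onto \<open>F\<close>. The
      boundary terms vanish because F(0) = 0 and because \<open>v\<close> vanishes beyond
      \<open>R\<close>; with the weak identity this gives equal pairings of u' and F with e.\<close>
    moreover have "(LINT x:{0..}|lebesgue. ((of_real (V x) * (u x * cnj (v x))) - of_real \<mu> * u x * cnj (v x)) + F x * cnj (e x)) = 0 - F 0 * cnj (v 0)"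
    proof (rule has_ac_deriv_LINT)
      show "has_ac_deriv (\<lambda>x. F x * cnj (v x)) (\<lambda>x. ((of_real (V x) * (u x * cnj (v x))) - of_real \<mu> * u x * cnj (v x)) + F x * cnj (e x))"
        by (rule has_ac_deriv_cong[OF has_ac_deriv_mult[OF F has_ac_deriv_cnj[OF v]]]) (simp_all add: k_def algebra_simps)
      show "set_integrable lebesgue {0..} (\<lambda>x. ((of_real (V x) * (u x * cnj (v x))) - of_real \<mu> * u x * cnj (v x)) + F x * cnj (e x))"
        by (rule set_integral_add(1)[OF set_integral_diff(1)[OF i2 i3] i4])
      have "\<forall>\<^sub>F x in at_top. 0 = F x * cnj (v x)"
        using eventually_gt_at_top[of R] by eventually_elim (simp add: v0)
      then show "((\<lambda>x. F x * cnj (v x)) \<longlongrightarrow> 0) at_top"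
        by (rule Lim_transform_eventually[OF tendsto_const])
    qed
    moreover have "F 0 = 0" by (simp add: F_def)
    moreover have "A = D" if "(A + B) - C = 0" "(B - C) + D = 0 - F0 * v'" "F0 = 0" for A B C D F0 v' :: complex
      using that by algebra
    ultimately have "(LINT x:{0..}|lebesgue. u' x * cnj (e x)) = (LINT x:{0..}|lebesgue. F x * cnj (e x))"
      unfolding set_integral_diff(2)[OF set_integral_add(1)[OF i1 i2] i3] set_integral_add(2)[OF i1 i2]
        set_integral_add(2)[OF set_integral_diff(1)[OF i2 i3] i4] set_integral_diff(2)[OF i2 i3]
      by blast
    then have "(LINT x:{0..}|lebesgue. u' x * cnj (e x) - F x * cnj (e x)) = 0"
      using set_integral_diff(2)[OF i1 i4] by simp
    moreover have "(LINT x:{0..}|lebesgue. u' x * cnj (e x) - F x * cnj (e x)) = (LINT x:{0..}|lebesgue. of_real ((cmod (e x))\<^sup>2))"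
      by (rule set_lebesgue_integral_cong) (auto simp: e_def complex_norm_square left_diff_distrib simp del: of_real_power)
    moreover have "(LINT x:{0..}|lebesgue. complex_of_real ((cmod (e x))\<^sup>2)) = of_real (LINT x:{0..}|lebesgue. (cmod (e x))\<^sup>2)"
      unfolding set_lebesgue_integral_def integral_complex_of_real[symmetric]
      by (simp only: scaleR_conv_of_real of_real_mult of_real_eq_id id_apply)
    ultimately have "(LINT x:{0..}|lebesgue. (cmod (e x))\<^sup>2) = 0" by (simp only: of_real_eq_0_iff)
    moreover have "integrable lebesgue (\<lambda>x. indicat_real {0..} x *\<^sub>R (cmod (e x))\<^sup>2)"
      using L2e by (simp add: L2_half_def set_integrable_def)
    ultimately have "AE x in lebesgue. indicat_real {0..} x *\<^sub>R (cmod (e x))\<^sup>2 = 0"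
      unfolding set_lebesgue_integral_def
      by (subst (asm) integral_nonneg_eq_0_iff_AE) auto
    \<comment> \<open>The weak derivative is fixed only up to a null set; equality almost everywhere
      is enough, since it is integrated next.\<close>
    then have AE0: "AE x in lebesgue. x \<in> {0..R} \<longrightarrow> u' x = F x"
      by eventually_elim (auto simp: e_def split: split_indicator_asm)
    have "u R = (LINT t:{0..R}|lebesgue. u' t)" using has_ac_derivD(3)[OF uL(3) R] u(2) by simp
    also have "\<dots> = (LINT t:{0..R}|lebesgue. F t)"
      unfolding set_lebesgue_integral_def
      by (rule integral_cong_AE)
         (use u'i Fi AE0 in \<open>auto simp: set_integrable_def elim!: eventually_mono split: split_indicator\<close>)
    also have "\<dots> = integral {0..R} F" by (rule set_lebesgue_integral_eq_integral(2)[OF Fi])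
    finally show ?thesis .
  qed
  show ?thesis
  proof (rule has_ac_deriv_ivp_unique[OF _ u(2) F _ ki \<open>x \<ge> 0\<close>])
    show "has_ac_deriv u F"
      by (rule has_ac_derivI) (use uF u(2) in \<open>auto intro!: absolutely_integrable_continuous_real continuous_on_subset[OF Fc]\<close>)
  qed (simp add: F_def)
qed

text \<open>Testing the eigenfunction with the decaying Jost solution gives u(0) w = 0. If w were
  nonzero, u(0) = 0 would follow, and \<open>weak_solution_0\<close> would make the eigenfunction
  trivial.\<close>

lemma eigenvalue_imp_bound_momentum:
  assumes "t > 0" "is_eigenvalue \<gamma> V (- t\<^sup>2)"
  shows "w \<gamma> (\<i> * of_real t) = 0"
proof (rule ccontr)
  let ?a = "\<i> * complex_of_real t"
  have a: "Im ?a > 0" using assms by simp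
  assume nz: "w \<gamma> ?a \<noteq> 0"
  obtain u u' where ne: "\<exists>x\<ge>0. u x \<noteq> 0" and u: "H1_half u u'"
    and weak: "\<And>v v'. H1_half v v' \<Longrightarrow> schroedinger_form \<gamma> V u u' v v' = (LINT x:{0..}|lebesgue. of_real (- t\<^sup>2) * u x * cnj (v x))"
    using assms(2) unfolding is_eigenvalue_def schroedinger_op_def by blast
  have "(LINT x:{0..}|lebesgue. u' x * cnj (\<theta>' ?a x) + of_real (V x) * (u x * cnj (\<theta> ?a x)))
      = (LINT x:{0..}|lebesgue. \<theta>' ?a x * u' x + of_real (V x) * (\<theta> ?a x * u x))"
    using \<theta>_real[of t] assms(1) by (intro set_lebesgue_integral_cong) (auto simp: mult.commute)
  moreover have "(LINT x:{0..}|lebesgue. of_real (- t\<^sup>2) * u x * cnj (\<theta> ?a x)) = ?a\<^sup>2 * (LINT x:{0..}|lebesgue. \<theta> ?a x * u x)"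
  proof -
    have "(LINT x:{0..}|lebesgue. of_real (- t\<^sup>2) * u x * cnj (\<theta> ?a x)) = (LINT x:{0..}|lebesgue. ?a\<^sup>2 * (\<theta> ?a x * u x))"
      using \<theta>_real(1)[of t] assms(1) by (intro set_lebesgue_integral_cong) (auto simp: power_mult_distrib mult_ac)
    then show ?thesis by simp
  qed
  moreover have "cnj (\<theta> ?a 0) = \<theta> ?a 0" using \<theta>_real(1)[of t 0] assms(1) by simp
  \<comment> \<open>The weak identity and \<open>form_\<theta>\<close> evaluate the same pairing;
    only the boundary terms at 0 survive, and their difference is u(0) w.\<close>
  ultimately have "(?a\<^sup>2 * (LINT x:{0..}|lebesgue. \<theta> ?a x * u x) - \<theta>' ?a 0 * u 0) + of_real \<gamma> * (u 0 * \<theta> ?a 0)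
      = ?a\<^sup>2 * (LINT x:{0..}|lebesgue. \<theta> ?a x * u x)"
    using weak[OF H1_half_\<theta>[OF a]] form_\<theta>[OF u a] unfolding schroedinger_form_def by (simp only:)
  then have "of_real \<gamma> * (u 0 * \<theta> ?a 0) = \<theta>' ?a 0 * u 0"
    by (simp only: diff_add_eq diff_eq_eq add_left_cancel)
  then have "u 0 * w \<gamma> ?a = 0" by (simp add: w_eq algebra_simps)
  then have u0: "u 0 = 0" using nz by simp
  have "u x = 0" if "x \<ge> 0" for x
    by (rule weak_solution_0[OF u u0 _ that, of "- t\<^sup>2"]) (use weak u0 in \<open>simp add: schroedinger_form_def\<close>)
  then show False using ne by blast
qed

lemma negative_eigenvalues_eq: "negative_eigenvalues \<gamma> V = (\<lambda>t. - t\<^sup>2) ` bound_momenta \<gamma>"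
proof
  show "negative_eigenvalues \<gamma> V \<subseteq> (\<lambda>t. - t\<^sup>2) ` bound_momenta \<gamma>"
  proof
    fix \<mu> assume "\<mu> \<in> negative_eigenvalues \<gamma> V"
    then have \<mu>: "\<mu> < 0" "is_eigenvalue \<gamma> V \<mu>" by (auto simp: negative_eigenvalues_def)
    then have "\<mu> = - (sqrt (- \<mu>))\<^sup>2" "sqrt (- \<mu>) > 0" by simp_all
    moreover from this have "sqrt (- \<mu>) \<in> bound_momenta \<gamma>"
      using eigenvalue_imp_bound_momentum[of "sqrt (- \<mu>)" \<gamma>] \<mu>(2) by (simp add: bound_momenta_def)
    ultimately show "\<mu> \<in> (\<lambda>t. - t\<^sup>2) ` bound_momenta \<gamma>" by (metis image_eqI)
  qed
  show "(\<lambda>t. - t\<^sup>2) ` bound_momenta \<gamma> \<subseteq> negative_eigenvalues \<gamma> V"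
    by (auto simp: bound_momenta_def negative_eigenvalues_def bound_momentum_imp_eigenvalue)
qed

lemma finite_negative_eigenvalues: "finite (negative_eigenvalues \<gamma> V)"
  unfolding negative_eigenvalues_eq using finite_bound_momenta by simp

lemma card_negative_eigenvalues: "card (negative_eigenvalues \<gamma> V) = card (bound_momenta \<gamma>)"
  unfolding negative_eigenvalues_eq
  by (rule card_image) (auto simp: inj_on_def bound_momenta_def intro: power2_eq_imp_eq)

end

theorem theorem5p5:
  fixes \<gamma> :: real and V :: "real \<Rightarrow> real"
  assumes "set_borel_measurable lebesgue {0..} V"
    and "set_integrable lebesgue {0..} (\<lambda>x. (1 + x) * \<bar>V x\<bar>)"
  defines "N \<equiv> real (card (negative_eigenvalues \<gamma> V))"
  shows "finite (negative_eigenvalues \<gamma> V) \<and>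
    (\<exists>\<eta>0 \<eta>inf.
      (limit_phase \<gamma> V \<longlongrightarrow> \<eta>0) (at_right 0) \<and>
      (limit_phase \<gamma> V \<longlongrightarrow> \<eta>inf) at_top \<and>
      (jost_function \<gamma> V 0 \<noteq> 0 \<longrightarrow>
        \<eta>inf - \<eta>0 = (if \<gamma> > 0 then pi * N
                      else if \<gamma> = 0 then pi * (N - 1/2)
                      else pi * (N - 1))) \<and>
      (jost_function \<gamma> V 0 = 0 \<longrightarrow>
        \<eta>inf - \<eta>0 = (if \<gamma> > 0 then pi * (N + 1/2)
                      else if \<gamma> = 0 then pi * N
                      else pi * (N - 1/2))))"
proof -
  interpret half_line_potential V by unfold_locales (fact assms)+
  have w0: "jost_function \<gamma> V 0 = w \<gamma> 0" by (simp add: jost_function_eq)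
  \<comment> \<open>The phase vanishes at infinity, so the difference is minus its limit at 0; the
    three values of sgn \<gamma> give the three cases.\<close>
  show ?thesis
    unfolding w0 N_def card_negative_eigenvalues
    using limit_phase_limits[of \<gamma>]
    by (intro conjI exI finite_negative_eigenvalues) (auto simp: sgn_if algebra_simps)
qed

end
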